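(* Let $N\ge3$ and let $\mathcal B$ be the algebra with operations $\mu_k^{\mathbf w}$ described in the context. Then $\mathcal B$ satisfies the $A_\infty$-relations, and is therefore an $A_\infty$-algebra: for every $k\ge0$, every weight $\mathbf w$ and all $\tau_1,\dots,\tau_k\in\mathcal B$, $$\sum_{\mathbf w'+\mathbf w''=\mathbf w}\ \sum_{\substack{0\le r\le k\\0\le p\le k-r}}\mu^{\mathbf w'}_{k-r+1}\bigl(\tau_k,\dots,\tau_{p+r+1},\mu_r^{\mathbf w''}(\tau_{p+r},\dots,\tau_{p+1}),\tau_p,\dots,\tau_1\bigr)=0 .$$
   Context: **Algebra.** Fix $N\ge3$, $\mathbb F=\mathbb F_2$, $R=\mathbb F[V_0,\dots,V_{N+1}]$ (the $V_i$ are central). Indices of generators are read mod $N$. $\mathcal B$ is the $R$-algebra with orthogonal idempotents $J_1,\dots,J_N$ and generators $\rho_i,\sigma_i$, $1\le i\le N$. $\rho_i$ has initial and final idempotent $i$; $\sigma_i$ has initial idempotent $i$ and final idempotent $i+1$. Products are read right to left and vanish unless the initial idempotent of the left factor is the final idempotent of the right factor; also $\rho_i\rho_j=0$ and $\sigma_i\sigma_j=0$ for all $i,j$. So nonzero monomials alternate: $\cdots\rho_{i+1}\sigma_i\rho_i\sigma_{i-1}\cdots$. This product is the simple multiplication $\mu_2$. Let $U_0=\sum_{i=1}^N\sigma_{i+N-1}\rho_{i+N-1}\cdots\sigma_i\rho_i+\sum_{i=1}^N\rho_{i+N}\sigma_{i+N-1}\cdots\rho_{i+1}\sigma_i$ (the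 sum of all alternating monomials with exactly $N$ $\rho$'s and $N$ $\sigma$'s). The length $\ell(\tau)$ of a monomial is its number of $\sigma$-factors; $\ell(\tau_k,\dots,\tau_1)=\sum_p\ell(\tau_p)$. A weight is a finite $\mathbb Z_{\ge0}$-combination of $\varepsilon_0,\dots,\varepsilon_{N+1}$. All operations are $R$-multilinear and vanish unless the initial idempotent of $\tau_{p+1}$ is the final idempotent of $\tau_p$ for all $p$; scalar outputs are multiplied by the appropriate idempotent. The only nonzero operation with nonzero weight is $\mu_0^{\varepsilon_0}=U_0$; unweighted $\mu_0=0$. In addition to simple multiplication, unweighted $\mu_k$ for $1\le k\le N$ are defined on monomials by the following rules. **Case 1: $\ell(\tau_k,\dots,\tau_1)<N$.** The only operations are simple multiplication $\mu_2$ and the differential $\mu_1=\partial$ given by $\partial\rho_i=V_i$, $\partial\sigma_i=0$ and the Leibniz rule. **Case 2: $k=1$, $\ell(\tau)\ge N$.** Products over $\lambda$ run over $\lambda\in\{1,\dots,N+1\}$ with the indicated index omitted, so have $N$ factors. - $\tau=\sigma_j\rho_j\cdots\rho_{i+1}\sigma_i$: $\partial\tau=\prod_{\lambda\ne j+1}V_\lambda\cdot\tau^R+\prod_{\lambda\neq i}V_\lambda\cdot\tau^L$, where $\tau^R=\rho_{j+1}\sigma_j\cdots\rho_{i+1}\sigma_i$ (resp. $\tau^L=\sigma_j\rho_j\cdots\sigma_i\rho_i$), of length $\ell(\tau)-N$, is the part of $\tau$ remaining after removing the leftmost (resp. rightmost) block that contains $N$ $\sigma$'s and begins and ends in $\sigma$.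 - $\tau=\rho_{j+1}\sigma_j\cdots\rho_{i+1}\sigma_i$: $\partial\tau=V_{j+1}\,\sigma_j\rho_j\cdots\rho_{i+1}\sigma_i+\prod_{\lambda\ne i}V_\lambda\cdot(\rho_{j+1}\sigma_j\rho_j\cdots\sigma_i\rho_i)$, the last word, of length $\ell(\tau)-N$, being what remains after removing the rightmost such block. - $\tau=\sigma_j\rho_j\cdots\sigma_i\rho_i$: $\partial\tau=V_i\,\sigma_j\rho_j\cdots\rho_{i+1}\sigma_i+\prod_{\lambda\ne j+1}V_\lambda\cdot(\rho_{j+1}\sigma_j\cdots\rho_{i+1}\sigma_i\rho_i)$, the last word, of length $\ell(\tau)-N$, being what remains after removing the leftmost such block. - $\tau=\rho_{j+1}\sigma_j\cdots\sigma_i\rho_i$: $\partial\tau=V_{j+1}\,\sigma_j\rho_j\cdots\sigma_i\rho_i+V_i\,\rho_{j+1}\sigma_j\cdots\rho_{i+1}\sigma_i$. **Allowable sequences.** For $(\tau_k,\dots,\tau_1)$: (S1) means $\ell(\tau_k,\dots,\tau_p)\ge N$ for some $p>1$; (S2) means $\ell(\tau_p,\dots,\tau_1)\ge N$ for some $p<k$; the sequence stretches too far if both hold. It is left flanked if the leftmost factor of $\tau_k$ is a $\rho$, right flanked if the rightmost factor of $\tau_1$ is a $\rho$, doubly flanked if both, unflanked if neither. It is impermissibly flanked if it is left flanked with (S2) but not (S1), or right flanked with (S1) but not (S2), or doubly flanked. A sequence of total length $\ge N$ is allowable only when: $k\le N$; idempotents match; it does not stretch too far; it is not impermissibly flanked;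 each $\tau_p$ contains a $\sigma$ and begins and ends with $\sigma$, except that $\tau_k$ may begin and $\tau_1$ may end with a $\rho$. **Case 3: $k>1$, $\ell(\tau_k,\dots,\tau_1)\ge N$.** If the sequence is not allowable, $\mu_k(\tau_k,\dots,\tau_1)=0$. If it is allowable, then (each $B_\lambda$ below is either $\rho_\lambda$ or a comma, $|$ is the cut point, and the block on the $\sigma$-side of the cut contains exactly $N$ $\sigma$'s): - Unflanked, (S1) but not (S2): write $(\tau_k,\dots,\tau_1)=(\tau_k'\,|\,\sigma_{i+N-1}B_{i+N-1}\cdots B_{i+1}\sigma_i)$, with $i$ the initial idempotent of $\tau_1$ and $\tau_k'$ the leftover part of $\tau_k$; $\mu_k=\tau_k'\,V_{N+1}\prod\{V_\lambda:B_\lambda=\rho_\lambda\}$. - Unflanked, (S2) but not (S1): write $(\tau_k,\dots,\tau_1)=(\sigma_iB_i\sigma_{i-1}\cdots B_{i-N+2}\sigma_{i-N+1}\,|\,\tau_1')$, with $i+1$ the final idempotent of $\tau_k$ and $\tau_1'$ the leftover part of $\tau_1$; $\mu_k=V_{N+1}\prod\{V_\lambda:B_\lambda=\rho_\lambda\}\,\tau_1'$. - Unflanked, neither (S1) nor (S2): with $i$ and $j$ the initial and final idempotents of the sequence, it can be written both as $(\sigma_{j-1}B_{j-1}\sigma_{j-2}\cdots B_{j+1}\sigma_j\,|\,\tau_1')$ (cut from the left) and as $(\tau_k'\,|\,\sigma_{i+N-1}B_{i+N-1}\cdots B_{i+1}\sigma_i)$ (cut from the right), the $B_\lambda$ agreeing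 for each $\lambda$ which appears more than once; then $$\mu_k(\tau_k,\dots,\tau_1)=\tau_k'\,V_{N+1}\prod\{V_\lambda: j<\lambda<i \bmod N,\ B_\lambda=\rho_\lambda\}+\tau_1'\,V_{N+1}\prod\{V_\lambda: j<\lambda<i\bmod N,\ B_\lambda=\rho_\lambda\}.$$ - Left flanked of length $N$: write $(\rho_i\sigma_{i+N-1}B_{i+N-1}\cdots B_{i+1}\sigma_i)$; $\mu_k=\rho_iV_{N+1}\prod\{V_\lambda:B_\lambda=\rho_\lambda\}$. - Right flanked of length $N$: write $(\sigma_{i+N-1}B_{i+N-1}\cdots B_{i+1}\sigma_i\rho_i)$; $\mu_k=\rho_iV_{N+1}\prod\{V_\lambda:B_\lambda=\rho_\lambda\}$. - Left flanked of length $>N$: cut from the right, $(\tau_k'\,|\,\sigma_{i+N-1}B_{i+N-1}\cdots B_{i+1}\sigma_i)$, and $\mu_k=\tau_k'\,V_{N+1}\prod\{V_\lambda:B_\lambda=\rho_\lambda\}$. - Right flanked of length $>N$: cut from the left, $(\sigma_iB_i\cdots B_{i-N+2}\sigma_{i-N+1}\,|\,\tau_1')$, and $\mu_k=V_{N+1}\prod\{V_\lambda:B_\lambda=\rho_\lambda\}\,\tau_1'$.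
   Formalization: Two formulas are corrected, as the relations fail as printed: at total length exactly N the two equal terms (in ∂ and in unflanked μ_k with neither S1 nor S2) count once; in that unflanked case each term takes V_λ for all ρ_λ in its own removed block, not only j<λ<i. *)

theory Defs
  imports Complex_Main "HOL-Library.Poly_Mapping" "HOL-Library.Z2"
begin

text \<open>
  Polynomials over the two-element field \<^typ>\<open>bit\<close>, in variables indexed by all natural
  numbers; the ring $R = F_2[V_0, \dots, V_{N+1}]$ is the subset \<open>ground_ring N\<close>.
\<close>

type_synonym coeff = "(nat \<Rightarrow>\<^sub>0 nat) \<Rightarrow>\<^sub>0 bit"

definition V :: "nat \<Rightarrow> coeff" where
  "V i = Poly_Mapping.single (Poly_Mapping.single i 1) 1"

definition ground_ring :: "nat \<Rightarrow> coeff set" where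
  "ground_ring N = {c. \<forall>m \<in> Poly_Mapping.keys c. Poly_Mapping.keys m \<subseteq> {0..N + 1}}"


section \<open>The algebra\<close>

text \<open>Indices of generators and idempotents are represented by the residues $1, \dots, N$.\<close>

definition res :: "nat \<Rightarrow> nat \<Rightarrow> nat" where
  "res N a = (a + N - 1) mod N + 1"

datatype gen = is_rho: Rho (idx: nat) | is_sigma: Sig (idx: nat)

text \<open>The initial idempotent of a generator is its index.\<close>

fun gen_final :: "nat \<Rightarrow> gen \<Rightarrow> nat" where
  "gen_final N (Rho i) = i"
| "gen_final N (Sig i) = res N (i + 1)"

text \<open>
  Words are listed as they are written, so the head of the list is the leftmost factor and the
  initial idempotent of the word is that of the last entry. The monomials below form the
  $R$-basis of the algebra: all other products of generators vanish.
\<close>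

datatype mono = Idem nat | Word "gen list"

definition alternating :: "nat \<Rightarrow> gen list \<Rightarrow> bool" where
  "alternating N w \<longleftrightarrow> w \<noteq> [] \<and> (\<forall>g \<in> set w. idx g \<in> {1..N}) \<and>
     successively (\<lambda>g h. idx g = gen_final N h \<and> is_rho g \<noteq> is_rho h) w"

definition monomials :: "nat \<Rightarrow> mono set" where
  "monomials N = Idem ` {1..N} \<union> Word ` {w. alternating N w}"

type_synonym alg = "mono \<Rightarrow>\<^sub>0 coeff"

definition alg_carrier :: "nat \<Rightarrow> alg set" where
  "alg_carrier N = {x. Poly_Mapping.keys x \<subseteq> monomials N \<and>
                       (\<forall>m. Poly_Mapping.lookup x m \<in> ground_ring N)}"

definition basis :: "mono \<Rightarrow> alg" where
  "basis m = Poly_Mapping.single m 1"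

definition smul :: "coeff \<Rightarrow> alg \<Rightarrow> alg" where
  "smul c x = Poly_Mapping.map ((*) c) x"

fun letters :: "mono \<Rightarrow> gen list" where
  "letters (Idem i) = []"
| "letters (Word w) = w"

fun initial :: "mono \<Rightarrow> nat" where
  "initial (Idem i) = i"
| "initial (Word w) = idx (last w)"

fun final :: "nat \<Rightarrow> mono \<Rightarrow> nat" where
  "final N (Idem i) = i"
| "final N (Word w) = gen_final N (hd w)"

fun mono_mult :: "nat \<Rightarrow> mono \<Rightarrow> mono \<Rightarrow> alg" where
  "mono_mult N (Idem i) b = (if i = final N b then basis b else 0)"
| "mono_mult N (Word u) (Idem i) = (if idx (last u) = i then basis (Word u) else 0)"
| "mono_mult N (Word u) (Word v) =
     (if idx (last u) = gen_final N (hd v) \<and> is_rho (last u) \<noteq> is_rho (hd v)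
      then basis (Word (u @ v)) else 0)"

definition mult :: "nat \<Rightarrow> alg \<Rightarrow> alg \<Rightarrow> alg" where
  "mult N x y = (\<Sum>a \<in> Poly_Mapping.keys x. \<Sum>b \<in> Poly_Mapping.keys y.
     smul (Poly_Mapping.lookup x a * Poly_Mapping.lookup y b) (mono_mult N a b))"

definition U0 :: "nat \<Rightarrow> alg" where
  "U0 N =
     (\<Sum>i = 1..N. basis (Word (concat
        (map (\<lambda>t. [Sig (res N (i + t)), Rho (res N (i + t))]) (rev [0..<N]))))) +
     (\<Sum>i = 1..N. basis (Word (concat
        (map (\<lambda>t. [Rho (res N (i + t + 1)), Sig (res N (i + t))]) (rev [0..<N])))))"


section \<open>Lengths and cuts\<close>

definition sigmas :: "gen list \<Rightarrow> nat" where
  "sigmas w = length (filter is_sigma w)"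

definition len :: "mono \<Rightarrow> nat" where
  "len m = sigmas (letters m)"

definition total_len :: "mono list \<Rightarrow> nat" where
  "total_len ts = sum_list (map len ts)"

text \<open>\<open>split_sigmas n w\<close> splits \<open>w\<close> after its \<open>n\<close>-th \<open>\<sigma>\<close> from the left.\<close>

fun split_sigmas :: "nat \<Rightarrow> gen list \<Rightarrow> gen list \<times> gen list" where
  "split_sigmas 0 w = ([], w)"
| "split_sigmas (Suc n) [] = ([], [])"
| "split_sigmas (Suc n) (g # w) =
     (let (u, v) = split_sigmas (if is_sigma g then n else Suc n) w in (g # u, v))"

text \<open>
  When the word starts (ends) with a \<open>\<sigma>\<close>, the left (right) block begins and ends in \<open>\<sigma>\<close>
  and contains exactly \<open>N\<close> of them.
\<close>

definition left_block :: "nat \<Rightarrow> gen list \<Rightarrow> gen list" where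
  "left_block N w = fst (split_sigmas N w)"

definition left_rest :: "nat \<Rightarrow> gen list \<Rightarrow> gen list" where
  "left_rest N w = snd (split_sigmas N w)"

definition right_block :: "nat \<Rightarrow> gen list \<Rightarrow> gen list" where
  "right_block N w = rev (fst (split_sigmas N (rev w)))"

definition right_rest :: "nat \<Rightarrow> gen list \<Rightarrow> gen list" where
  "right_rest N w = rev (snd (split_sigmas N (rev w)))"

text \<open>An empty leftover part is read as an idempotent.\<close>

definition leftover :: "nat \<Rightarrow> gen list \<Rightarrow> alg" where
  "leftover i w = basis (if w = [] then Idem i else Word w)"


section \<open>The differential\<close>

fun diff_gen :: "gen \<Rightarrow> alg" where
  "diff_gen (Rho i) = smul (V i) (basis (Idem i))"
| "diff_gen (Sig i) = 0"

fun leibniz :: "nat \<Rightarrow> gen list \<Rightarrow> alg" where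
  "leibniz N [] = 0"
| "leibniz N [g] = diff_gen g"
| "leibniz N (g # h # w) =
     mult N (diff_gen g) (basis (Word (h # w))) + mult N (basis (Word [g])) (leibniz N (h # w))"

definition V_except :: "nat \<Rightarrow> nat \<Rightarrow> coeff" where
  "V_except N i = (\<Prod>l \<in> {1..N + 1} - {i}. V l)"

text \<open>
  For a word of length exactly \<open>N\<close> beginning and ending in \<open>\<sigma>\<close>, the leftmost and the rightmost
  block are the same block, namely the whole word. Its removal contributes one term: counting it
  twice would give $0$ over $F_2$, and the differential would not square to zero on
  $\rho_i \sigma_{i-1} \cdots \sigma_i$.
\<close>

fun diff :: "nat \<Rightarrow> mono \<Rightarrow> alg" where
  "diff N (Idem i) = 0"
| "diff N (Word w) =
     (let i = initial (Word w); f = final N (Word w);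
          cutL = smul (V_except N f) (leftover i (left_rest N w));
          cutR = smul (V_except N i) (leftover f (right_rest N w))
      in if sigmas w < N then leibniz N w
         else if is_sigma (hd w) \<and> is_sigma (last w) then
           (if sigmas w = N then cutR else cutL + cutR)
         else if is_rho (hd w) \<and> is_sigma (last w) then
           smul (V f) (basis (Word (tl w))) + cutR
         else if is_sigma (hd w) \<and> is_rho (last w) then
           smul (V i) (basis (Word (butlast w))) + cutL
         else
           smul (V f) (basis (Word (tl w))) + smul (V i) (basis (Word (butlast w))))"


section \<open>Operations on sequences\<close>

text \<open>
  A sequence $(\tau_k, \dots, \tau_1)$ is the list \<open>[\<tau>\<^sub>k, \<dots>, \<tau>\<^sub>1]\<close>; hence
  \<open>take q\<close> gives $(\tau_k, \dots, \tau_{k-q+1})$ and \<open>drop q\<close> gives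
  $(\tau_{k-q}, \dots, \tau_1)$.
\<close>

definition idempotents_match :: "nat \<Rightarrow> mono list \<Rightarrow> bool" where
  "idempotents_match N ts \<longleftrightarrow> successively (\<lambda>a b. initial a = final N b) ts"

definition S1 :: "nat \<Rightarrow> mono list \<Rightarrow> bool" where
  "S1 N ts \<longleftrightarrow> (\<exists>q < length ts. total_len (take q ts) \<ge> N)"

definition S2 :: "nat \<Rightarrow> mono list \<Rightarrow> bool" where
  "S2 N ts \<longleftrightarrow> (\<exists>q \<in> {1..<length ts}. total_len (drop q ts) \<ge> N)"

definition starts_rho :: "mono \<Rightarrow> bool" where
  "starts_rho m \<longleftrightarrow> letters m \<noteq> [] \<and> is_rho (hd (letters m))"

definition ends_rho :: "mono \<Rightarrow> bool" where
  "ends_rho m \<longleftrightarrow> letters m \<noteq> [] \<and> is_rho (last (letters m))"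

definition left_flanked :: "mono list \<Rightarrow> bool" where
  "left_flanked ts \<longleftrightarrow> starts_rho (hd ts)"

definition right_flanked :: "mono list \<Rightarrow> bool" where
  "right_flanked ts \<longleftrightarrow> ends_rho (last ts)"

definition stretches_too_far :: "nat \<Rightarrow> mono list \<Rightarrow> bool" where
  "stretches_too_far N ts \<longleftrightarrow> S1 N ts \<and> S2 N ts"

definition impermissibly_flanked :: "nat \<Rightarrow> mono list \<Rightarrow> bool" where
  "impermissibly_flanked N ts \<longleftrightarrow>
     (left_flanked ts \<and> S2 N ts \<and> \<not> S1 N ts) \<or>
     (right_flanked ts \<and> S1 N ts \<and> \<not> S2 N ts) \<or>
     (left_flanked ts \<and> right_flanked ts)"

definition allowable :: "nat \<Rightarrow> mono list \<Rightarrow> bool" where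
  "allowable N ts \<longleftrightarrow>
     length ts \<le> N \<and> idempotents_match N ts \<and>
     \<not> stretches_too_far N ts \<and> \<not> impermissibly_flanked N ts \<and>
     (\<forall>t \<in> set ts. len t > 0) \<and>
     (\<forall>t \<in> set (tl ts). \<not> starts_rho t) \<and>
     (\<forall>t \<in> set (butlast ts). \<not> ends_rho t)"

text \<open>
  Here \<open>b\<close> is the block on the \<open>\<sigma>\<close>-side of the cut, with its commas dropped; so
  $B_\lambda = \rho_\lambda$ means that $\rho_\lambda$ occurs in \<open>b\<close>.
\<close>

definition block_coeff :: "nat \<Rightarrow> gen list \<Rightarrow> coeff" where
  "block_coeff N b = V (N + 1) * (\<Prod>l \<in> {l. Rho l \<in> set b}. V l)"

definition seq_word :: "mono list \<Rightarrow> gen list" where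
  "seq_word ts = concat (map letters ts)"

text \<open>
  For allowable sequences the leftover of the cut from the left is a part of $\tau_1$ and that of
  the cut from the right is a part of $\tau_k$.
\<close>

definition cut_from_left :: "nat \<Rightarrow> mono list \<Rightarrow> alg" where
  "cut_from_left N ts =
     smul (block_coeff N (left_block N (seq_word ts)))
          (leftover (initial (last ts)) (left_rest N (seq_word ts)))"

definition cut_from_right :: "nat \<Rightarrow> mono list \<Rightarrow> alg" where
  "cut_from_right N ts =
     smul (block_coeff N (right_block N (seq_word ts)))
          (leftover (final N (hd ts)) (right_rest N (seq_word ts)))"

text \<open>
  The flanked cases of length \<open>N\<close> and of length \<open>> N\<close> have the same formula; for length \<open>N\<close>
  the leftover is the flanking $\rho_i$.

  In the unflanked case with neither (S1) nor (S2), each of the two terms carries the $V_\lambda$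
  with $B_\lambda = \rho_\lambda$ of its own removed block, as in all the other cases. Taking in
  both terms only the $\lambda$ strictly between \<open>j\<close> and \<open>i\<close> mod \<open>N\<close> (the positions common to
  both blocks) breaks the relations when the total length exceeds \<open>N\<close>: for $N = 3$, look at the
  relation for $(\rho_2\sigma_1\rho_1\sigma_3,\ \sigma_2\rho_2\sigma_1)$, where
  $\mu_2(\sigma_1\rho_1\sigma_3, \sigma_2\rho_2\sigma_1)$ has to be
  $V_4 V_2\, \sigma_1\rho_1 + V_4 V_1\, \rho_2\sigma_1$. When the total length is \<open>N\<close>, both cuts
  remove the same block, the whole sequence, and it is counted once.
\<close>

definition long_op :: "nat \<Rightarrow> mono list \<Rightarrow> alg" where
  "long_op N ts =
     (if left_flanked ts then cut_from_right N ts
      else if right_flanked ts then cut_from_left N ts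
      else if S1 N ts then cut_from_right N ts
      else if S2 N ts then cut_from_left N ts
      else if total_len ts = N then cut_from_right N ts
      else cut_from_right N ts + cut_from_left N ts)"

definition simple_mult :: "nat \<Rightarrow> mono list \<Rightarrow> alg" where
  "simple_mult N ts = (if length ts = 2 then mono_mult N (ts ! 0) (ts ! 1) else 0)"

definition mu_mono :: "nat \<Rightarrow> mono list \<Rightarrow> alg" where
  "mu_mono N ts =
     (if length ts = 0 then 0
      else if length ts = 1 then diff N (hd ts)
      else simple_mult N ts +
        (if total_len ts \<ge> N \<and> allowable N ts then long_op N ts else 0))"


section \<open>The weighted operations\<close>

text \<open>
  A weight is the finitely supported function of its coefficients on
  $\varepsilon_0, \dots, \varepsilon_{N+1}$.
\<close>

type_synonym weight = "nat \<Rightarrow>\<^sub>0 nat"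

definition weights :: "nat \<Rightarrow> weight set" where
  "weights N = {w. Poly_Mapping.keys w \<subseteq> {0..N + 1}}"

definition eps :: "nat \<Rightarrow> weight" where
  "eps i = Poly_Mapping.single i 1"

text \<open>\<open>mu N w [x\<^sub>k, \<dots>, x\<^sub>1]\<close> is $\mu_k^{w}(x_k, \dots, x_1)$.\<close>

definition mu :: "nat \<Rightarrow> weight \<Rightarrow> alg list \<Rightarrow> alg" where
  "mu N w xs =
     (if w = 0 then
        (\<Sum>ms \<in> listset (map Poly_Mapping.keys xs).
           smul (prod_list (map2 Poly_Mapping.lookup xs ms)) (mu_mono N ms))
      else if w = eps 0 \<and> xs = [] then U0 N
      else 0)"

text \<open>\<open>inputs \<tau> b a\<close> is the sequence $(\tau_b, \dots, \tau_a)$, empty if $b < a$.\<close>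

definition inputs :: "(nat \<Rightarrow> alg) \<Rightarrow> nat \<Rightarrow> nat \<Rightarrow> alg list" where
  "inputs \<tau> b a = map \<tau> (rev [a..<Suc b])"

end

theory Submission
  imports Defs
begin

text \<open>
  All operations are homogeneous for the multiplicative grading in which \<open>\<rho>\<^sub>i\<close> has weight \<open>V\<^sub>i\<close>,
  \<open>\<sigma>\<^sub>N\<close> has weight \<open>V\<^bsub>N+1\<^esub>\<close> and the other \<open>\<sigma>\<^sub>i\<close> have weight 1: a block containing
  each \<open>\<sigma>\<^sub>i\<close> once has exactly the weight by which its removal multiplies. Hence every term of a relation
  is determined by its output monomial, and one may set all \<open>V\<^sub>i = 1\<close>. The idempotents can then be forgotten
  as well, and a sequence becomes a word in \<open>\<rho>\<close>, \<open>\<sigma>\<close> and the comma.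

  In such words both the differential and the multiplication delete one letter (a \<open>\<rho>\<close> or a comma), words
  containing \<open>\<rho>\<rho>\<close> or \<open>\<sigma>\<sigma>\<close> being 0. The long operations remove a block of \<open>2N-1\<close> letters
  that alternate between \<open>\<sigma>\<close> and \<open>\<rho>\<close>-or-comma, at the right or at the left end. By the degree
  in \<open>V\<^bsub>N+1\<^esub>\<close> the relation splits into three parts. Deleting twice gives 0 mod 2. Two block removals
  cancel, since removing first the right and then the left block gives the same as the opposite order. In the
  commutator of deletion and block removal, a deletion inside a gap can be made in two ways, and the terms
  that survive correspond to windows of \<open>2N\<close> letters that cover all commas; only the first and the
  last window of each run of consecutive such windows occur, and all of them give the same output.
\<close>

section \<open>Words with commas\<close>

text \<open>A monomial is thus a final idempotent together with a pattern of letters. Multiplying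
  each monomial by its weight (\<open>rescale\<close>) is injective, since the coefficient ring has
  no zero divisors, and makes every term of a relation a common factor times a term without
  coefficients. The rules for allowable sequences do not look like cuts of a word. They say exactly
  when a cut leaves a word without commas: the leftover of a cut from the right runs over a comma if
  (S2) holds, that of a cut from the left if (S1) holds, and a flanking \<open>\<rho>\<close>
  forbids the cut at its own end. The relation of weight \<open>eps 0\<close> needs an argument of
  its own. For the short operations it says that \<open>U0\<close> is closed and central. In a long
  operation the two kinds of monomials of \<open>U0\<close> can only be entries at opposite ends of
  the sequence, and there they give the same palindromic output.\<close>

class char2_group = ab_group_add +
  assumes double_zero [simp]: "x + x = 0"
begin

text \<open>With \<open>double_zero\<close> and the AC rules this lets the simplifier cancel equal
  summands anywhere in a sum.\<close>

lemma add_left_cancel2 [simp]: "x + (x + y) = y"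
  by (simp add: add.assoc [symmetric])

end

instance bit :: char2_group
  by standard simp

instance poly_mapping :: (type, char2_group) char2_group
  by standard (rule poly_mapping_eqI, simp add: lookup_add)

text \<open>
  \<open>Cm\<close> is the comma between two entries, so an entry without letters, as in \<open>Cm Cm\<close>, is an idempotent.
  A linear combination of output words is represented by the value of its linear extension at an arbitrary
  function \<open>e\<close> on words; words that are 0 in the algebra are accounted for by requiring \<open>e\<close> to vanish there.
\<close>

datatype letter = Rh | Sg | Cm

fun dels :: "(letter list \<Rightarrow> 'a::comm_monoid_add) \<Rightarrow> letter list \<Rightarrow> 'a" where
  "dels f [] = 0"
| "dels f (a # w) = (if a = Sg then 0 else f w) + dels (\<lambda>x. f (a # x)) w"

fun splits :: "('b list \<Rightarrow> 'b list \<Rightarrow> 'a::comm_monoid_add) \<Rightarrow> 'b list \<Rightarrow> 'a" where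
  "splits F [] = F [] []"
| "splits F (a # w) = F [] (a # w) + splits (\<lambda>x. F (a # x)) w"

text \<open>Models an outer multiplication by the first entry: that entry stays outside while the
  inner operation acts on everything behind the first comma. A word without commas has no such
  term.\<close>

fun firstc :: "(letter list \<Rightarrow> letter list \<Rightarrow> 'a::comm_monoid_add) \<Rightarrow> letter list \<Rightarrow> 'a" where
  "firstc F [] = 0"
| "firstc F (a # w) = (if a = Cm then F [] w else firstc (\<lambda>u. F (a # u)) w)"

definition lastc :: "(letter list \<Rightarrow> letter list \<Rightarrow> 'a::comm_monoid_add) \<Rightarrow> letter list \<Rightarrow> 'a" where
  "lastc F w = firstc (\<lambda>u v. F (rev v) (rev u)) (rev w)"

lemma dels_append: "dels f (u @ v) = dels (\<lambda>x. f (x @ v)) u + dels (\<lambda>x. f (u @ x)) v"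
  by (induction u arbitrary: f) (simp_all add: add_ac)

lemma dels_rev: "dels f (rev w) = dels (\<lambda>x. f (rev x)) w"
  by (induction w arbitrary: f) (simp_all add: dels_append add_ac)

lemma dels_add: "dels (\<lambda>x. f x + g x) w = dels f w + dels g w"
  by (induction w arbitrary: f g) (simp_all add: add_ac)

lemma dels_0 [simp]: "dels (\<lambda>x. 0) w = 0"
  by (induction w) simp_all

lemma dels_cong:
  assumes "\<And>u a v. w = u @ a # v \<Longrightarrow> a \<noteq> Sg \<Longrightarrow> f (u @ v) = g (u @ v)"
  shows "dels f w = dels g w"
  using assms
proof (induction w arbitrary: f g)
  case (Cons a w)
  have "dels (\<lambda>x. f (a # x)) w = dels (\<lambda>x. g (a # x)) w"
  proof (rule Cons.IH)
    fix u b v assume "w = u @ b # v" "b \<noteq> Sg"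
    then show "f (a # u @ v) = g (a # u @ v)" using Cons.prems [of "a # u" b v] by simp
  qed
  then show ?case using Cons.prems [of "[]" a w] by simp
qed simp

lemma dels_natural:
  assumes "T 0 = 0" and "\<And>x y. T (x + y) = T x + T y"
  shows "T (dels f w) = dels (\<lambda>x. T (f x)) w"
  by (induction w arbitrary: f) (simp_all add: assms)

text \<open>Two positions can be deleted in either order, with the same result.\<close>

lemma dels_dels: "dels (dels f) w = (0 :: 'a::char2_group)"
  by (induction w arbitrary: f) (simp_all add: dels_add add_ac)

lemma splits_cong:
  assumes "\<And>x y. x @ y = w \<Longrightarrow> F x y = G x y"
  shows "splits F w = splits G w"
  using assms
proof (induction w arbitrary: F G)
  case (Cons a w)
  have "splits (\<lambda>x. F (a # x)) w = splits (\<lambda>x. G (a # x)) w"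
    by (rule Cons.IH) (simp add: Cons.prems)
  then show ?case using Cons.prems [of "[]" "a # w"] by simp
qed simp

lemma splits_add: "splits (\<lambda>x y. F x y + G x y) w = splits F w + splits G w"
  by (induction w arbitrary: F G) (simp_all add: add_ac)

lemma splits_0 [simp]: "splits (\<lambda>x y. 0) w = 0"
  by (induction w) simp_all

lemma splits_zero: "(\<And>x y. x @ y = w \<Longrightarrow> F x y = 0) \<Longrightarrow> splits F w = 0"
  using splits_cong [of w F "\<lambda>x y. 0"] by simp

lemma splits_natural:
  assumes "T 0 = 0" and "\<And>x y. T (x + y) = T x + T y"
  shows "T (splits F w) = splits (\<lambda>x y. T (F x y)) w"
  by (induction w arbitrary: F) (simp_all add: assms)

lemma splits_append:
  "splits F (u @ a # v) = splits (\<lambda>x y. F x (y @ a # v)) u + splits (\<lambda>x. F (u @ a # x)) v"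
  by (induction u arbitrary: F) (simp_all add: add_ac)

lemma splits_rev: "splits F (rev w) = splits (\<lambda>x y. F (rev y) (rev x)) w"
  by (induction w arbitrary: F) (simp_all add: splits_append add_ac)

lemma splits_index: "splits F w = (\<Sum>i\<le>length w. F (take i w) (drop i w))"
  by (induction w arbitrary: F) (simp_all del: sum.atMost_Suc add: sum.atMost_Suc_shift)

text \<open>Being a block fixes the length of a piece, so sums over cut points of blocks reduce to
  one summand.\<close>

lemma splits_single:
  assumes "\<And>x y. x @ y = w \<Longrightarrow> length x \<noteq> n \<Longrightarrow> F x y = 0"
  shows "splits F w = (if n \<le> length w then F (take n w) (drop n w) else 0)"
proof -
  have "splits F w = (\<Sum>i\<le>length w. if i = n then F (take n w) (drop n w) else 0)"
    unfolding splits_index by (rule sum.cong) (auto intro!: assms)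
  then show ?thesis by simp
qed

lemma splits_single_right:
  assumes "\<And>x y. x @ y = w \<Longrightarrow> length y \<noteq> n \<Longrightarrow> F x y = 0"
  shows "splits F w = (if n \<le> length w then F (take (length w - n) w) (drop (length w - n) w) else 0)"
proof (cases "n \<le> length w")
  case True
  have "splits F w = (if length w - n \<le> length w
      then F (take (length w - n) w) (drop (length w - n) w) else 0)"
    using True by (intro splits_single assms) auto
  then show ?thesis using True by simp
next
  case False
  then show ?thesis using assms by (auto intro: splits_zero)
qed

lemma splits_assoc:
  "splits (\<lambda>x w. splits (F x) w) w = splits (\<lambda>w z. splits (\<lambda>x y. F x y z) w) w"
  by (induction w arbitrary: F) (simp_all add: splits_add add_ac)

text \<open>Both sides run over the cut points that lie behind the first comma.\<close>

lemma firstc_splits: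
  "firstc (\<lambda>u w. splits (\<lambda>x b. G u x b) w) S = splits (\<lambda>z b. firstc (\<lambda>u x. G u x b) z) S"
  by (induction S arbitrary: G) auto

lemma lastc_splits:
  "lastc (\<lambda>u v. splits (\<lambda>x b. G x b v) u) S = splits (\<lambda>x w. lastc (\<lambda>b v. G x b v) w) S"
proof -
  have "lastc (\<lambda>u v. splits (\<lambda>x b. G x b v) u) S =
    firstc (\<lambda>u v. splits (\<lambda>x b. G (rev b) (rev x) (rev u)) v) (rev S)"
    by (simp add: lastc_def splits_rev)
  also have "\<dots> = splits (\<lambda>z b. firstc (\<lambda>u x. G (rev b) (rev x) (rev u)) z) (rev S)"
    by (rule firstc_splits)
  finally show ?thesis by (simp add: lastc_def splits_rev)
qed

definition cfree :: "letter list \<Rightarrow> bool" where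
  "cfree w \<longleftrightarrow> Cm \<notin> set w"

lemma cfree_simps [simp]:
  "cfree []" "cfree (a # w) \<longleftrightarrow> a \<noteq> Cm \<and> cfree w" "cfree (u @ v) \<longleftrightarrow> cfree u \<and> cfree v"
  "cfree (rev u) = cfree u"
  by (auto simp: cfree_def)

lemma cfree_last: "cfree w \<Longrightarrow> w \<noteq> [] \<Longrightarrow> last w \<noteq> Cm"
  by (metis cfree_def last_in_set)

lemma cfree_hd: "cfree w \<Longrightarrow> w \<noteq> [] \<Longrightarrow> hd w \<noteq> Cm"
  by (metis cfree_def hd_in_set)

lemma firstc_cfree: "cfree w \<Longrightarrow> firstc F w = 0"
  by (induction w arbitrary: F) auto

lemma firstc_append: "cfree u \<Longrightarrow> firstc F (u @ Cm # v) = F u v"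
  by (induction u arbitrary: F) auto

lemma lastc_cfree: "cfree w \<Longrightarrow> lastc F w = 0"
  by (simp add: lastc_def firstc_cfree)

lemma lastc_append: "cfree v \<Longrightarrow> lastc F (u @ Cm # v) = F u v"
  by (simp add: lastc_def firstc_append)

lemma not_cfree_last: "\<not> cfree w \<Longrightarrow> \<exists>u v. w = u @ Cm # v \<and> cfree v"
  unfolding cfree_def by (metis split_list_last)

lemma not_cfree_first: "\<not> cfree w \<Longrightarrow> \<exists>u v. w = u @ Cm # v \<and> cfree u"
  unfolding cfree_def by (metis split_list_first)

text \<open>Only the splitting right behind the last comma has a nonzero summand. In this form the
  length of a block can be used, through \<open>splits_single\<close>, to locate that comma.\<close>

lemma lastc_conv:
  "lastc F w = splits (\<lambda>x y. if x \<noteq> [] \<and> last x = Cm \<and> cfree y then F (butlast x) y else 0) w"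
proof (cases "cfree w")
  case True
  then have "splits (\<lambda>x y. if x \<noteq> [] \<and> last x = Cm \<and> cfree y then F (butlast x) y else 0) w = 0"
    by (intro splits_zero) (auto dest: cfree_last)
  with True show ?thesis by (simp add: lastc_cfree)
next
  case False
  then obtain u v where w: "w = u @ Cm # v" and v: "cfree v" using not_cfree_last by blast
  have "splits (\<lambda>x y. if x \<noteq> [] \<and> last x = Cm \<and> cfree y then F (butlast x) y else 0) w = F u v"
  proof (subst splits_single [where n = "Suc (length u)"])
    fix x y assume xy: "x @ y = w" and n: "length x \<noteq> Suc (length u)"
    show "(if x \<noteq> [] \<and> last x = Cm \<and> cfree y then F (butlast x) y else 0) = 0"
    proof (rule ccontr)
      assume "\<not> ?thesis"
      then have x: "x \<noteq> []" "last x = Cm" and y: "cfree y" by (auto split: if_splits)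
      then obtain x' where x': "x = x' @ [Cm]" by (metis append_butlast_last_id)
      then have "x' @ Cm # y = u @ Cm # v" using xy w by simp
      then have "x' = u" using y v
        by (auto simp: append_eq_append_conv2 Cons_eq_append_conv append_eq_Cons_conv)
      with n x' show False by simp
    qed
  qed (simp_all add: w v)
  then show ?thesis by (simp add: w v lastc_append)
qed

section \<open>Blocks and cuts\<close>

text \<open>\<open>Rh\<close> and \<open>Cm\<close> are not distinguished: they are the two values
  that a gap \<open>B\<^sub>\<lambda>\<close> between consecutive sigmas can take.\<close>

definition gapped :: "letter list \<Rightarrow> bool" where
  "gapped w \<longleftrightarrow> successively (\<lambda>a b. (a = Sg) \<noteq> (b = Sg)) w"

text \<open>The odd length forces the last letter to be \<open>Sg\<close> as well, so there are
  \<open>n\<close> letters \<open>Sg\<close> and \<open>n - 1\<close> gaps. Writing the length with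
  \<open>Suc\<close> avoids truncated subtraction and excludes \<open>n = 0\<close>.\<close>

definition block :: "nat \<Rightarrow> letter list \<Rightarrow> bool" where
  "block n w \<longleftrightarrow> Suc (length w) = 2 * n \<and> hd w = Sg \<and> gapped w"

lemma gapped_simps [simp]:
  "gapped []" "gapped [a]"
  "gapped (a # b # w) \<longleftrightarrow> (a = Sg) \<noteq> (b = Sg) \<and> gapped (b # w)"
  by (simp_all add: gapped_def)

lemma gapped_append:
  "gapped (u @ v) \<longleftrightarrow> gapped u \<and> gapped v \<and> (u = [] \<or> v = [] \<or> (last u = Sg) \<noteq> (hd v = Sg))"
  by (auto simp: gapped_def successively_append_iff)

lemma gapped_Cons: "gapped (a # v) \<longleftrightarrow> gapped v \<and> (v = [] \<or> (a = Sg) \<noteq> (hd v = Sg))"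
  using gapped_append [of "[a]" v] by auto

lemma gapped_rev [simp]: "gapped (rev w) = gapped w"
  by (induction w) (auto simp: gapped_append gapped_Cons last_rev)

lemma gapped_nth: "gapped w \<Longrightarrow> i < length w \<Longrightarrow> (w ! i = Sg) \<longleftrightarrow> ((w ! 0 = Sg) \<longleftrightarrow> even i)"
proof (induction i)
  case (Suc i)
  then have "(w ! i = Sg) \<noteq> (w ! Suc i = Sg)"
    by (auto simp: gapped_def successively_conv_nth)
  with Suc show ?case by auto
qed simp

lemma block_last: "block n w \<Longrightarrow> last w = Sg"
proof -
  assume b: "block n w"
  then have "w \<noteq> []" by (auto simp: block_def)
  moreover from b this have "even (length w - 1)"
    by (auto simp: block_def elim: oddE evenE)
  ultimately show ?thesis using b gapped_nth [of w "length w - 1"]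
    by (auto simp: block_def last_conv_nth hd_conv_nth)
qed

lemma block_not_Nil: "block n w \<Longrightarrow> w \<noteq> []"
  by (auto simp: block_def)

lemma block_rev [simp]: "block n (rev w) = block n w"
  by (metis block_def block_last gapped_rev hd_rev length_rev rev_rev_ident)

lemma block_simps [simp]:
  "\<not> block n []" "a \<noteq> Sg \<Longrightarrow> \<not> block n (a # w)" "block n [Sg] \<longleftrightarrow> n = 1"
  "\<not> block n (Sg # Sg # w)" "a \<noteq> Sg \<Longrightarrow> block n (Sg # a # w) \<longleftrightarrow> block (n - 1) w"
  by (cases "w = []"; auto simp: block_def gapped_Cons; presburger)+

text \<open>An extra letter in the interior stands next to a gap, and deleting either of these two
  neighbours gives a block. The two terms cancel, so only an extra letter at an end
  survives.\<close>

lemma dels_block: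
  fixes c :: "'a::char2_group"
  shows "dels (\<lambda>b. if block n b then c else 0) w =
    (if w \<noteq> [] \<and> hd w \<noteq> Sg \<and> block n (tl w) then c else 0) +
    (if w \<noteq> [] \<and> last w \<noteq> Sg \<and> block n (butlast w) then c else 0)"
proof (induction w arbitrary: n rule: induct_list012)
  case (3 x y zs)
  consider "x \<noteq> Sg" | "x = Sg" "y = Sg" | "x = Sg" "y \<noteq> Sg" by blast
  then show ?case
  proof cases
    case 3
    have "block n (Sg # zs) \<longleftrightarrow> (if zs = [] then n = 1 else hd zs \<noteq> Sg \<and> block (n - 1) (tl zs))"
      by (cases zs; cases "hd zs = Sg") auto
    with 3 show ?thesis using "3.IH"(1) [of "n - 1"] by (auto simp: add_ac)
  qed auto
qed auto

text \<open>A deleted letter at the cut leaves a single cut there, but before the deletion it may be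
  counted in the left or in the right piece. The last sum removes the second count.\<close>

lemma dels_splits:
  fixes F :: "letter list \<Rightarrow> letter list \<Rightarrow> 'a::char2_group"
  shows "dels (splits F) S =
    splits (\<lambda>x b. dels (\<lambda>x. F x b) x + dels (F x) b) S +
    splits (\<lambda>x b. if b \<noteq> [] \<and> hd b \<noteq> Sg then F x (tl b) else 0) S"
proof (induction S arbitrary: F)
  case (Cons a S)
  have *: "splits (\<lambda>x b. dels (\<lambda>x. F x b) (a # x) + dels (F (a # x)) b) S =
      (if a = Sg then 0 else splits F S) +
      splits (\<lambda>x b. dels (\<lambda>x. F (a # x) b) x + dels (F (a # x)) b) S"
    by (simp add: splits_add add_ac)
  have "dels (splits F) (a # S) = (if a = Sg then 0 else splits F S) +
      dels (F []) (a # S) + dels (splits (\<lambda>x. F (a # x))) S + (if a = Sg then 0 else F [] S)"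
    by (simp add: dels_add add_ac)
  then show ?case
    unfolding splits.simps * Cons.IH by (simp add: add_ac)
qed simp

text \<open>
  The leftover of a cut from the right is followed by a \<open>\<sigma>\<close> of the block, so it must not end in \<open>\<sigma>\<close>.
\<close>

definition rho_right :: "(letter list \<Rightarrow> 'a::zero) \<Rightarrow> letter list \<Rightarrow> 'a" where
  "rho_right e x = (if cfree x \<and> (x = [] \<or> last x \<noteq> Sg) then e x else 0)"

definition cut_right :: "nat \<Rightarrow> (letter list \<Rightarrow> 'a::comm_monoid_add) \<Rightarrow> letter list \<Rightarrow> 'a" where
  "cut_right N e S = splits (\<lambda>x b. if block N b then rho_right e x else 0) S"

text \<open>Defined by reversal, so that statements about cuts from the left are mirror images and
  need no second proof.\<close>

definition cut_left :: "nat \<Rightarrow> (letter list \<Rightarrow> 'a::comm_monoid_add) \<Rightarrow> letter list \<Rightarrow> 'a" where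
  "cut_left N e S = cut_right N (\<lambda>x. e (rev x)) (rev S)"

definition cut_all :: "nat \<Rightarrow> (letter list \<Rightarrow> 'a::zero) \<Rightarrow> letter list \<Rightarrow> 'a" where
  "cut_all N e S = (if block N S then e [] else 0)"

text \<open>
  If the whole sequence is a block, the cuts from the right and from the left both have the empty leftover;
  adding \<open>cut_all\<close> makes that term occur once instead of twice.
\<close>

definition phi :: "nat \<Rightarrow> (letter list \<Rightarrow> 'a::comm_monoid_add) \<Rightarrow> letter list \<Rightarrow> 'a" where
  "phi N e S = cut_right N e S + cut_left N e S + cut_all N e S"

text \<open>By \<open>dels_block\<close> a deletion inside the block survives only at the two ends
  of the block. The term at the left end equals the correction in \<open>dels_splits\<close> and
  cancels with it.\<close>

lemma cut_right_dels:
  fixes e :: "letter list \<Rightarrow> 'a::char2_group"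
  shows "dels (cut_right N e) S =
    splits (\<lambda>x b. if block N b then dels (rho_right e) x else 0) S +
    splits (\<lambda>x b. if b \<noteq> [] \<and> last b \<noteq> Sg \<and> block N (butlast b) then rho_right e x else 0) S"
proof -
  have 1: "dels (\<lambda>x. if P then f x else 0) x = (if P then dels f x else 0)"
    for P and f :: "letter list \<Rightarrow> 'a" and x by simp
  show ?thesis
    unfolding cut_right_def dels_splits
    unfolding 1 dels_block splits_add [symmetric]
    by (rule splits_cong) (auto simp: add_ac)
qed

abbreviation ends_in_gap :: "letter list \<Rightarrow> bool" where
  "ends_in_gap x \<equiv> x \<noteq> [] \<and> last x \<noteq> Sg \<and> butlast x \<noteq> [] \<and> last (butlast x) = Sg \<and> cfree (butlast x)"

text \<open>Deleting the last letter of \<open>x\<close> can leave a word ending in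
  \<open>Sg\<close>, which \<open>rho_right\<close> rejects on the left-hand side. On the right-hand
  side the same word does occur: in the differential of the leftover if the letter is
  \<open>Rh\<close>, in the product with an empty second factor if it is the only comma. The last
  summand is this difference.\<close>

lemma dels_rho_right:
  fixes e :: "letter list \<Rightarrow> 'a::char2_group"
  shows "dels (rho_right e) x = rho_right (dels e) x +
    firstc (\<lambda>u. rho_right (\<lambda>y. e (u @ y))) x +
    (if ends_in_gap x
     then e (butlast x) else 0)"
proof (cases "cfree x")
  case True
  show ?thesis
  proof (cases x rule: rev_cases)
    case (snoc y a)
    have y: "cfree y" "a \<noteq> Cm" using True snoc by auto
    have z: "dels (\<lambda>z. rho_right e (z @ [a])) y = (if a = Sg then 0 else dels (\<lambda>z. e (z @ [a])) y)"
    proof (cases "a = Sg")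
      case False
      have "dels (\<lambda>z. rho_right e (z @ [a])) y = dels (\<lambda>z. e (z @ [a])) y"
        using y False by (intro dels_cong) (simp add: rho_right_def)
      with False show ?thesis by simp
    qed (simp add: rho_right_def)
    show ?thesis
      using y True by (auto simp: snoc dels_append z firstc_cfree) (auto simp: rho_right_def dels_append)
  qed (simp add: rho_right_def)
next
  case False
  then obtain u v where x: "x = u @ Cm # v" and u: "cfree u" using not_cfree_first by blast
  have 1: "dels (\<lambda>z. rho_right e (z @ Cm # v)) u = 0" "dels (\<lambda>z. rho_right e (u @ Cm # z)) v = 0"
    by (simp_all add: rho_right_def)
  have 2: "\<not> ends_in_gap x \<or>
      v = [] \<and> u \<noteq> [] \<and> last u = Sg"
    by (cases v rule: rev_cases) (auto simp: x butlast_append)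
  show ?thesis
    using u 2 by (cases "v = []") (auto simp: x dels_append 1 firstc_append rho_right_def)
qed

text \<open>On the left stand all ways to combine one cut from the right with one deletion: the
  outer differential, the outer product with the first and with the last entry, and the inner
  differential or product. In the sums on the right a block disappears together with one letter: the
  gap before it, the final letter of the word after it, or the last comma after it.\<close>

lemma cut_right_commutator:
  fixes e :: "letter list \<Rightarrow> 'a::char2_group"
  shows "cut_right N (dels e) S + firstc (\<lambda>u. cut_right N (\<lambda>x. e (u @ x))) S +
      lastc (\<lambda>u v. cut_right N (\<lambda>x. e (x @ v)) u) S + dels (cut_right N e) S =
    splits (\<lambda>x b. if block N b \<and> ends_in_gap x then e (butlast x) else 0) S +
    splits (\<lambda>x b. if b \<noteq> [] \<and> last b \<noteq> Sg \<and> block N (butlast b) then rho_right e x else 0) S +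
    splits (\<lambda>x. lastc (\<lambda>b v. if block N b then rho_right (\<lambda>x. e (x @ v)) x else 0)) S"
proof -
  have f: "firstc (\<lambda>u. cut_right N (\<lambda>x. e (u @ x))) S =
      splits (\<lambda>x b. if block N b then firstc (\<lambda>u. rho_right (\<lambda>y. e (u @ y))) x else 0) S"
  proof -
    have "firstc (\<lambda>u x. if P then f u x else 0) x = (if P then firstc f x else 0)"
      for P and f :: "letter list \<Rightarrow> letter list \<Rightarrow> 'a" and x
      by (induction x arbitrary: f) auto
    then show ?thesis unfolding cut_right_def firstc_splits by simp
  qed
  have l: "lastc (\<lambda>u v. cut_right N (\<lambda>x. e (x @ v)) u) S =
      splits (\<lambda>x. lastc (\<lambda>b v. if block N b then rho_right (\<lambda>x. e (x @ v)) x else 0)) S"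
    unfolding cut_right_def lastc_splits by (rule refl)
  have "cut_right N (dels e) S + firstc (\<lambda>u. cut_right N (\<lambda>x. e (u @ x))) S +
      splits (\<lambda>x b. if block N b then dels (rho_right e) x else 0) S =
    splits (\<lambda>x b. if block N b \<and> ends_in_gap x then e (butlast x) else 0) S"
    unfolding f unfolding cut_right_def splits_add [symmetric]
    by (rule splits_cong) (simp add: dels_rho_right add_ac)
  then show ?thesis
    unfolding cut_right_dels l by (simp add: add_ac)
qed

lemma firstc_add: "firstc (\<lambda>u v. F u v + G u v) w = firstc F w + firstc G w"
  by (induction w arbitrary: F G) simp_all

lemma lastc_add: "lastc (\<lambda>u v. F u v + G u v) w = lastc F w + lastc G w"
  by (simp add: lastc_def firstc_add)

lemma lastc_rev: "lastc F (rev w) = firstc (\<lambda>u v. F (rev v) (rev u)) w"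
  by (simp add: lastc_def)

lemma firstc_rev: "firstc F (rev w) = lastc (\<lambda>u v. F (rev v) (rev u)) w"
  by (simp add: lastc_def)

text \<open>
  What survives of the commutator of \<open>dels\<close> with the cuts from the right, together with half of the
  contribution of \<open>cut_all\<close>; the rest is the mirror image.
\<close>

definition mismatch :: "nat \<Rightarrow> (letter list \<Rightarrow> 'a::comm_monoid_add) \<Rightarrow> letter list \<Rightarrow> 'a" where
  "mismatch N e S =
    splits (\<lambda>x b. if block N b \<and> ends_in_gap x then e (butlast x) else 0) S +
    splits (\<lambda>x b. if b \<noteq> [] \<and> last b \<noteq> Sg \<and> block N (butlast b) then rho_right e x else 0) S +
    splits (\<lambda>x. lastc (\<lambda>b v. if block N b then rho_right (\<lambda>x. e (x @ v)) x else 0)) S +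
    (if S \<noteq> [] \<and> last S \<noteq> Sg \<and> block N (butlast S) then e [] else 0) +
    lastc (\<lambda>b v. if block N b then e v else 0) S"

lemma phi_commutator_mismatch:
  fixes e :: "letter list \<Rightarrow> 'a::char2_group"
  shows "phi N (dels e) S + firstc (\<lambda>u. phi N (\<lambda>x. e (u @ x))) S +
      lastc (\<lambda>u v. phi N (\<lambda>x. e (x @ v)) u) S + dels (phi N e) S =
    mismatch N e S + mismatch N (\<lambda>x. e (rev x)) (rev S)"
proof -
  let ?e = "\<lambda>x. e (rev x)"
  let ?R = "\<lambda>e S. cut_right N (dels e) S + firstc (\<lambda>u. cut_right N (\<lambda>x. e (u @ x))) S +
      lastc (\<lambda>u v. cut_right N (\<lambda>x. e (x @ v)) u) S + dels (cut_right N e) S"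
  have L: "cut_left N (dels e) S + firstc (\<lambda>u. cut_left N (\<lambda>x. e (u @ x))) S +
      lastc (\<lambda>u v. cut_left N (\<lambda>x. e (x @ v)) u) S + dels (cut_left N e) S = ?R ?e (rev S)"
    by (simp add: cut_left_def [abs_def] dels_rev lastc_rev firstc_rev add_ac)
  have E: "cut_all N (dels e) S + firstc (\<lambda>u. cut_all N (\<lambda>x. e (u @ x))) S +
      lastc (\<lambda>u v. cut_all N (\<lambda>x. e (x @ v)) u) S + dels (cut_all N e) S =
    ((if S \<noteq> [] \<and> last S \<noteq> Sg \<and> block N (butlast S) then e [] else 0) +
      lastc (\<lambda>b v. if block N b then e v else 0) S) +
    ((if rev S \<noteq> [] \<and> last (rev S) \<noteq> Sg \<and> block N (butlast (rev S)) then ?e [] else 0) +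
      lastc (\<lambda>b v. if block N b then ?e v else 0) (rev S))"
    unfolding cut_all_def lastc_rev
    by (simp add: dels_block last_rev butlast_rev add_ac cong: if_cong)
  have "phi N (dels e) S + firstc (\<lambda>u. phi N (\<lambda>x. e (u @ x))) S +
      lastc (\<lambda>u v. phi N (\<lambda>x. e (x @ v)) u) S + dels (phi N e) S =
    ?R e S +
    (cut_left N (dels e) S + firstc (\<lambda>u. cut_left N (\<lambda>x. e (u @ x))) S +
      lastc (\<lambda>u v. cut_left N (\<lambda>x. e (x @ v)) u) S + dels (cut_left N e) S) +
    (cut_all N (dels e) S + firstc (\<lambda>u. cut_all N (\<lambda>x. e (u @ x))) S +
      lastc (\<lambda>u v. cut_all N (\<lambda>x. e (x @ v)) u) S + dels (cut_all N e) S)"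
    unfolding phi_def by (simp only: firstc_add lastc_add dels_add) (simp only: add_ac)
  also note L
  also note E
  also note cut_right_commutator
  also note cut_right_commutator
  finally show ?thesis unfolding mismatch_def by (simp only: add_ac)
qed

section \<open>Cancellation of the windows left over from the commutator\<close>

definition altw :: "letter list \<Rightarrow> bool" where
  "altw w \<longleftrightarrow> cfree w \<and> gapped w"

text \<open>For a joined sequence this says that the entries are nonempty and alternating and that
  each letter next to a comma is \<open>Sg\<close>, the shape of the input of a long
  operation.\<close>

definition good :: "letter list \<Rightarrow> bool" where
  "good S \<longleftrightarrow> gapped S \<and> S \<noteq> [] \<and> hd S \<noteq> Cm \<and> last S \<noteq> Cm"

lemma good_rev [simp]: "good (rev S) = good S"
  by (auto simp: good_def hd_rev last_rev)

lemma gapped_block: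
  assumes "gapped S" "i + 2 * N \<le> Suc (length S)" "N \<ge> 1" "S ! i = Sg"
  shows "block N (take (2 * N - 1) (drop i S))"
proof -
  have "gapped (take i S @ take (2 * N - 1) (drop i S) @ drop (2 * N - 1) (drop i S))"
    using assms(1) by (simp only: append_take_drop_id)
  then have "gapped (take (2 * N - 1) (drop i S))"
    by (simp only: gapped_append)
  then show ?thesis using assms by (simp add: block_def hd_drop_conv_nth)
qed

text \<open>
  Every surviving term removes a window of \<open>2 * N\<close> letters from \<open>S\<close>. The first summand is the window
  at the right end; the others are windows ending in a comma, which cannot be moved to the left.
\<close>

lemma mismatch_good:
  fixes e :: "letter list \<Rightarrow> 'a::char2_group"
  assumes S: "good S" and N: "N \<ge> 1"
  defines "K \<equiv> length S - 2 * N"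
  shows "mismatch N e S = (if K > 0 then
    (if cfree (take K S) then e (take K S) else 0) +
    (\<Sum>i = 1..K. if cfree (take i S) \<and> cfree (drop (i + 2 * N) S) \<and> S ! (i + 2 * N - 1) = Cm
       then e (take i S @ drop (i + 2 * N) S) else 0) else 0)"
proof -
  let ?W = "\<Sum>i = 1..K. if cfree (take i S) \<and> cfree (drop (i + 2 * N) S) \<and> S ! (i + 2 * N - 1) = Cm
    then e (take i S @ drop (i + 2 * N) S) else 0"
  let ?M = "length S"
  have g: "gapped S" and S0: "S \<noteq> []" and lS: "last S \<noteq> Cm" using S by (auto simp: good_def)
  have par: "(S ! j = Sg) \<longleftrightarrow> ((S ! i = Sg) \<longleftrightarrow> even i = even j)" if "i < ?M" "j < ?M" for i j
    using gapped_nth [OF g that(1)] gapped_nth [OF g that(2)] by auto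
  have last: "last (take i S) = S ! (i - 1)" if "0 < i" "i \<le> ?M" for i
  proof -
    have "take i S \<noteq> []" "length (take i S) = i" using that by auto
    then show ?thesis using that by (simp add: last_conv_nth)
  qed
  define A1 where "A1 = splits (\<lambda>x b. if block N b \<and> ends_in_gap x then e (butlast x) else 0) S"
  define A2 where "A2 = splits (\<lambda>x b. if b \<noteq> [] \<and> last b \<noteq> Sg \<and> block N (butlast b) then rho_right e x else 0) S"
  define E1 where "E1 = (if S \<noteq> [] \<and> last S \<noteq> Sg \<and> block N (butlast S) then e [] else 0)"
  have "A1 = (if 2 * N - 1 \<le> ?M then
       (let x = take (?M - (2 * N - 1)) S; b = drop (?M - (2 * N - 1)) S in
        if block N b \<and> ends_in_gap x then e (butlast x) else 0) else 0)"
    unfolding A1_def Let_def by (rule splits_single_right) (auto simp: block_def)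
  \<comment> \<open>The last \<open>2 * N\<close> letters disappear: the block at the right end and
    the gap in front of it, which is \<open>S ! K\<close>.\<close>
  also have "\<dots> = (if K > 0 \<and> S ! K \<noteq> Sg \<and> cfree (take K S) then e (take K S) else 0)"
  proof (cases "K > 0")
    case True
    then have K: "?M - (2 * N - 1) = Suc K" "Suc K < ?M" "Suc K + 2 * N = Suc ?M"
      using N by (auto simp: K_def)
    have b: "block N (drop (Suc K) S) \<longleftrightarrow> S ! Suc K = Sg"
      using gapped_block [OF g, of "Suc K" N] K N by (auto simp: block_def hd_drop_conv_nth)
    have bl: "butlast (take (Suc K) S) = take K S" using K by (simp add: butlast_take)
    show ?thesis using True K b par [of K "Suc K"] par [of "K - 1" K] last [of K] last [of "Suc K"]
      by (auto simp: bl Let_def)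
  next
    case False
    then show ?thesis by (auto simp: K_def Let_def butlast_take)
  qed
  finally have A1: "A1 = (if K > 0 \<and> S ! K \<noteq> Sg \<and> cfree (take K S) then e (take K S) else 0)" .
  have "A2 = (if 2 * N \<le> ?M then
       (let x = take (?M - (2 * N)) S; b = drop (?M - (2 * N)) S in
        if b \<noteq> [] \<and> last b \<noteq> Sg \<and> block N (butlast b) then rho_right e x else 0) else 0)"
    unfolding A2_def Let_def by (rule splits_single_right) (use N in \<open>auto simp: block_def\<close>)
  \<comment> \<open>Again the last \<open>2 * N\<close> letters disappear, now as a block starting
    at \<open>K\<close> followed by the final letter, so the condition on \<open>S ! K\<close> is
    complementary to that of \<open>A1\<close>. The case \<open>K = 0\<close> is \<open>E1\<close>,
    which occurs once more in \<open>mismatch\<close>.\<close>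
  also have "\<dots> = (if K > 0 \<and> S ! K = Sg \<and> cfree (take K S) then e (take K S) else 0) + E1"
  proof (cases "2 * N \<le> ?M")
    case True
    then have K: "K < ?M" "K + 2 * N = ?M" using N by (auto simp: K_def)
    have lp: "last S \<noteq> Sg \<longleftrightarrow> S ! K = Sg"
    proof -
      have "?M - 1 = K + (2 * N - 1)" using K N by simp
      then have "even (?M - 1) \<noteq> even K" using N by auto
      with par [of K "?M - 1"] K show ?thesis using S0 by (auto simp: last_conv_nth)
    qed
    have bl: "butlast (drop K S) = take (2 * N - 1) (drop K S)"
    proof -
      have "length (drop K S) - 1 = 2 * N - 1" unfolding length_drop using K by simp
      then show ?thesis by (simp only: butlast_conv_take)
    qed
    have b: "block N (butlast (drop K S)) \<longleftrightarrow> S ! K = Sg"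
      using gapped_block [OF g, of K N] K N unfolding bl by (auto simp: block_def hd_drop_conv_nth)
    have rr: "S ! K = Sg \<Longrightarrow> rho_right e (take K S) = (if cfree (take K S) then e (take K S) else 0)"
      using par [of "K - 1" K] K last [of K] by (auto simp: rho_right_def)
    have E1: "E1 = (if K = 0 \<and> S ! K = Sg then e [] else 0)"
      using lp b K N by (auto simp: E1_def S0 block_def hd_conv_nth)
    show ?thesis using True lp b rr K E1 by (auto simp: Let_def K_def)
  next
    case False
    then show ?thesis by (auto simp: K_def E1_def block_def)
  qed
  finally have A2: "A2 = (if K > 0 \<and> S ! K = Sg \<and> cfree (take K S) then e (take K S) else 0) + E1" .
  let ?G = "\<lambda>x. lastc (\<lambda>b v. if block N b then rho_right (\<lambda>x. e (x @ v)) x else 0)"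
  have G0: "?G [] S = lastc (\<lambda>b v. if block N b then e v else 0) S"
    by (simp add: rho_right_def cong: if_cong)
  \<comment> \<open>The block occupies the positions \<open>i\<close> to
    \<open>i + 2 * N - 2\<close>; the comma behind it is the last one and completes the
    window.\<close>
  have Gi: "?G (take i S) (drop i S) = (if i \<le> K \<and> cfree (take i S) \<and> cfree (drop (i + 2 * N) S) \<and>
      S ! (i + 2 * N - 1) = Cm then e (take i S @ drop (i + 2 * N) S) else 0)"
    if i: "0 < i" "i \<le> ?M" for i
  proof -
    let ?w = "drop i S"
    have "?G (take i S) ?w = (if 2 * N \<le> length ?w then (let b = take (2 * N) ?w; v = drop (2 * N) ?w in
      if b \<noteq> [] \<and> last b = Cm \<and> cfree v then
        if block N (butlast b) then rho_right (\<lambda>x. e (x @ v)) (take i S) else 0 else 0) else 0)"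
      unfolding lastc_conv Let_def by (rule splits_single) (use N in \<open>auto simp: block_def\<close>)
    also have "\<dots> = (if i \<le> K \<and> cfree (take i S) \<and> cfree (drop (i + 2 * N) S) \<and>
      S ! (i + 2 * N - 1) = Cm then e (take i S @ drop (i + 2 * N) S) else 0)"
    proof (cases "2 * N \<le> length ?w")
      case True
      then have K: "i \<le> K" "i + 2 * N \<le> ?M" "i < ?M" using N i by (auto simp: K_def)
      have l: "last (take (2 * N) ?w) = S ! (i + 2 * N - 1)"
        using K N True by (subst last_conv_nth) (auto simp: min_def)
      have "even i \<noteq> even (i + 2 * N - 1)" using N by auto
      then have p: "S ! (i + 2 * N - 1) = Cm \<Longrightarrow> S ! i = Sg"
        using par [of i "i + 2 * N - 1"] K N by auto
      have b: "block N (butlast (take (2 * N) ?w)) \<longleftrightarrow> S ! i = Sg"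
        using gapped_block [OF g, of i N] K N True
        by (auto simp: block_def hd_drop_conv_nth butlast_take)
      have rr: "S ! i = Sg \<Longrightarrow> last (take i S) \<noteq> Sg"
        using par [of "i - 1" i] K i last [of i] by auto
      show ?thesis using True K l p b rr N i
        by (auto simp: Let_def rho_right_def add.commute)
    qed (use i in \<open>auto simp: K_def Let_def\<close>)
    finally show ?thesis .
  qed
  have "splits ?G S = (\<Sum>i\<le>?M. ?G (take i S) (drop i S))" by (rule splits_index)
  also have "\<dots> = ?G [] S + (\<Sum>i = 1..?M. ?G (take i S) (drop i S))"
    by (simp add: atMost_atLeast0 sum.atLeast_Suc_atMost take_0 cong: if_cong)
  also have "(\<Sum>i = 1..?M. ?G (take i S) (drop i S)) =
      (\<Sum>i = 1..?M. if i \<le> K \<and> cfree (take i S) \<and> cfree (drop (i + 2 * N) S) \<and>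
      S ! (i + 2 * N - 1) = Cm then e (take i S @ drop (i + 2 * N) S) else 0)"
    by (rule sum.cong) (auto simp: Gi)
  also have "\<dots> = ?W"
    by (rule sum.mono_neutral_cong_right) (auto simp: K_def)
  finally have A3: "splits ?G S = lastc (\<lambda>b v. if block N b then e v else 0) S +
    ?W"
    unfolding G0 .
  have "mismatch N e S = A1 + A2 + splits ?G S + E1 + lastc (\<lambda>b v. if block N b then e v else 0) S"
    unfolding mismatch_def A1_def A2_def E1_def ..
  then show ?thesis unfolding A3 A2 A1 by (auto simp: add_ac)
qed


text \<open>If \<open>S\<close> ends in a comma, that comma can be read as the final letter to be
  deleted or as the separator of an empty last entry, and every term occurs twice. Otherwise a term
  with a nonempty leftover in front of the block would force \<open>S\<close> to be
  \<open>good\<close>; those with an empty one cancel against the two summands that come from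
  \<open>cut_all\<close>.\<close>

lemma mismatch_not_good:
  fixes e :: "letter list \<Rightarrow> 'a::char2_group"
  assumes S: "\<not> good S" and e: "\<And>w. \<not> altw w \<Longrightarrow> e w = 0"
  shows "mismatch N e S = 0"
proof (cases "S \<noteq> [] \<and> last S = Cm")
  case True
  then obtain S' where S': "S = S' @ [Cm]" by (metis append_butlast_last_id)
  have "splits (\<lambda>x b. if block N b \<and> ends_in_gap x then e (butlast x) else 0) S = 0"
  proof (rule splits_zero)
    fix x b assume "x @ b = S"
    then have "\<not> block N b"
      using True block_last [of N b] block_not_Nil [of N b] by (auto simp: last_append split: if_splits)
    then show "(if block N b \<and> ends_in_gap x then e (butlast x) else 0) = 0" by simp
  qed
  moreover have "splits (\<lambda>x. lastc (\<lambda>b v. if block N b then rho_right (\<lambda>x. e (x @ v)) x else 0)) S =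
    splits (\<lambda>x b. if b \<noteq> [] \<and> last b \<noteq> Sg \<and> block N (butlast b) then rho_right e x else 0) S"
  proof (rule splits_cong)
    fix x w assume xw: "x @ w = S"
    show "lastc (\<lambda>b v. if block N b then rho_right (\<lambda>x. e (x @ v)) x else 0) w =
      (if w \<noteq> [] \<and> last w \<noteq> Sg \<and> block N (butlast w) then rho_right e x else 0)"
    proof (cases w rule: rev_cases)
      case (snoc w' a)
      then have "a = Cm" using xw S' by auto
      then show ?thesis by (simp add: snoc lastc_append)
    qed (simp add: lastc_cfree)
  qed
  ultimately show ?thesis
    using True by (simp add: mismatch_def S' lastc_append)
next
  case False
  have bg: "gapped b" "hd b = Sg" "last b = Sg" "b \<noteq> []" if "block N b" for b
    using that block_last [OF that] block_not_Nil [OF that] by (auto simp: block_def)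
  have 1: "splits (\<lambda>x b. if block N b \<and> ends_in_gap x then e (butlast x) else 0) S = 0"
  proof (rule splits_zero)
    fix x b assume xb: "x @ b = S"
    show "(if block N b \<and> ends_in_gap x then e (butlast x) else 0) = 0"
    proof (rule ccontr)
      assume *: "\<not> ?thesis"
      then obtain y a where x: "x = y @ [a]" by (metis append_butlast_last_id)
      from * have "block N b" "altw y" "y \<noteq> []" "last y = Sg" "a \<noteq> Sg"
        using e [of y] by (auto simp: x split: if_splits)
      moreover from this have "hd y \<noteq> Cm" by (simp add: altw_def cfree_hd)
      ultimately have "good S" using bg [of b]
        by (simp add: good_def altw_def gapped_append gapped_Cons x flip: xb)
      with S show False ..
    qed
  qed
  have 2: "splits (\<lambda>x b. if b \<noteq> [] \<and> last b \<noteq> Sg \<and> block N (butlast b) then rho_right e x else 0) S =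
    (if S \<noteq> [] \<and> last S \<noteq> Sg \<and> block N (butlast S) then e [] else 0)"
  proof (cases S)
    case (Cons a S')
    have "splits (\<lambda>x b. if b \<noteq> [] \<and> last b \<noteq> Sg \<and> block N (butlast b) then rho_right e (a # x) else 0) S' = 0"
    proof (rule splits_zero)
      fix x b assume xb: "x @ b = S'"
      show "(if b \<noteq> [] \<and> last b \<noteq> Sg \<and> block N (butlast b) then rho_right e (a # x) else 0) = 0"
      proof (rule ccontr)
        assume *: "\<not> ?thesis"
        then obtain y g where b: "b = y @ [g]" by (metis append_butlast_last_id)
        from * have "block N y" "altw (a # x)" "last (a # x) \<noteq> Sg" "g \<noteq> Sg" "g \<noteq> Cm" "a \<noteq> Cm"
          using e [of "a # x"] False xb by (auto simp: b Cons rho_right_def split: if_splits)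
        then have "good ((a # x) @ y @ [g])" using bg [of y]
          by (simp add: good_def altw_def gapped_append del: append_Cons)
        with S show False by (simp add: Cons b flip: xb)
      qed
    qed
    then show ?thesis by (simp add: Cons rho_right_def cong: if_cong)
  qed simp
  have 3: "splits (\<lambda>x. lastc (\<lambda>b v. if block N b then rho_right (\<lambda>x. e (x @ v)) x else 0)) S =
    lastc (\<lambda>b v. if block N b then e v else 0) S"
  proof (cases S)
    case (Cons a S')
    have "splits (\<lambda>x. lastc (\<lambda>b v. if block N b then rho_right (\<lambda>x. e (x @ v)) (a # x) else 0)) S' = 0"
    proof (rule splits_zero)
      fix x w assume xw: "x @ w = S'"
      show "lastc (\<lambda>b v. if block N b then rho_right (\<lambda>x. e (x @ v)) (a # x) else 0) w = 0"
      proof (cases "cfree w")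
        case False': False
        then obtain b v where w: "w = b @ Cm # v" and v: "cfree v" using not_cfree_last by blast
        have vN: "v \<noteq> []" using False xw w by (auto simp: Cons)
        show ?thesis
        proof (rule ccontr)
          assume *: "\<not> ?thesis"
          then have h: "block N b" "altw (a # x @ v)" "last (a # x) \<noteq> Sg" "a \<noteq> Cm"
            using e [of "a # x @ v"] by (auto simp: w v lastc_append rho_right_def split: if_splits)
          then have "gapped ((a # x) @ v)" by (simp add: altw_def)
          with h vN bg [of b] have "good ((a # x) @ b @ Cm # v)"
            using cfree_last [of v] v
            by (simp add: good_def gapped_append gapped_Cons del: append_Cons(1))
          with S show False by (simp add: Cons w flip: xw)
        qed
      qed (simp add: lastc_cfree)
    qed
    then show ?thesis by (simp add: Cons rho_right_def cong: if_cong)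
  qed (simp add: lastc_cfree)
  show ?thesis unfolding mismatch_def 1 2 3 by (simp add: add_ac)
qed

text \<open>Each maximal run of indices in \<open>{0..K}\<close> satisfying \<open>v\<close> is
  counted twice: at its last index by the first two kinds of end terms (\<open>v K\<close>, or
  \<open>v i\<close> without \<open>v (Suc i)\<close>), and at its first index by
  \<open>v 0\<close>, or \<open>v i\<close> without \<open>v (i - 1)\<close>.\<close>

lemma telescope:
  fixes c :: "'a::char2_group"
  shows "(if v K then c else 0) + (\<Sum>i = 1..K. if v i \<and> \<not> v (i - 1) then c else 0) +
    (if v 0 then c else 0) + (\<Sum>i<K. if v i \<and> \<not> v (Suc i) then c else 0) = 0"
proof (induction K)
  case (Suc K)
  let ?A = "\<Sum>i = 1..K. if v i \<and> \<not> v (i - 1) then c else 0"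
  let ?B = "\<Sum>i<K. if v i \<and> \<not> v (Suc i) then c else 0"
  have "(if v K then c else 0) + ?A + (if v 0 then c else 0) + ?B = 0" by (rule Suc.IH)
  moreover have "?A + (if v (Suc K) \<and> \<not> v K then c else 0) =
      (\<Sum>i = 1..Suc K. if v i \<and> \<not> v (i - 1) then c else 0)"
    by simp
  ultimately show ?case by (cases "v K"; cases "v (Suc K)") (simp_all add: add_ac)
qed simp

lemma mismatch_cancel:
  fixes e :: "letter list \<Rightarrow> 'a::char2_group"
  assumes N: "N \<ge> 1" and e: "\<And>w. \<not> altw w \<Longrightarrow> e w = 0"
  shows "mismatch N e S + mismatch N (\<lambda>x. e (rev x)) (rev S) = 0"
proof (cases "good S")
  case False
  have "e (rev w) = 0" if "\<not> altw w" for w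
    using that by (intro e) (simp add: altw_def)
  with False show ?thesis by (simp add: mismatch_not_good e)
next
  case True
  let ?M = "length S"
  define K where "K = ?M - 2 * N"
  have g: "gapped S" and lS: "last S \<noteq> Cm" and hS: "hd S \<noteq> Cm" using True by (auto simp: good_def)
  \<comment> \<open>The window of \<open>2 * N\<close> letters starting at \<open>i\<close> contains
    all commas.\<close>
  define v where "v i \<longleftrightarrow> cfree (take i S) \<and> cfree (drop (i + 2 * N) S)" for i
  \<comment> \<open>Removing an even number of letters preserves the parity of positions, and no
    comma is left; hence the remaining word does not depend on the window.\<close>
  define c where "c = e (map (\<lambda>j. if (S ! 0 = Sg) \<longleftrightarrow> even j then Sg else Rh) [0..<K])"
  show ?thesis
  proof (cases "K > 0")
    case True': True
    then have M: "?M = K + 2 * N" by (simp add: K_def)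
    have c: "e (take i S @ drop (i + 2 * N) S) = c" if "v i" "i \<le> K" for i
    proof -
      have "take i S @ drop (i + 2 * N) S = map (\<lambda>j. if (S ! 0 = Sg) \<longleftrightarrow> even j then Sg else Rh) [0..<K]"
      proof (rule nth_equalityI)
        fix j assume j: "j < length (take i S @ drop (i + 2 * N) S)"
        then have jK: "j < K" using M that by simp
        define j' where "j' = (if j < i then j else j + 2 * N)"
        have n: "(take i S @ drop (i + 2 * N) S) ! j = S ! j'"
          using that M jK by (auto simp: j'_def nth_append add_ac)
        have "(take i S @ drop (i + 2 * N) S) ! j \<noteq> Cm"
          using \<open>v i\<close> nth_mem [OF j] by (auto simp: v_def cfree_def)
        moreover have "j' < ?M" "even j' = even j" using jK M by (auto simp: j'_def)
        ultimately show "(take i S @ drop (i + 2 * N) S) ! j =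
            map (\<lambda>j. if (S ! 0 = Sg) \<longleftrightarrow> even j then Sg else Rh) [0..<K] ! j"
          using gapped_nth [OF g, of j'] jK unfolding n by (cases "S ! j'") auto
      qed (use that M in auto)
      then show ?thesis by (simp add: c_def)
    qed
    have v1: "v (i - 1) \<longleftrightarrow> cfree (take (i - 1) S) \<and> S ! (i + 2 * N - 1) \<noteq> Cm \<and> cfree (drop (i + 2 * N) S)"
      if "1 \<le> i" "i \<le> K" for i
    proof -
      have "drop (i - 1 + 2 * N) S = S ! (i + 2 * N - 1) # drop (i + 2 * N) S"
        using that M N Cons_nth_drop_Suc [of "i + 2 * N - 1" S] by simp
      then show ?thesis by (auto simp: v_def)
    qed
    have v2: "v (Suc i) \<longleftrightarrow> cfree (take i S) \<and> S ! i \<noteq> Cm \<and> cfree (drop (Suc i + 2 * N) S)"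
      if "i < K" for i
      using that M by (auto simp: v_def take_Suc_conv_app_nth)
    have cf: "cfree (take i S)" if "cfree (take j S)" "i \<le> j" for i j
      using that unfolding cfree_def by (meson set_take_subset_set_take subsetD)
    have cd: "cfree (drop j S)" if "cfree (drop i S)" "i \<le> j" for i j
      using that unfolding cfree_def by (meson set_drop_subset_set_drop subsetD)
    have "mismatch N e S = (if v K then c else 0) + (\<Sum>i = 1..K. if v i \<and> \<not> v (i - 1) then c else 0)"
    proof -
      have "v K = cfree (take K S)" using M by (simp add: v_def)
      moreover have "v K \<Longrightarrow> e (take K S) = c" using c [of K] M by simp
      moreover have "(\<Sum>i = 1..K. if cfree (take i S) \<and> cfree (drop (i + 2 * N) S) \<and> S ! (i + 2 * N - 1) = Cm
          then e (take i S @ drop (i + 2 * N) S) else 0) =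
        (\<Sum>i = 1..K. if v i \<and> \<not> v (i - 1) then c else 0)"
      proof (rule sum.cong [OF refl])
        fix i assume i: "i \<in> {1..K}"
        have "cfree (take i S) \<Longrightarrow> cfree (take (i - 1) S)" by (rule cf) auto
        then show "(if cfree (take i S) \<and> cfree (drop (i + 2 * N) S) \<and> S ! (i + 2 * N - 1) = Cm
            then e (take i S @ drop (i + 2 * N) S) else 0) = (if v i \<and> \<not> v (i - 1) then c else 0)"
          using i v1 [of i] c [of i] unfolding v_def [of i] by auto
      qed
      ultimately show ?thesis
        using mismatch_good [OF True N, of e] True' by (auto simp flip: K_def)
    qed
    moreover have "mismatch N (\<lambda>x. e (rev x)) (rev S) =
      (if v 0 then c else 0) + (\<Sum>i<K. if v i \<and> \<not> v (Suc i) then c else 0)"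
    proof -
      have "v 0 = cfree (take K (rev S))" using M by (simp add: v_def take_rev)
      moreover have "v 0 \<Longrightarrow> e (rev (take K (rev S))) = c" using c [of 0] M by (simp add: take_rev)
      moreover have "(\<Sum>i = 1..K. if cfree (take i (rev S)) \<and> cfree (drop (i + 2 * N) (rev S)) \<and>
          rev S ! (i + 2 * N - 1) = Cm
          then e (rev (take i (rev S) @ drop (i + 2 * N) (rev S))) else 0) =
        (\<Sum>i<K. if v i \<and> \<not> v (Suc i) then c else 0)"
      \<comment> \<open>Reversal sends the window starting at \<open>i\<close> to the one starting
        at \<open>K - i\<close>, and a comma at its right end to a comma at its left end.\<close>
      proof (rule sum.reindex_bij_witness [where i = "\<lambda>i. K - i" and j = "\<lambda>i. K - i"])
        fix i assume i: "i \<in> {1..K}"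
        have "rev S ! (i + 2 * N - 1) = S ! (K - i)"
          using i M N by (subst rev_nth) auto
        moreover have "take i (rev S) = rev (drop (K - i + 2 * N) S)"
            "drop (i + 2 * N) (rev S) = rev (take (K - i) S)"
          using i M by (auto simp: take_rev drop_rev intro!: arg_cong2 [where f = drop] arg_cong2 [where f = take])
        ultimately show "(if v (K - i) \<and> \<not> v (Suc (K - i)) then c else 0) =
          (if cfree (take i (rev S)) \<and> cfree (drop (i + 2 * N) (rev S)) \<and>
          rev S ! (i + 2 * N - 1) = Cm
          then e (rev (take i (rev S) @ drop (i + 2 * N) (rev S))) else 0)"
          using i c [of "K - i"] v2 [of "K - i"] cd [of "K - i + 2 * N" "Suc (K - i) + 2 * N"]
          by (auto simp: v_def)
      qed auto
      ultimately show ?thesis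
        using mismatch_good [of "rev S" N "\<lambda>x. e (rev x)"] True N True' by (auto simp flip: K_def)
    qed
    ultimately show ?thesis using telescope [of v K c] by (simp add: add_ac)
  qed (use mismatch_good [OF True N, of e] mismatch_good [of "rev S" N "\<lambda>x. e (rev x)"] N True
      in \<open>simp flip: K_def\<close>)
qed

theorem phi_commutator:
  fixes e :: "letter list \<Rightarrow> 'a::char2_group"
  assumes "N \<ge> 1" and "\<And>w. \<not> altw w \<Longrightarrow> e w = 0"
  shows "phi N (dels e) S + firstc (\<lambda>u. phi N (\<lambda>x. e (u @ x))) S +
      lastc (\<lambda>u v. phi N (\<lambda>x. e (x @ v)) u) S + dels (phi N e) S = 0"
  unfolding phi_commutator_mismatch by (rule mismatch_cancel [OF assms])

section \<open>The relations modulo two\<close>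

text \<open>The empty sequence and the sequence with a single empty entry have the same image. This
  causes no confusion, since \<open>phi\<close> vanishes on the empty word.\<close>

fun join :: "letter list list \<Rightarrow> letter list" where
  "join [] = []"
| "join [t] = t"
| "join (t # u # ts) = t @ Cm # join (u # ts)"

fun short :: "(letter list \<Rightarrow> 'a::comm_monoid_add) \<Rightarrow> letter list list \<Rightarrow> 'a" where
  "short e [u] = dels e u"
| "short e [u, v] = e (u @ v)"
| "short e ts = 0"

definition splits3 ::
    "('b list \<Rightarrow> 'b list \<Rightarrow> 'b list \<Rightarrow> 'a::comm_monoid_add) \<Rightarrow> 'b list \<Rightarrow> 'a" where
  "splits3 F ts = splits (\<lambda>A. splits (\<lambda>B C. F A B C)) ts"

text \<open>All unweighted operations with every variable set to 1 and with indices dropped. Since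
  \<open>e\<close> receives the output, nesting of operations is substitution for
  \<open>e\<close>.\<close>

definition bar :: "nat \<Rightarrow> (letter list \<Rightarrow> 'a::comm_monoid_add) \<Rightarrow> letter list list \<Rightarrow> 'a" where
  "bar N e ts = short e ts + phi N e (join ts)"

lemma join_Cons: "join (t # ts) = t @ (if ts = [] then [] else Cm # join ts)"
  by (cases ts) auto

lemma join_append:
  "join (us @ ts) = join us @ (if us = [] \<or> ts = [] then [] else [Cm]) @ join ts"
  by (induction us) (auto simp: join_Cons)

lemma rev_join: "rev (join ts) = join (rev (map rev ts))"
  by (induction ts) (auto simp: join_Cons join_append)

lemma join_middle:
  "join (A @ u # C) = (if A = [] then [] else join A @ [Cm]) @ u @ (if C = [] then [] else Cm # join C)"
  by (auto simp: join_append join_Cons)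

lemma good_middleD:
  assumes "good (join (A @ u # C))"
  shows "u \<noteq> []" and "C \<noteq> [] \<Longrightarrow> last u = Sg" and "A \<noteq> [] \<Longrightarrow> hd u = Sg" and "gapped u"
  using assms unfolding join_middle
  by (auto simp: good_def gapped_append gapped_Cons hd_append split: if_splits)

lemma cut_right_0 [simp]: "cut_right N (\<lambda>x. 0) S = 0"
  by (simp add: cut_right_def rho_right_def cong: if_cong)

lemma phi_0 [simp]: "phi N (\<lambda>x. 0) S = 0"
  by (simp add: phi_def cut_left_def cut_all_def)

lemma cut_right_add: "cut_right N (\<lambda>x. f x + g x) S = cut_right N f S + cut_right N g S"
  unfolding cut_right_def splits_add [symmetric] by (rule splits_cong) (auto simp: rho_right_def)

lemma phi_add: "phi N (\<lambda>x. f x + g x) S = phi N f S + phi N g S"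
  by (simp add: phi_def cut_left_def cut_all_def cut_right_add add_ac)

lemma phi_Nil [simp]: "phi N e [] = 0"
  by (simp add: phi_def cut_left_def cut_all_def cut_right_def)

lemma phi_rev: "phi N e (rev S) = phi N (\<lambda>x. e (rev x)) S"
  by (simp add: phi_def cut_left_def cut_all_def add_ac)

lemma short_add: "short (\<lambda>x. f x + g x) ts = short f ts + short g ts"
  by (cases "(f, ts)" rule: short.cases) (simp_all add: dels_add)

lemma short_0 [simp]: "short (\<lambda>x. 0) ts = 0"
  by (cases ts; cases "tl ts"; cases "tl (tl ts)") auto

lemma short_long: "length ts \<ge> 3 \<Longrightarrow> short e ts = 0"
  by (cases ts; cases "tl ts"; cases "tl (tl ts)") auto

lemma splits3_add: "splits3 (\<lambda>A B C. F A B C + G A B C) ts = splits3 F ts + splits3 G ts"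
proof -
  have "splits (\<lambda>B C. F A B C + G A B C) = (\<lambda>w. splits (F A) w + splits (G A) w)" for A
    by (rule ext) (rule splits_add)
  then show ?thesis by (simp add: splits3_def splits_add)
qed

lemma splits3_cong:
  assumes "\<And>A B C. ts = A @ B @ C \<Longrightarrow> F A B C = G A B C"
  shows "splits3 F ts = splits3 G ts"
  unfolding splits3_def by (intro splits_cong) (use assms in auto)

lemma splits3_zero: "(\<And>A B C. ts = A @ B @ C \<Longrightarrow> F A B C = 0) \<Longrightarrow> splits3 F ts = 0"
  unfolding splits3_def by (intro splits_zero) auto

lemma splits3_rev: "splits3 F (rev ts) = splits3 (\<lambda>A B C. F (rev C) (rev B) (rev A)) ts"
proof -
  have "splits3 F (rev ts) = splits (\<lambda>x y. splits (\<lambda>B C. F (rev y) B C) (rev x)) ts"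
    unfolding splits3_def by (simp add: splits_rev)
  also have "\<dots> = splits (\<lambda>x y. splits (\<lambda>C B. F (rev y) (rev B) (rev C)) x) ts"
    by (simp add: splits_rev)
  also have "\<dots> = splits3 (\<lambda>A B C. F (rev C) (rev B) (rev A)) ts"
    unfolding splits3_def splits_assoc ..
  finally show ?thesis .
qed

lemma splits_map: "splits F (map f ts) = splits (\<lambda>x y. F (map f x) (map f y)) ts"
  by (induction ts arbitrary: F) simp_all

lemma splits3_map: "splits3 F (map f ts) = splits3 (\<lambda>A B C. F (map f A) (map f B) (map f C)) ts"
  by (simp add: splits3_def splits_map)

text \<open>A letter deleted from the joined word either belongs to one entry and is removed by the
  differential, or it is a comma between two entries and is removed by their product.\<close>

lemma splits3_short_join:
  "splits3 (\<lambda>A B C. short (\<lambda>u. F (join (A @ u # C))) B) ts = dels F (join ts)"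
proof (induction ts arbitrary: F)
  case (Cons t ts)
  have head: "splits (\<lambda>B C. short (\<lambda>u. F (join (u # C))) B) (t # ts) =
      dels (\<lambda>u. F (join (u # ts))) t + (if ts = [] then 0 else F (t @ join ts))"
  proof (cases ts)
    case (Cons t2 ts2)
    have "splits (\<lambda>B C. short (\<lambda>u. F (join (u # C))) (t # t2 # B)) ts2 = F (join ((t @ t2) # ts2))"
      by (subst splits_single [where n = 0]) (auto elim!: short.elims simp: neq_Nil_conv)
    then show ?thesis by (simp add: Cons join_Cons)
  qed simp
  have tail: "splits (\<lambda>A. splits (\<lambda>B C. short (\<lambda>u. F (join ((t # A) @ u # C))) B)) ts =
      dels (\<lambda>x. F (t @ Cm # x)) (join ts)"
    using Cons.IH [of "\<lambda>x. F (t @ Cm # x)"] by (simp add: splits3_def join_Cons)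
  show ?case
    using head tail by (cases "ts = []") (auto simp: splits3_def join_Cons dels_append add_ac)
qed (simp add: splits3_def)

text \<open>Only sequences of one, two or three entries can contribute; for these the sum is the
  square of the differential, the Leibniz rule and associativity.\<close>

lemma splits3_short_short:
  fixes e :: "letter list \<Rightarrow> 'a::char2_group"
  shows "splits3 (\<lambda>A B C. short (\<lambda>u. short e (A @ u # C)) B) ts = 0"
proof -
  consider "ts = []" | a where "ts = [a]" | a b where "ts = [a, b]" | a b c where "ts = [a, b, c]" |
      "length ts \<ge> 4"
    by (cases ts; cases "tl ts"; cases "tl (tl ts)"; cases "tl (tl (tl ts))") auto
  then show ?thesis
  proof cases
    case 5
    show ?thesis
    proof (rule splits3_zero)
      fix A B C assume ts: "ts = A @ B @ C"
      show "short (\<lambda>u. short e (A @ u # C)) B = 0"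
      proof (cases "length B \<ge> 3 \<or> B = []")
        case True
        then show ?thesis by (auto simp: short_long)
      next
        case False
        then have "length A + length C \<ge> 2" using 5 ts by auto
        then have "short e (A @ u # C) = 0" for u
          by (intro short_long) simp
        then show ?thesis by simp
      qed
    qed
  qed (simp_all add: splits3_def dels_dels dels_append add_ac)
qed

text \<open>An outer differential or product has at most one entry besides the inner output, so the
  inner operation takes all entries, all but the first, or all but the last.\<close>

lemma splits3_outer_short:
  fixes e :: "letter list \<Rightarrow> 'a::char2_group"
  assumes "\<And>t. t \<in> set ts \<Longrightarrow> cfree t"
  shows "splits3 (\<lambda>A B C. phi N (\<lambda>u. short e (A @ u # C)) (join B)) ts =
    phi N (dels e) (join ts) + firstc (\<lambda>u. phi N (\<lambda>x. e (u @ x))) (join ts) +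
    lastc (\<lambda>u v. phi N (\<lambda>x. e (x @ v)) u) (join ts)"
proof -
  let ?F = "\<lambda>A B C. phi N (\<lambda>u. short e (A @ u # C)) (join B)"
  have B: "?F A [] C = 0" for A C by simp
  have AC: "?F A B C = 0" if "length A + length C \<ge> 2" for A B C
  proof -
    have "short e (A @ u # C) = 0" for u
      using that by (intro short_long) simp
    then show ?thesis by simp
  qed
  consider "ts = []" | t where "ts = [t]" | "length ts \<ge> 2"
    by (cases ts; cases "tl ts") auto
  then show ?thesis
  proof cases
    case 3
    then obtain t ts1 where ts1: "ts = t # ts1" "ts1 \<noteq> []" by (cases ts; cases "tl ts") auto
    then obtain ts2 s where ts2: "ts = ts2 @ [s]" "ts2 \<noteq> []" by (metis append_butlast_last_id butlast.simps(2) list.distinct(1))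
    have "splits (?F []) ts = ?F [] ts [] + ?F [] ts2 [s]"
    proof -
      have "splits (\<lambda>x y. ?F [] x (y @ [s])) ts2 = ?F [] ts2 [s]"
      proof (subst splits_single_right [where n = 0])
        fix x y :: "letter list list" assume "length y \<noteq> 0"
        then show "?F [] x (y @ [s]) = 0" by (intro AC) (cases y; simp)
      qed simp
      then show ?thesis unfolding ts2(1) splits_append by (simp add: add_ac)
    qed
    moreover have "splits (\<lambda>A. splits (?F (t # A))) ts1 = ?F [t] ts1 []"
    proof (subst splits_single [where n = 0])
      fix x y :: "letter list list" assume "length x \<noteq> 0"
      then show "splits (?F (t # x)) y = 0"
        by (intro splits_zero AC) (cases x; simp)
    next
      have "splits (?F [t]) ts1 = ?F [t] ts1 []"
      proof (subst splits_single_right [where n = 0])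
        fix x y :: "letter list list" assume "length y \<noteq> 0"
        then show "?F [t] x y = 0" by (intro AC) (cases y; simp)
      qed simp
      then show "(if 0 \<le> length ts1 then splits (?F (t # take 0 ts1)) (drop 0 ts1) else 0) = ?F [t] ts1 []"
        by simp
    qed
    ultimately have "splits3 ?F ts = ?F [] ts [] + ?F [] ts2 [s] + ?F [t] ts1 []"
      by (simp add: splits3_def ts1(1))
    moreover have "firstc (\<lambda>u. phi N (\<lambda>x. e (u @ x))) (join ts) = ?F [t] ts1 []"
      using ts1 assms by (simp add: join_Cons firstc_append)
    moreover have "lastc (\<lambda>u v. phi N (\<lambda>x. e (x @ v)) u) (join ts) = ?F [] ts2 [s]"
      using ts2 assms by (simp add: join_append lastc_append)
    moreover have "?F [] ts [] = phi N (dels e) (join ts)" by simp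
    ultimately show ?thesis by (simp add: add_ac)
  qed (use assms in \<open>simp_all add: splits3_def lastc_cfree firstc_cfree\<close>)
qed


text \<open>A nonzero term has an alternating leftover that does not meet the block in
  \<open>Sg\<close>, and the two together form a \<open>good\<close> word. This is how the shape
  conditions on allowable sequences enter.\<close>

lemma phi_not_good:
  fixes e :: "letter list \<Rightarrow> 'a::comm_monoid_add"
  assumes S: "\<not> good S" and e: "\<And>w. \<not> altw w \<Longrightarrow> e w = 0"
  shows "phi N e S = 0"
proof -
  have bg: "gapped b" "hd b = Sg" "last b = Sg" "b \<noteq> []" if "block N b" for b
    using that block_last [OF that] block_not_Nil [OF that] by (auto simp: block_def)
  have R: "cut_right N e S = 0" if S: "\<not> good S" and e: "\<And>w. \<not> altw w \<Longrightarrow> e w = 0"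
    for S and e :: "letter list \<Rightarrow> 'a"
    unfolding cut_right_def
  proof (rule splits_zero)
    fix x b assume xb: "x @ b = S"
    show "(if block N b then rho_right e x else 0) = 0"
    proof (rule ccontr)
      assume *: "\<not> ?thesis"
      then have "block N b" "altw x" "x = [] \<or> last x \<noteq> Sg"
        using e [of x] by (auto simp: rho_right_def split: if_splits)
      then have "good (x @ b)" using bg [of b] cfree_hd [of x]
        by (auto simp: good_def altw_def gapped_append hd_append)
      with S xb show False by simp
    qed
  qed
  have "cut_left N e S = 0"
    unfolding cut_left_def by (rule R) (use S e in \<open>auto simp: altw_def\<close>)
  moreover have "cut_all N e S = 0"
    using S bg [of S] by (auto simp: cut_all_def good_def)
  ultimately show ?thesis using R [OF S e] by (simp add: phi_def)
qed

section \<open>Two successive block removals\<close>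

lemma cut_right_last:
  assumes "S \<noteq> []" "last S \<noteq> Sg"
  shows "cut_right N e S = 0" and "cut_all N e S = 0"
proof -
  have "\<not> block N b" if "x @ b = S" for x b
    using that assms block_last [of N b] block_not_Nil [of N b]
    by (cases "b = []") (auto simp: block_not_Nil)
  then show "cut_right N e S = 0" unfolding cut_right_def by (intro splits_zero) auto
  show "cut_all N e S = 0" using assms block_last [of N S] by (auto simp: cut_all_def)
qed

lemma phi_last_not_Sg: "S \<noteq> [] \<Longrightarrow> last S \<noteq> Sg \<Longrightarrow> phi N e S = cut_left N e S"
  by (simp add: phi_def cut_right_last)

lemma cut_left_splits:
  "cut_left N e S = splits (\<lambda>b z. if block N b \<and> cfree z \<and> (z = [] \<or> hd z \<noteq> Sg) then e z else 0) S"
  unfolding cut_left_def cut_right_def splits_rev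
  by (rule splits_cong) (auto simp: rho_right_def last_rev)

text \<open>A prefix of a joined sequence is cut in exactly one way at its last comma.\<close>

lemma splits_join:
  assumes "\<And>t. t \<in> set ts \<Longrightarrow> cfree t" and "\<And>T. H T [] = 0"
  shows "splits (\<lambda>A B. splits (\<lambda>x b. if cfree x then H (join (A @ [x])) b else 0) (join B)) ts =
    splits H (join ts)"
  using assms
proof (induction ts arbitrary: H)
  case (Cons t ts)
  have IH: "splits (\<lambda>A B. splits (\<lambda>x b. if cfree x then H (t @ Cm # join (A @ [x])) b else 0) (join B)) ts =
      splits (\<lambda>T. H (t @ Cm # T)) (join ts)"
    using Cons.prems by (intro Cons.IH) auto
  have t: "cfree t" using Cons.prems by simp
  have "splits (\<lambda>x b. if cfree x then H x b else 0) (join (t # ts)) =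
      (if ts = [] then splits H t else splits (\<lambda>x y. H x (y @ Cm # join ts)) t)"
    using t by (auto simp: join_Cons splits_append intro!: splits_cong cong: if_cong)
  then show ?case
    using IH Cons.prems(2) [of "t @ [Cm]"]
    by (cases "ts = []") (auto simp: join_Cons splits_append cong: if_cong)
qed simp

text \<open>The word is \<open>b' @ z @ b\<close> with a block at either end. This expression does
  not record which block was removed first and is invariant under reversal.\<close>

definition double_cut :: "nat \<Rightarrow> (letter list \<Rightarrow> 'a::comm_monoid_add) \<Rightarrow> letter list \<Rightarrow> 'a" where
  "double_cut N e S = splits (\<lambda>T b. splits (\<lambda>b' z.
    if block N b' \<and> block N b \<and> cfree z \<and> z \<noteq> [] \<and> hd z \<noteq> Sg \<and> last z \<noteq> Sg then e z else 0) T) S"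

lemma double_cut_rev: "double_cut N (\<lambda>x. e (rev x)) (rev S) = double_cut N e S"
proof -
  have "double_cut N (\<lambda>x. e (rev x)) (rev S) = splits (\<lambda>b' T. splits (\<lambda>z b.
    if block N b' \<and> block N b \<and> cfree z \<and> z \<noteq> [] \<and> hd z \<noteq> Sg \<and> last z \<noteq> Sg then e z else 0) T) S"
    unfolding double_cut_def splits_rev
    by (intro splits_cong) (auto simp: hd_rev last_rev)
  then show ?thesis unfolding double_cut_def splits_assoc .
qed

text \<open>For the outer operation to be nonzero the inner leftover must be nonempty. It does not
  end in \<open>Sg\<close>, so it has to be the last entry of the outer sequence, and the outer
  block cannot lie at that end. The outer operation is therefore a cut from the left.\<close>

lemma splits3_cut_right_phi:
  fixes e :: "letter list \<Rightarrow> 'a::comm_monoid_add"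
  assumes ts: "\<And>t. t \<in> set ts \<Longrightarrow> cfree t" and e: "\<And>w. \<not> altw w \<Longrightarrow> e w = 0"
  shows "splits3 (\<lambda>A B C. cut_right N (\<lambda>u. phi N e (join (A @ u # C))) (join B)) ts =
    double_cut N e (join ts)"
proof -
  define P where "P T = (if T \<noteq> [] \<and> last T = Sg then 0 else cut_left N e T)" for T
  have inner: "rho_right (\<lambda>u. phi N e (join (A @ u # C))) x =
      (if cfree x \<and> C = [] then P (join (A @ [x])) else 0)" for A C x
  proof (cases "cfree x \<and> (x = [] \<or> last x \<noteq> Sg)")
    case True
    show ?thesis
    proof (cases "x \<noteq> [] \<and> C = []")
      case True': True
      then show ?thesis using True
        by (auto simp: rho_right_def P_def phi_last_not_Sg join_middle)
    next
      case False
      then have "\<not> good (join (A @ x # C))" using True good_middleD [of A x C] by auto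
      then have "phi N e (join (A @ x # C)) = 0" by (rule phi_not_good [OF _ e])
      moreover have "cut_left N e (join (A @ [x])) = 0" if "C = []"
      proof -
        have "x = []" using False that by simp
        moreover have "cut_left N e T = 0" if "T = [] \<or> last T = Cm" for T
          unfolding cut_left_splits
        proof (rule splits_zero)
          fix b z assume bz: "b @ z = T"
          show "(if block N b \<and> cfree z \<and> (z = [] \<or> hd z \<noteq> Sg) then e z else 0) = 0"
            using that bz block_last [of N b] cfree_last [of z] block_not_Nil [of N b]
            by (auto simp: last_append split: if_splits)
        qed
        ultimately show ?thesis by (auto simp: join_middle)
      qed
      ultimately show ?thesis by (cases "C = []") (simp_all add: rho_right_def P_def)
    qed
  next
    case False
    then show ?thesis by (auto simp: rho_right_def P_def join_middle)
  qed
  have "splits3 (\<lambda>A B C. cut_right N (\<lambda>u. phi N e (join (A @ u # C))) (join B)) ts =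
    splits (\<lambda>A W. splits (\<lambda>B C. if C = [] then
      splits (\<lambda>x b. if cfree x then if block N b then P (join (A @ [x])) else 0 else 0) (join B) else 0) W) ts"
    unfolding splits3_def cut_right_def inner
    by (intro splits_cong) (auto intro!: splits_cong splits_zero)
  also have "\<dots> = splits (\<lambda>A B.
      splits (\<lambda>x b. if cfree x then if block N b then P (join (A @ [x])) else 0 else 0) (join B)) ts"
    by (intro splits_cong) (subst splits_single_right [where n = 0], auto)
  also have "\<dots> = splits (\<lambda>T b. if block N b then P T else 0) (join ts)"
    using splits_join [of ts "\<lambda>T b. if block N b then P T else 0"] ts by simp
  also have "\<dots> = double_cut N e (join ts)"
    unfolding double_cut_def
  proof (rule splits_cong)
    fix T b
    have "P T = splits (\<lambda>b' z. if block N b' \<and> cfree z \<and> z \<noteq> [] \<and> hd z \<noteq> Sg \<and> last z \<noteq> Sg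
        then e z else 0) T"
    proof (cases "T \<noteq> [] \<and> last T = Sg")
      case True
      then show ?thesis
        by (auto simp: P_def intro!: splits_zero split: if_splits)
    next
      case False
      then show ?thesis
        unfolding P_def cut_left_splits if_not_P [OF False]
        by (intro splits_cong) (auto simp: last_append dest: block_last block_not_Nil split: if_splits)
    qed
    then show "(if block N b then P T else 0) = splits (\<lambda>b' z.
        if block N b' \<and> block N b \<and> cfree z \<and> z \<noteq> [] \<and> hd z \<noteq> Sg \<and> last z \<noteq> Sg then e z else 0) T"
      by auto
  qed
  finally show ?thesis .
qed

text \<open>Inner cuts from the right and, by reversal, inner cuts from the left add up to the same
  \<open>double_cut\<close>. The inner \<open>cut_all\<close> leaves an empty entry, on which every
  long operation vanishes.\<close>

lemma splits3_phi_phi: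
  fixes e :: "letter list \<Rightarrow> 'a::char2_group"
  assumes ts: "\<And>t. t \<in> set ts \<Longrightarrow> cfree t" and e: "\<And>w. \<not> altw w \<Longrightarrow> e w = 0"
  shows "splits3 (\<lambda>A B C. phi N (\<lambda>u. phi N e (join (A @ u # C))) (join B)) ts = 0"
proof -
  let ?e = "\<lambda>x. e (rev x)" and ?r = "\<lambda>ts. rev (map rev ts)"
  have e': "\<not> altw w \<Longrightarrow> ?e w = 0" for w by (rule e) (simp add: altw_def)
  have "splits3 (\<lambda>A B C. cut_left N (\<lambda>u. phi N e (join (A @ u # C))) (join B)) ts =
    splits3 (\<lambda>A B C. cut_right N (\<lambda>u. phi N ?e (join (?r C @ u # ?r A))) (join (?r B))) ts"
  proof (rule splits3_cong)
    fix A B C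
    have "phi N e (join (A @ rev u # C)) = phi N ?e (join (?r C @ u # ?r A))" for u
      using phi_rev [of N ?e "join (A @ rev u # C)"] by (simp add: rev_join)
    then show "cut_left N (\<lambda>u. phi N e (join (A @ u # C))) (join B) =
        cut_right N (\<lambda>u. phi N ?e (join (?r C @ u # ?r A))) (join (?r B))"
      by (simp add: cut_left_def rev_join)
  qed
  also have "\<dots> = splits3 (\<lambda>A B C. cut_right N (\<lambda>u. phi N ?e (join (A @ u # C))) (join B)) (?r ts)"
    by (simp add: splits3_rev splits3_map rev_map)
  also have "\<dots> = double_cut N ?e (join (?r ts))"
    using ts by (intro splits3_cut_right_phi e') auto
  also have "\<dots> = double_cut N e (join ts)"
    by (simp add: double_cut_rev flip: rev_join)
  finally have L: "splits3 (\<lambda>A B C. cut_left N (\<lambda>u. phi N e (join (A @ u # C))) (join B)) ts =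
    double_cut N e (join ts)" .
  have "phi N e (join (A @ [] # C)) = 0" for A C
    by (rule phi_not_good [OF _ e]) (use good_middleD(1) in blast)
  then have "splits3 (\<lambda>A B C. cut_all N (\<lambda>u. phi N e (join (A @ u # C))) (join B)) ts = 0"
    by (intro splits3_zero) (simp add: cut_all_def)
  then show ?thesis
    using splits3_cut_right_phi [OF ts e, where N = N] L unfolding phi_def [of N "\<lambda>u. phi N e (f u)" for f]
    by (simp add: splits3_add)
qed

theorem bar_relation:
  fixes e :: "letter list \<Rightarrow> 'a::char2_group"
  assumes N: "N \<ge> 1" and ts: "\<And>t. t \<in> set ts \<Longrightarrow> cfree t" and e: "\<And>w. \<not> altw w \<Longrightarrow> e w = 0"
  shows "splits3 (\<lambda>A B C. bar N (\<lambda>u. bar N e (A @ u # C)) B) ts = 0"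
proof -
  have "splits3 (\<lambda>A B C. bar N (\<lambda>u. bar N e (A @ u # C)) B) ts =
    splits3 (\<lambda>A B C. short (\<lambda>u. short e (A @ u # C)) B) ts +
    splits3 (\<lambda>A B C. short (\<lambda>u. phi N e (join (A @ u # C))) B) ts +
    splits3 (\<lambda>A B C. phi N (\<lambda>u. short e (A @ u # C)) (join B)) ts +
    splits3 (\<lambda>A B C. phi N (\<lambda>u. phi N e (join (A @ u # C))) (join B)) ts"
    unfolding bar_def short_add phi_add splits3_add by (simp add: add_ac)
  then show ?thesis
    using phi_commutator [OF N e, where S = "join ts"]
    by (simp add: splits3_short_short splits3_short_join splits3_outer_short [OF ts]
        splits3_phi_phi [OF ts e] add_ac)
qed

section \<open>Insertion of the curvature element\<close>

lemma altw_eqI: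
  assumes "altw u" "altw v" "length u = length v" "u \<noteq> [] \<Longrightarrow> (hd u = Sg) = (hd v = Sg)"
  shows "u = v"
proof (rule nth_equalityI [OF assms(3)])
  fix i assume i: "i < length u"
  have "u ! i \<noteq> Cm" "v ! i \<noteq> Cm"
  proof -
    have "u ! i \<in> set u" "v ! i \<in> set v" using i assms(3) by auto
    then show "u ! i \<noteq> Cm" "v ! i \<noteq> Cm" using assms(1,2) by (auto simp: altw_def cfree_def)
  qed
  moreover have "(u ! i = Sg) = (v ! i = Sg)"
  proof -
    have "(u ! i = Sg) = ((u ! 0 = Sg) = even i)" "(v ! i = Sg) = ((v ! 0 = Sg) = even i)"
      using assms i by (auto simp: altw_def intro!: gapped_nth)
    moreover have "(u ! 0 = Sg) = (v ! 0 = Sg)"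
    proof -
      have "u \<noteq> []" "v \<noteq> []" using i assms(3) by auto
      then show ?thesis using assms(4) by (simp add: hd_conv_nth)
    qed
    ultimately show ?thesis by blast
  qed
  ultimately show "u ! i = v ! i"
    by (metis letter.exhaust)
qed

text \<open>Deleting an interior letter makes two \<open>Sg\<close> adjacent, and \<open>e\<close>
  vanishes there. This is why the differential of a long word only removes letters at its
  ends.\<close>

lemma dels_altw:
  assumes w: "altw w" "length w \<ge> 2" and e: "\<And>w. \<not> altw w \<Longrightarrow> e w = 0"
  shows "dels e w = (if hd w = Sg then 0 else e (tl w)) + (if last w = Sg then 0 else e (butlast w))"
proof -
  obtain a m b where abm: "w = a # m @ [b]"
    using w(2) by (cases w; cases "tl w" rule: rev_cases) auto
  have "dels (\<lambda>x. e (a # x @ [b])) m = dels (\<lambda>x. 0) m"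
  proof (rule dels_cong)
    fix u c v assume m: "m = u @ c # v" and c: "c \<noteq> Sg"
    have "last (a # u) = Sg" "hd (v @ [b]) = Sg"
      using w(1) c unfolding abm m altw_def
      by (auto simp: gapped_append gapped_Cons hd_append split: if_splits)
    then have "\<not> gapped ((a # u) @ (v @ [b]))" unfolding gapped_append by simp
    then show "e (a # (u @ v) @ [b]) = 0" by (intro e) (simp add: altw_def)
  qed
  then show ?thesis by (auto simp: abm dels_append)
qed

text \<open>\<open>srs N\<close> and \<open>rss N\<close> are the patterns of the two kinds of
  monomials in \<open>U0\<close>.\<close>

definition srs :: "nat \<Rightarrow> letter list" where
  "srs n = concat (replicate n [Sg, Rh])"

definition rss :: "nat \<Rightarrow> letter list" where
  "rss n = concat (replicate n [Rh, Sg])"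

lemma length_srs [simp]: "length (srs n) = 2 * n" "length (rss n) = 2 * n"
  by (induction n) (simp_all add: srs_def rss_def)

lemma srs_Suc: "srs (Suc n) = Sg # Rh # srs n" "rss (Suc n) = Rh # Sg # rss n"
  by (simp_all add: srs_def rss_def)

lemma srs_Nil_iff [simp]: "srs n = [] \<longleftrightarrow> n = 0" "rss n = [] \<longleftrightarrow> n = 0"
  by (metis length_srs mult_eq_0_iff length_0_conv zero_neq_numeral)+

lemma hd_srs: "n > 0 \<Longrightarrow> hd (srs n) = Sg" "n > 0 \<Longrightarrow> hd (rss n) = Rh"
  by (cases n; simp add: srs_Suc)+

lemma last_srs: "n > 0 \<Longrightarrow> last (srs n) = Rh" "n > 0 \<Longrightarrow> last (rss n) = Sg"
  by (induction n) (auto simp: srs_Suc)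

lemma altw_srs: "altw (srs n)" "altw (rss n)"
proof (induction n)
  case (Suc n)
  case 1
  then show ?case using Suc by (cases "n = 0") (auto simp: altw_def srs_Suc gapped_Cons hd_srs)
  case 2
  then show ?case using Suc by (cases "n = 0") (auto simp: altw_def srs_Suc gapped_Cons hd_srs)
qed (simp_all add: altw_def srs_def rss_def)

lemma altw_rev [simp]: "altw (rev w) = altw w"
  by (simp add: altw_def)

lemma rev_rss: "rev (rss n) = srs n"
proof (cases "n = 0")
  case False
  then show ?thesis
    by (intro altw_eqI) (auto simp: altw_srs hd_rev last_srs hd_srs)
qed (simp add: srs_def rss_def)

text \<open>The word ends in \<open>Rh\<close>, so the block can only be cut off from the left, and
  the leftover is free of commas exactly if the block covers \<open>S\<close> and the comma. The
  leftover then has \<open>length S + 2\<close> letters and begins and ends with \<open>Rh\<close>.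
  It is a palindrome, the property that makes the contributions from both ends of a sequence
  agree.\<close>

lemma phi_srs:
  assumes N: "N \<ge> 1" and e: "\<And>w. \<not> altw w \<Longrightarrow> e w = 0"
  shows "phi N e (S @ Cm # srs N) =
    (if good S \<and> hd S = Sg \<and> last S = Sg \<and> length S + 2 \<le> 2 * N
     then e (Rh # srs (Suc (length S) div 2)) else 0)"
proof (cases "good (S @ Cm # srs N) \<and> hd S = Sg")
  case False
  have "phi N e (S @ Cm # srs N) = 0"
  proof (cases "good (S @ Cm # srs N)")
    case False
    then show ?thesis by (rule phi_not_good [OF _ e])
  next
    case True
    with False have h: "hd S \<noteq> Sg" "S \<noteq> []" by (auto simp: good_def)
    have "\<not> block N b" if "b @ z = S @ Cm # srs N" for b z
    proof
      assume b: "block N b"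
      then have "b \<noteq> []" "hd b = Sg" by (auto simp: block_def)
      with that h have "hd (b @ z) \<noteq> Sg" by simp
      then show False using \<open>b \<noteq> []\<close> \<open>hd b = Sg\<close> by simp
    qed
    then have "cut_left N e (S @ Cm # srs N) = 0"
      unfolding cut_left_splits by (intro splits_zero) auto
    then show ?thesis using N by (simp add: phi_last_not_Sg last_srs)
  qed
  moreover have "\<not> (good S \<and> hd S = Sg \<and> last S = Sg)"
    using False N by (auto simp: good_def gapped_append gapped_Cons altw_srs [unfolded altw_def] last_srs hd_srs)
  ultimately show ?thesis by auto
next
  case True
  let ?Y = "S @ Cm # srs N"
  have S: "S \<noteq> []" "hd S = Sg" "last S = Sg" "gapped S" "gapped ?Y"
    using True N by (auto simp: good_def gapped_append gapped_Cons split: if_splits)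
  then have gS: "good S" by (auto simp: good_def)
  have odd: "odd (length S)"
    using gapped_nth [OF S(4), of "length S - 1"] S by (auto simp: hd_conv_nth last_conv_nth)
  have "phi N e ?Y = cut_left N e ?Y" using N by (intro phi_last_not_Sg) (auto simp: last_srs)
  also have "\<dots> = (if 2 * N - 1 \<le> length ?Y then (let b = take (2 * N - 1) ?Y; z = drop (2 * N - 1) ?Y in
      if block N b \<and> cfree z \<and> (z = [] \<or> hd z \<noteq> Sg) then e z else 0) else 0)"
    unfolding cut_left_splits Let_def by (rule splits_single) (auto simp: block_def)
  also have "\<dots> = (if length S + 2 \<le> 2 * N then e (Rh # srs (Suc (length S) div 2)) else 0)"
  proof -
    let ?z = "drop (2 * N - 1) ?Y"
    have b: "block N (take (2 * N - 1) ?Y)"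
      using gapped_block [OF S(5), of 0 N] S N by (simp add: nth_append hd_conv_nth)
    have g: "gapped ?z" using S(5) append_take_drop_id [of "2 * N - 1" ?Y] gapped_append by metis
    show ?thesis
    proof (cases "length S + 2 \<le> 2 * N")
      case True
      then have z: "?z = drop (2 * N - 2 - length S) (srs N)"
        using N by (simp add: drop_Cons' Suc_diff_Suc numeral_2_eq_2)
      then have c: "cfree ?z" using altw_srs(1) [of N] set_drop_subset by (fastforce simp: altw_def cfree_def)
      have l: "length ?z = length S + 2" using True N by simp
      have "?Y ! (2 * N - 1) \<noteq> Sg"
        using gapped_nth [OF S(5), of "2 * N - 1"] S N by (auto simp: nth_append hd_conv_nth split: if_splits)
      then have h: "hd ?z \<noteq> Sg" using N by (subst hd_drop_conv_nth) auto
      have "?z = Rh # srs (Suc (length S) div 2)"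
      proof (rule altw_eqI)
        show "altw (Rh # srs (Suc (length S) div 2))"
          using altw_srs(1) [of "Suc (length S) div 2"] odd S
          by (cases "srs (Suc (length S) div 2) = []") (auto simp: altw_def gapped_Cons hd_srs)
      qed (use c g h l odd in \<open>auto simp: altw_def\<close>)
      moreover have "2 * N - 1 \<le> length ?Y" by simp
      ultimately have "(if 2 * N - 1 \<le> length ?Y then (let b = take (2 * N - 1) ?Y; z = drop (2 * N - 1) ?Y in
        if block N b \<and> cfree z \<and> (z = [] \<or> hd z \<noteq> Sg) then e z else 0) else 0) =
        e (Rh # srs (Suc (length S) div 2))"
        unfolding Let_def using b c h by presburger
      then show ?thesis using True by simp
    next
      case False
      have "\<not> cfree ?z"
      proof -
        have "?z = drop (2 * N - 1) S @ Cm # srs N" using False N by simp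
        then show ?thesis by simp
      qed
      then show ?thesis using False by (simp add: Let_def)
    qed
  qed
  finally show ?thesis using S gS by simp
qed

text \<open>For the short operations this says that the curvature element is closed and central. In
  a long operation \<open>srs N\<close>, which ends in \<open>Rh\<close>, can only be the last entry
  of the list, and \<open>rss N\<close>, which begins with \<open>Rh\<close>, only the first.
  Reversal exchanges these two cases, and the outputs given by \<open>phi_srs\<close> are
  palindromes, so the two terms are equal.\<close>

theorem bar_curvature:
  fixes e :: "letter list \<Rightarrow> 'a::char2_group"
  assumes N: "N \<ge> 1" and ts: "\<And>t. t \<in> set ts \<Longrightarrow> altw t" and e: "\<And>w. \<not> altw w \<Longrightarrow> e w = 0"
  shows "splits (\<lambda>A C. bar N e (A @ srs N # C) + bar N e (A @ rss N # C)) ts = 0"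
proof -
  let ?e = "\<lambda>x. e (rev x)"
  have e': "\<not> altw w \<Longrightarrow> ?e w = 0" for w by (rule e) simp
  have "splits (\<lambda>A C. short e (A @ srs N # C) + short e (A @ rss N # C)) ts = 0"
  proof -
    consider "ts = []" | t where "ts = [t]" | "length ts \<ge> 2" by (cases ts; cases "tl ts") auto
    then show ?thesis
    proof cases
      case 1
      obtain m where m: "N = Suc m" using N by (cases N) auto
      have "altw (tl (rss N))" "altw (butlast (srs N))"
        using altw_srs(2) [of N] altw_srs(1) [of N] gapped_append [of "butlast (srs N)" "[last (srs N)]"] N
        by (auto simp: altw_def m srs_Suc gapped_Cons cfree_def dest: in_set_butlastD)
      then have "tl (rss N) = butlast (srs N)"
        by (intro altw_eqI) (auto simp: m srs_Suc)
      then show ?thesis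
        using 1 N by (simp add: dels_altw altw_srs e hd_srs last_srs)
    next
      case (2 t)
      have t: "altw t" using ts 2 by simp
      show ?thesis
      proof (cases "t = []")
        case False
        have 1: "e (srs N @ t) = 0" if "hd t \<noteq> Sg"
          using that False N by (intro e) (simp add: altw_def gapped_append last_srs)
        have 2: "e (rss N @ t) = 0" if "hd t = Sg"
          using that False N by (intro e) (simp add: altw_def gapped_append last_srs)
        have 3: "e (t @ srs N) = 0" if "last t = Sg"
          using that False N by (intro e) (simp add: altw_def gapped_append hd_srs)
        have 4: "e (t @ rss N) = 0" if "last t \<noteq> Sg"
          using that False N by (intro e) (simp add: altw_def gapped_append hd_srs)
        have 5: "(if hd t = Sg then srs N else rss N) @ t = t @ (if last t = Sg then rss N else srs N)"
        proof (rule altw_eqI)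
          show "altw ((if hd t = Sg then srs N else rss N) @ t)"
            "altw (t @ (if last t = Sg then rss N else srs N))"
            using t altw_srs [of N] N
            by (auto simp: altw_def gapped_append hd_srs last_srs)
        qed (use False N in \<open>auto simp: hd_srs\<close>)
        show ?thesis
          using 1 2 3 4 5 by (cases "hd t = Sg"; cases "last t = Sg") (auto simp: \<open>ts = [t]\<close>)
      qed (simp add: \<open>ts = [t]\<close>)
    next
      case 3
      then show ?thesis by (intro splits_zero) (auto simp: short_long)
    qed
  qed
  moreover have "splits (\<lambda>A C. phi N e (join (A @ srs N # C)) + phi N e (join (A @ rss N # C))) ts = 0"
  proof -
    have "splits (\<lambda>A C. phi N e (join (A @ srs N # C))) ts = phi N e (join (ts @ [srs N]))"
    proof (subst splits_single_right [where n = 0])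
      fix A C :: "letter list list" assume "length C \<noteq> 0"
      then have "\<not> good (join (A @ srs N # C))"
        using good_middleD(2) [of A "srs N" C] N by (auto simp: last_srs)
      then show "phi N e (join (A @ srs N # C)) = 0" by (rule phi_not_good [OF _ e])
    qed simp
    moreover have "splits (\<lambda>A C. phi N e (join (A @ rss N # C))) ts = phi N e (join (rss N # ts))"
    proof (subst splits_single [where n = 0])
      fix A C :: "letter list list" assume "length A \<noteq> 0"
      then have "\<not> good (join (A @ rss N # C))"
        using good_middleD(3) [of A "rss N" C] N by (auto simp: hd_srs)
      then show "phi N e (join (A @ rss N # C)) = 0" by (rule phi_not_good [OF _ e])
    qed simp
    moreover have "phi N e (join (ts @ [srs N])) = phi N e (join (rss N # ts))"
    proof (cases "ts = []")
      case True
      have c: "cut_left N e (srs N) = (if 2 * N - 1 \<le> length (srs N) then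
          (let b = take (2 * N - 1) (srs N); z = drop (2 * N - 1) (srs N) in
          if block N b \<and> cfree z \<and> (z = [] \<or> hd z \<noteq> Sg) then e z else 0) else 0)" for e :: "letter list \<Rightarrow> 'a"
        unfolding cut_left_splits Let_def by (rule splits_single) (auto simp: block_def)
      \<comment> \<open>The leftover is a single letter.\<close>
      have r: "rev (drop (2 * N - 1) (srs N)) = drop (2 * N - 1) (srs N)"
      proof -
        have "length xs = Suc 0 \<Longrightarrow> rev xs = xs" for xs :: "letter list"
          by (cases xs) auto
        then show ?thesis using N by simp
      qed
      have "cut_left N e (srs N) = cut_left N ?e (srs N)" by (simp only: c Let_def r)
      moreover have "phi N e (rss N) = phi N ?e (srs N)"
        using phi_rev [of N ?e "rss N"] by (simp add: rev_rss)
      ultimately show ?thesis using True N by (simp add: phi_last_not_Sg last_srs)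
    next
      case False
      have *: "rev (Rh # srs m) = Rh # srs m" for m
      proof -
        have "rss m @ [Rh] = Rh # srs m" by (induction m) (simp_all add: srs_Suc, simp add: srs_def rss_def)
        then show ?thesis by (simp flip: rev_rss)
      qed
      have "phi N e (rss N @ Cm # join ts) = phi N ?e (rev (join ts) @ Cm # srs N)"
        using phi_rev [of N ?e "rss N @ Cm # join ts"] by (simp add: rev_rss)
      also have "\<dots> = phi N e (join ts @ Cm # srs N)"
        using phi_srs [of N e "join ts", OF N e] phi_srs [of N ?e "rev (join ts)", OF N e']
        by (simp only: *) (auto simp: good_def hd_rev last_rev)
      finally show ?thesis using False by (simp add: join_Cons join_append)
    qed
    ultimately show ?thesis by (simp add: splits_add)
  qed
  ultimately show ?thesis unfolding bar_def by (simp add: splits_add add_ac)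
qed

section \<open>Homogeneity\<close>

lemma lookup_smul [simp]: "Poly_Mapping.lookup (smul c x) m = c * Poly_Mapping.lookup x m"
  by (simp add: smul_def map.rep_eq when_def)

lemma smul_simps [simp]:
  "smul c 0 = 0" "smul 0 x = 0" "smul 1 x = x" "smul c (smul d x) = smul (c * d) x"
  by (auto intro!: poly_mapping_eqI simp: mult.assoc)

lemma smul_add: "smul c (x + y) = smul c x + smul c y" "smul (c + d) x = smul c x + smul d x"
  by (auto intro!: poly_mapping_eqI simp: lookup_add distrib_left distrib_right)

lemma smul_sum: "smul c (sum f A) = (\<Sum>a\<in>A. smul c (f a))"
  by (induction A rule: infinite_finite_induct) (simp_all add: smul_add)

lemma lookup_sum: "Poly_Mapping.lookup (sum f A) m = (\<Sum>a\<in>A. Poly_Mapping.lookup (f a) m)"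
  by (induction A rule: infinite_finite_induct) (simp_all add: lookup_add)

definition lin :: "(mono \<Rightarrow> alg) \<Rightarrow> alg \<Rightarrow> alg" where
  "lin f x = (\<Sum>m\<in>Poly_Mapping.keys x. smul (Poly_Mapping.lookup x m) (f m))"

lemma lin_superset:
  assumes "finite A" "Poly_Mapping.keys x \<subseteq> A"
  shows "lin f x = (\<Sum>m\<in>A. smul (Poly_Mapping.lookup x m) (f m))"
  unfolding lin_def using assms by (intro sum.mono_neutral_left) (auto simp: in_keys_iff)

lemma lin_add: "lin f (x + y) = lin f x + lin f y"
proof -
  let ?A = "Poly_Mapping.keys x \<union> Poly_Mapping.keys y"
  have "Poly_Mapping.keys (x + y) \<subseteq> ?A" by (rule keys_add)
  then show ?thesis
    by (simp add: lin_superset [of ?A] lookup_add smul_add sum.distrib)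
qed

lemma lin_0 [simp]: "lin f 0 = 0" "lin (\<lambda>m. 0) x = 0"
  by (simp_all add: lin_def)

lemma lin_sum: "lin f (sum g A) = (\<Sum>a\<in>A. lin f (g a))"
  by (induction A rule: infinite_finite_induct) (simp_all add: lin_add)

lemma lin_smul: "lin f (smul c x) = smul c (lin f x)"
proof -
  have "Poly_Mapping.keys (smul c x) \<subseteq> Poly_Mapping.keys x"
    by (auto simp: in_keys_iff)
  then show ?thesis by (simp add: lin_superset [of "Poly_Mapping.keys x"] smul_sum)
qed

lemma lin_basis [simp]: "lin f (basis m) = f m"
  by (simp add: lin_def basis_def)

lemma lin_add_fun: "lin (\<lambda>m. f m + g m) x = lin f x + lin g x"
  by (simp add: lin_def smul_add sum.distrib)

lemma lin_smul_fun: "lin (\<lambda>m. smul c (f m)) x = smul c (lin f x)"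
  by (simp add: lin_def smul_sum mult.commute)

lemma lin_lin: "lin f (lin g x) = lin (\<lambda>m. lin f (g m)) x"
  by (simp add: lin_def [of g] lin_def [of "\<lambda>m. lin f (g m)"] lin_sum lin_smul)

lemma lin_cong: "(\<And>m. m \<in> Poly_Mapping.keys x \<Longrightarrow> f m = g m) \<Longrightarrow> lin f x = lin g x"
  by (simp add: lin_def)

fun gweight :: "nat \<Rightarrow> gen \<Rightarrow> coeff" where
  "gweight N (Rho i) = V i"
| "gweight N (Sig i) = (if i = N then V (N + 1) else 1)"

definition word_weight :: "nat \<Rightarrow> gen list \<Rightarrow> coeff" where
  "word_weight N w = prod_list (map (gweight N) w)"

definition mono_weight :: "nat \<Rightarrow> mono \<Rightarrow> coeff" where
  "mono_weight N m = word_weight N (letters m)"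

text \<open>On a homogeneous element of weight \<open>g\<close> this is \<open>g\<close> times the
  element obtained by setting all variables to 1. Weights are nonzero and the coefficient ring has
  no zero divisors, so the map loses nothing and relations may be checked after applying it.\<close>

definition rescale :: "nat \<Rightarrow> alg \<Rightarrow> alg" where
  "rescale N = lin (\<lambda>m. smul (mono_weight N m) (basis m))"

lemma word_weight_simps [simp]:
  "word_weight N [] = 1" "word_weight N (g # w) = gweight N g * word_weight N w"
  "word_weight N (u @ v) = word_weight N u * word_weight N v"
  by (simp_all add: word_weight_def)

lemma mono_weight_simps [simp]: "mono_weight N (Idem i) = 1" "mono_weight N (Word w) = word_weight N w"
  by (simp_all add: mono_weight_def)

lemma V_neq_0 [simp]: "V i \<noteq> 0"
  unfolding V_def by (metis lookup_single_eq lookup_zero zero_neq_one)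

lemma mono_weight_neq_0: "mono_weight N m \<noteq> 0"
proof -
  have "gweight N g \<noteq> 0" for g by (cases g) auto
  then have "word_weight N w \<noteq> 0" for w by (induction w) simp_all
  then show ?thesis by (simp add: mono_weight_def)
qed

lemma lookup_rescale: "Poly_Mapping.lookup (rescale N x) m = Poly_Mapping.lookup x m * mono_weight N m"
proof -
  have "Poly_Mapping.lookup (rescale N x) m = (\<Sum>a\<in>Poly_Mapping.keys x.
      Poly_Mapping.lookup x a * mono_weight N a * (if a = m then 1 else 0))"
    by (simp add: rescale_def lin_def lookup_sum basis_def lookup_single when_def)
  also have "\<dots> = (\<Sum>a\<in>Poly_Mapping.keys x.
      if a = m then Poly_Mapping.lookup x m * mono_weight N m else 0)"
    by (rule sum.cong) auto
  finally show ?thesis by (simp add: in_keys_iff)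
qed

lemma keys_rescale [simp]: "Poly_Mapping.keys (rescale N x) = Poly_Mapping.keys x"
  by (auto simp: in_keys_iff lookup_rescale mono_weight_neq_0)

lemma rescale_eq_0_iff [simp]: "rescale N x = 0 \<longleftrightarrow> x = 0"
  by (metis keys_rescale keys_eq_empty)

lemma rescale_simps [simp]:
  "rescale N (smul c x) = smul c (rescale N x)" "rescale N (basis m) = smul (mono_weight N m) (basis m)"
  by (simp_all add: rescale_def lin_smul)

lemma rescale_add: "rescale N (x + y) = rescale N x + rescale N y"
  by (simp add: rescale_def lin_add)

lemma rescale_lin: "rescale N (lin h x) = lin (\<lambda>m. rescale N (h m)) x"
  by (simp add: rescale_def lin_lin)

section \<open>Monomials as labelled patterns\<close>

text \<open>The index of the \<open>\<sigma>\<close> whose final idempotent is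
  \<open>f\<close>.\<close>

definition prev :: "nat \<Rightarrow> nat \<Rightarrow> nat" where
  "prev N f = res N (f + N - 1)"

definition cnt :: "letter list \<Rightarrow> nat" where
  "cnt w = count_list w Sg"

lemma cnt_simps [simp]:
  "cnt [] = 0" "cnt (a # w) = (if a = Sg then Suc (cnt w) else cnt w)" "cnt (u @ v) = cnt u + cnt v"
  by (simp_all add: cnt_def)

text \<open>The initial idempotent of a pattern with final idempotent \<open>f\<close>: only a
  \<open>\<sigma>\<close> changes the idempotent.\<close>

definition shift :: "nat \<Rightarrow> nat \<Rightarrow> letter list \<Rightarrow> nat" where
  "shift N f w = (prev N ^^ cnt w) f"

text \<open>
  The indices of a word are determined, from left to right, by its final idempotent \<open>f\<close>.
\<close>

fun lab :: "nat \<Rightarrow> nat \<Rightarrow> letter list \<Rightarrow> gen list" where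
  "lab N f [] = []"
| "lab N f (Rh # w) = Rho f # lab N f w"
| "lab N f (Sg # w) = Sig (prev N f) # lab N (prev N f) w"
| "lab N f (Cm # w) = lab N f w"

definition mono_of :: "nat \<Rightarrow> nat \<Rightarrow> letter list \<Rightarrow> mono" where
  "mono_of N f u = (if u = [] then Idem f else Word (lab N f u))"

definition pat :: "mono \<Rightarrow> letter list" where
  "pat m = map (\<lambda>g. if is_rho g then Rh else Sg) (letters m)"

lemma shift_simps [simp]:
  "shift N f [] = f" "shift N f (Rh # w) = shift N f w" "shift N f (Cm # w) = shift N f w"
  "shift N f (Sg # w) = shift N (prev N f) w" "shift N f (u @ v) = shift N (shift N f u) v"
proof -
  show "shift N f (u @ v) = shift N (shift N f u) v"
    unfolding shift_def cnt_simps add.commute [of "cnt u"] funpow_add by simp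
qed (simp_all add: shift_def funpow_swap1)

lemma lab_append: "lab N f (u @ v) = lab N f u @ lab N (shift N f u) v"
  by (induction N f u rule: lab.induct) simp_all

lemma lab_Nil_iff [simp]: "cfree u \<Longrightarrow> lab N f u = [] \<longleftrightarrow> u = []"
  by (cases "(N, f, u)" rule: lab.cases) auto

lemma sigmas_lab [simp]: "sigmas (lab N f w) = cnt w"
  by (induction N f w rule: lab.induct) (simp_all add: sigmas_def)

lemma res_in: "N > 0 \<Longrightarrow> res N a \<in> {1..N}"
  using mod_less_divisor [of N "a + N - 1"] by (auto simp: res_def Suc_le_eq)

lemma res_id: "f \<in> {1..N} \<Longrightarrow> res N f = f"
  by (auto simp: res_def mod_if Suc_le_eq)

lemma prev_in: "N > 0 \<Longrightarrow> prev N f \<in> {1..N}"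
  unfolding prev_def by (rule res_in)

lemma res_eqI: "a > 0 \<Longrightarrow> b > 0 \<Longrightarrow> a mod N = b mod N \<Longrightarrow> res N a = res N b"
  by (cases N) (auto simp: res_def intro: mod_add_cong)

lemma prev_res: "N > 0 \<Longrightarrow> prev N (res N a) = res N (a + N - 1)"
proof -
  assume N: "N > 0"
  have "((a + N - 1) mod N + 1 + N - 1 + N - 1) mod N = ((a + N - 1) mod N + (N + (N - 1))) mod N"
    using N by (simp add: add_ac)
  also have "\<dots> = (a + N - 1 + (N + (N - 1))) mod N" by (rule mod_add_left_eq)
  also have "a + N - 1 + (N + (N - 1)) = (a + N - 1 + N - 1) + N" using N by simp
  finally show ?thesis by (simp add: prev_def res_def)
qed

lemma prev_res_Suc: "N > 0 \<Longrightarrow> prev N (res N (Suc a)) = res N a"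
proof -
  assume N: "N > 0"
  then have "Suc a + N - 1 + N - 1 = (a + N - 1) + N" by simp
  then have "(Suc a + N - 1 + N - 1) mod N = (a + N - 1) mod N" by (simp only: mod_add_self2)
  then show ?thesis using N by (simp only: prev_res) (simp only: res_def)
qed

lemma res_Suc_prev: "N > 0 \<Longrightarrow> f \<in> {1..N} \<Longrightarrow> res N (Suc (prev N f)) = f"
proof -
  assume N: "N > 0" and f: "f \<in> {1..N}"
  have "(Suc ((f + N - 1 + N - 1) mod N + 1) + N - 1) mod N = ((f + N - 1 + N - 1) mod N + Suc N) mod N"
    using N by (simp add: add_ac)
  also have "\<dots> = (f + N - 1 + N - 1 + Suc N) mod N" by (rule mod_add_left_eq)
  also have "f + N - 1 + N - 1 + Suc N = (f - 1) + N * 3" using N f by auto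
  finally show ?thesis using f by (auto simp: prev_def res_def)
qed

text \<open>Stepping back by one is adding \<open>N - 1\<close> modulo \<open>N\<close>, which keeps
  the arithmetic free of truncated subtraction.\<close>

lemma prev_pow: "N > 0 \<Longrightarrow> f \<in> {1..N} \<Longrightarrow> (prev N ^^ n) f = res N (f + n * (N - 1))"
proof (induction n)
  case (Suc n)
  then have "(prev N ^^ Suc n) f = res N (f + n * (N - 1) + N - 1)" by (simp add: prev_res)
  then show ?case using Suc.prems by (simp add: add_ac)
qed (simp add: res_id)

lemma prev_pow_mod:
  assumes N: "N > 0" and f: "f \<in> {1..N}" and mn: "m mod N = n mod N"
  shows "(prev N ^^ m) f = (prev N ^^ n) f"
proof -
  have "(f + m * (N - 1)) mod N = (f + n * (N - 1)) mod N"
    using mn by (intro mod_add_cong mod_mult_cong refl)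
  then show ?thesis using f unfolding prev_pow [OF N f] by (intro res_eqI) auto
qed

lemma prev_pow_inj:
  assumes N: "N > 0" and f: "f \<in> {1..N}" and ij: "i < N" "j < N"
    and eq: "(prev N ^^ i) f = (prev N ^^ j) f"
  shows "i = j"
proof -
  have "(f + i * (N - 1) + N - 1) mod N = (f + j * (N - 1) + N - 1) mod N"
    using eq by (simp add: prev_pow [OF N f] res_def)
  then have "int (f + i * (N - 1) + N - 1) mod int N = int (f + j * (N - 1) + N - 1) mod int N"
    by (metis zmod_int)
  then have "int N dvd int (f + i * (N - 1) + N - 1) - int (f + j * (N - 1) + N - 1)"
    by (simp only: mod_eq_dvd_iff)
  also have "\<dots> = int N * (int i - int j) - (int i - int j)"
    using N by (cases N) (simp_all add: algebra_simps)
  finally have "int N dvd int i - int j"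
    by (metis dvd_triv_left dvd_diff_right_iff)
  then show ?thesis using ij dvd_imp_le_int [of "int i - int j" "int N"] by fastforce
qed

lemma shift_in: "f \<in> {1..N} \<Longrightarrow> shift N f w \<in> {1..N}"
proof -
  assume f: "f \<in> {1..N}"
  then have "N > 0" by auto
  then show ?thesis using f prev_in by (cases "cnt w") (auto simp: shift_def)
qed

lemma final_Rho_Sig: "f \<in> {1..N} \<Longrightarrow> gen_final N (Sig (prev N f)) = f"
  by (simp add: res_Suc_prev)

lemma hd_lab: "cfree w \<Longrightarrow> w \<noteq> [] \<Longrightarrow> hd (lab N f w) = (if hd w = Sg then Sig (prev N f) else Rho f)"
  by (cases "(N, f, w)" rule: lab.cases) auto

lemma last_lab:
  assumes "cfree w" "w \<noteq> []"
  shows "last (lab N f w) = (if last w = Sg then Sig (shift N f w) else Rho (shift N f w))"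
proof -
  obtain v a where w: "w = v @ [a]" using assms(2) by (metis append_butlast_last_id)
  then show ?thesis using assms(1) by (cases a) (simp_all add: lab_append)
qed

lemma final_mono_of: "f \<in> {1..N} \<Longrightarrow> cfree u \<Longrightarrow> final N (mono_of N f u) = f"
  by (auto simp: mono_of_def hd_lab final_Rho_Sig simp del: gen_final.simps(2))

lemma initial_mono_of: "cfree u \<Longrightarrow> initial (mono_of N f u) = shift N f u"
  by (auto simp: mono_of_def last_lab)

lemma letters_mono_of: "letters (mono_of N f u) = lab N f u"
  by (simp add: mono_of_def)

lemma pat_mono_of: "cfree u \<Longrightarrow> pat (mono_of N f u) = u"
proof -
  have "cfree u \<Longrightarrow> map (\<lambda>g. if is_rho g then Rh else Sg) (lab N f u) = u"
    by (induction N f u rule: lab.induct) auto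
  then show "cfree u \<Longrightarrow> pat (mono_of N f u) = u" by (simp add: pat_def letters_mono_of)
qed

lemma alternating_lab:
  assumes "altw u" "u \<noteq> []" "f \<in> {1..N}"
  shows "alternating N (lab N f u)"
  using assms
proof (induction N f u rule: lab.induct)
  case (2 N f w)
  show ?case
  proof (cases w)
    case (Cons a v)
    then have "a = Sg" using 2 by (cases a) (auto simp: altw_def)
    then show ?thesis using 2 by (simp add: Cons altw_def alternating_def res_Suc_prev)
  qed (use 2 in \<open>simp add: alternating_def\<close>)
next
  case (3 N f w)
  then have p: "prev N f \<in> {1..N}" by (intro prev_in) auto
  show ?case
  proof (cases w)
    case (Cons a v)
    then have "a = Rh" using 3 by (cases a) (auto simp: altw_def)
    then show ?thesis using 3 p by (simp add: Cons altw_def alternating_def)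
  qed (use p in \<open>simp add: alternating_def\<close>)
qed (simp_all add: altw_def)

lemma mono_of_in: "altw u \<Longrightarrow> f \<in> {1..N} \<Longrightarrow> mono_of N f u \<in> monomials N"
  by (simp add: mono_of_def monomials_def alternating_lab)

lemma alternating_lab_inv:
  assumes "alternating N w"
  shows "lab N (gen_final N (hd w)) (map (\<lambda>g. if is_rho g then Rh else Sg) w) = w \<and>
    altw (map (\<lambda>g. if is_rho g then Rh else Sg) w) \<and> gen_final N (hd w) \<in> {1..N}"
  using assms
proof (induction w)
  case (Cons g w)
  have g: "idx g \<in> {1..N}" using Cons.prems by (simp add: alternating_def)
  then have N: "N > 0" by auto
  have fg: "gen_final N g \<in> {1..N}" using g res_in [OF N] by (cases g) auto
  have pg: "prev N (res N (Suc i)) = i" if "i \<in> {1..N}" for i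
    using that N by (simp add: prev_res_Suc res_id)
  show ?case
  proof (cases "w = []")
    case True
    then show ?thesis using fg g pg by (cases g) (auto simp: altw_def)
  next
    case False
    then obtain h w' where w: "w = h # w'" by (cases w) auto
    then have "alternating N w" using Cons.prems by (auto simp: alternating_def)
    note IH = Cons.IH [OF this]
    have gh: "idx g = gen_final N h" "is_rho g \<noteq> is_rho h"
      using Cons.prems by (auto simp: alternating_def w)
    then show ?thesis using IH fg g pg
      by (cases g; cases h) (auto simp: altw_def w)
  qed
qed (simp add: alternating_def)

text \<open>Basis monomials correspond to pairs of a final idempotent and an alternating pattern,
  with inverse \<open>mono_of\<close>. This correspondence carries the results on words over to the
  algebra.\<close>

lemma monomials_cases:
  assumes "m \<in> monomials N"
  shows "mono_of N (final N m) (pat m) = m" and "altw (pat m)" and "final N m \<in> {1..N}"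
proof -
  have "mono_of N (final N m) (pat m) = m \<and> altw (pat m) \<and> final N m \<in> {1..N}"
    using assms alternating_lab_inv [of N]
    by (auto simp: monomials_def mono_of_def pat_def altw_def alternating_def)
  then show "mono_of N (final N m) (pat m) = m" and "altw (pat m)" and "final N m \<in> {1..N}" by auto
qed

lemma is_sigma_iff: "is_sigma g \<longleftrightarrow> \<not> is_rho g"
  by (cases g) auto

lemma len_pat: "len m = cnt (pat m)"
  by (auto simp: len_def sigmas_def cnt_def pat_def count_list_eq_length_filter filter_map o_def
      is_sigma_iff intro!: arg_cong [where f = length] filter_cong)

lemma mono_weight_mono_of: "mono_weight N (mono_of N f u) = word_weight N (lab N f u)"
  by (simp add: mono_weight_def letters_mono_of)

lemma starts_rho_pat: "starts_rho m \<longleftrightarrow> pat m \<noteq> [] \<and> hd (pat m) \<noteq> Sg"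
  by (auto simp: starts_rho_def pat_def hd_map split: if_splits)

lemma ends_rho_pat: "ends_rho m \<longleftrightarrow> pat m \<noteq> [] \<and> last (pat m) \<noteq> Sg"
  by (auto simp: ends_rho_def pat_def last_map split: if_splits)

text \<open>The function to which \<open>bar\<close> is applied: an output pattern becomes the
  monomial with the final idempotent of the inputs, and words that are 0 in the algebra become
  0.\<close>

definition eval_at :: "nat \<Rightarrow> nat \<Rightarrow> letter list \<Rightarrow> alg" where
  "eval_at N f u = (if altw u then basis (mono_of N f u) else 0)"

lemma eval_at_0: "\<not> altw u \<Longrightarrow> eval_at N f u = 0"
  by (simp add: eval_at_def)

lemma idempotents_match_Cons:
  "idempotents_match N (t # ts) \<longleftrightarrow> idempotents_match N ts \<and> (ts = [] \<or> initial t = final N (hd ts))"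
  by (cases ts) (auto simp: idempotents_match_def)

lemma idempotents_match_append:
  "idempotents_match N (us @ ts) \<longleftrightarrow> idempotents_match N us \<and> idempotents_match N ts \<and>
    (us = [] \<or> ts = [] \<or> initial (last us) = final N (hd ts))"
  by (auto simp: idempotents_match_def successively_append_iff)

lemma seq_lab:
  assumes "set ts \<subseteq> monomials N" "idempotents_match N ts" "ts \<noteq> []"
  shows "seq_word ts = lab N (final N (hd ts)) (join (map pat ts))" (is ?A)
    and "initial (last ts) = shift N (final N (hd ts)) (join (map pat ts))" (is ?B)
proof -
  have "?A \<and> ?B" using assms
  proof (induction ts)
    case (Cons t ts)
    have t: "t \<in> monomials N" using Cons.prems by simp
    have lt: "letters t = lab N (final N t) (pat t)" "initial t = shift N (final N t) (pat t)"
      using monomials_cases [OF t] letters_mono_of [of N "final N t" "pat t"]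
        initial_mono_of [of "pat t" N "final N t"] by (auto simp: altw_def)
    show ?case
    proof (cases "ts = []")
      case True
      then show ?thesis using lt by (simp add: seq_word_def)
    next
      case False
      then have "seq_word ts = lab N (initial t) (join (map pat ts)) \<and>
          initial (last ts) = shift N (initial t) (join (map pat ts))"
        using Cons by (simp add: idempotents_match_Cons)
      then show ?thesis using False lt by (simp add: seq_word_def join_Cons lab_append)
    qed
  qed simp
  then show ?A ?B by auto
qed

definition seq_weight :: "nat \<Rightarrow> mono list \<Rightarrow> coeff" where
  "seq_weight N ts = word_weight N (seq_word ts)"

lemma seq_weight_simps [simp]:
  "seq_weight N [] = 1" "seq_weight N (t # ts) = mono_weight N t * seq_weight N ts"
  "seq_weight N (us @ ts) = seq_weight N us * seq_weight N ts"
  by (simp_all add: seq_weight_def seq_word_def mono_weight_def)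

lemma total_len_join: "total_len ts = cnt (join (map pat ts))"
  by (induction ts) (simp_all add: total_len_def join_Cons len_pat)

section \<open>Weights of blocks\<close>

lemma cnt_gapped: "gapped w \<Longrightarrow> w \<noteq> [] \<Longrightarrow>
    2 * cnt w + 1 = length w + of_bool (hd w = Sg) + of_bool (last w = Sg)"
  by (induction w) (auto simp: gapped_Cons split: if_splits)

lemma cnt_block: "block N b \<Longrightarrow> cnt b = N"
  using cnt_gapped [of b] block_last [of N b] block_not_Nil [of N b] by (auto simp: block_def)

lemma shift_block: "f \<in> {1..N} \<Longrightarrow> block N b \<Longrightarrow> shift N f b = f"
  using prev_pow_mod [of N f N 0] by (auto simp: shift_def cnt_block)

text \<open>\<open>block_coeff\<close> takes a product over a set of indices, while a weight counts
  occurrences of letters. They agree because the indices of the gaps are successive points of the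
  orbit of \<open>f\<close> under \<open>prev\<close>, which are distinct as long as
  \<open>n \<le> N\<close>. The general \<open>n\<close> lets the induction strip one
  \<open>\<sigma>\<close> and one gap at a time.\<close>

lemma block_weight:
  assumes "block n b" "n \<le> N" "f \<in> {1..N}"
  shows "word_weight N (lab N f b) =
      (\<Prod>i=1..n. if (prev N ^^ i) f = N then V (N + 1) else 1) * (\<Prod>l\<in>{l. Rho l \<in> set (lab N f b)}. V l)"
    and "{l. Rho l \<in> set (lab N f b)} \<subseteq> (\<lambda>i. (prev N ^^ i) f) ` {1..<n}"
    and "cfree b \<Longrightarrow> {l. Rho l \<in> set (lab N f b)} = (\<lambda>i. (prev N ^^ i) f) ` {1..<n}"
proof -
  let ?W = "\<lambda>n f. \<Prod>i=1..n. if (prev N ^^ i) f = N then V (N + 1) else 1"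
  let ?I = "\<lambda>n f. (\<lambda>i. (prev N ^^ i) f) ` {1..<n}"
  let ?R = "\<lambda>f b. {l. Rho l \<in> set (lab N f b)}"
  have "word_weight N (lab N f b) = ?W n f * (\<Prod>l\<in>?R f b. V l) \<and> ?R f b \<subseteq> ?I n f \<and>
      (cfree b \<longrightarrow> ?R f b = ?I n f)"
    using assms
  proof (induction b arbitrary: n f rule: induct_list012)
    case (2 a)
    then show ?case by (cases a) auto
  next
    case (3 a g w)
    then have a: "a = Sg" by (cases "a = Sg") auto
    with "3.prems" have g: "g \<noteq> Sg" by (cases "g = Sg") auto
    with "3.prems" a have b: "block (n - 1) w" by simp
    then obtain m where m: "n = Suc m" "m > 0"
      by (cases n; cases "n - 1") (auto simp: block_def)
    let ?p = "prev N f"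
    have N: "N > 0" using "3.prems" by auto
    have p: "?p \<in> {1..N}" using N by (rule prev_in)
    have IH: "word_weight N (lab N ?p w) = ?W m ?p * (\<Prod>l\<in>?R ?p w. V l)" "?R ?p w \<subseteq> ?I m ?p"
      "cfree w \<Longrightarrow> ?R ?p w = ?I m ?p"
      using "3.IH"(1) [of m ?p] b m p "3.prems" by auto
    have I: "?I n f = insert ?p (?I m ?p)"
    proof -
      have "{1..<n} = insert 1 (Suc ` {1..<m})" using m by (auto simp: image_Suc_atLeastLessThan)
      then have "?I n f = insert ?p ((\<lambda>i. (prev N ^^ i) f) ` Suc ` {1..<m})"
        by (simp only: image_insert) simp
      then show ?thesis unfolding image_image by (simp add: funpow_swap1)
    qed
    have W: "?W n f = (if ?p = N then V (N + 1) else 1) * ?W m ?p"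
    proof -
      let ?g = "\<lambda>i. if (prev N ^^ i) f = N then V (N + 1) else 1"
      have "?W n f = ?g 1 * prod ?g {Suc 1..Suc m}" unfolding m by (rule prod.atLeast_Suc_atMost) simp
      then show ?thesis unfolding prod.shift_bounds_cl_Suc_ivl by (simp add: funpow_swap1)
    qed
    have np: "?p \<notin> ?R ?p w"
    proof
      assume "?p \<in> ?R ?p w"
      then obtain i where "i \<in> {1..<m}" "(prev N ^^ i) ?p = (prev N ^^ 0) ?p" using IH(2) by auto
      then show False using prev_pow_inj [OF N p, of i 0] m "3.prems" by auto
    qed
    have fin: "finite (?R ?p w)" using IH(2) finite_surj by blast
    show ?case
    proof (cases g)
      case Rh
      then have R: "?R f (a # g # w) = insert ?p (?R ?p w)" by (auto simp: a)
      show ?thesis unfolding R I W using IH np fin by (auto simp: a Rh ac_simps)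
    next
      case Cm
      then have R: "?R f (a # g # w) = ?R ?p w" by (auto simp: a)
      show ?thesis unfolding R I W using IH by (auto simp: a Cm ac_simps)
    qed (use g in auto)
  qed simp
  then show "word_weight N (lab N f b) = ?W n f * (\<Prod>l\<in>?R f b. V l)"
    and "?R f b \<subseteq> ?I n f" and "cfree b \<Longrightarrow> ?R f b = ?I n f" by auto
qed

lemma prev_orbit:
  assumes f: "f \<in> {1..N}"
  shows "bij_betw (\<lambda>i. (prev N ^^ i) f) {1..N} {1..N}" and "(prev N ^^ N) f = f"
proof -
  have N: "N > 0" using f by auto
  have pm: "(prev N ^^ (k mod N)) f = (prev N ^^ k) f" for k by (rule prev_pow_mod [OF N f]) simp
  show "(prev N ^^ N) f = f" using pm [of N] by simp
  have "inj_on (\<lambda>i. (prev N ^^ i) f) {1..N}"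
  proof (rule inj_onI)
    fix i j assume ij: "i \<in> {1..N}" "j \<in> {1..N}" and eq: "(prev N ^^ i) f = (prev N ^^ j) f"
    have "(prev N ^^ (i mod N)) f = (prev N ^^ (j mod N)) f" unfolding pm by (rule eq)
    then have ijN: "i mod N = j mod N" by (rule prev_pow_inj [OF N f mod_less_divisor [OF N] mod_less_divisor [OF N]])
    show "i = j"
    proof (cases "i = N \<or> j = N")
      case True
      then have "N dvd i" "N dvd j" using ijN by (auto simp: mod_eq_0_iff_dvd [symmetric])
      then have "N \<le> i" "N \<le> j" using ij by (auto intro: dvd_imp_le)
      then show ?thesis using ij by simp
    next
      case False
      then show ?thesis using ijN ij by (simp add: mod_less)
    qed
  qed
  moreover have "(\<lambda>i. (prev N ^^ i) f) ` {1..N} \<subseteq> {1..N}"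
  proof (rule image_subsetI)
    fix i show "(prev N ^^ i) f \<in> {1..N}" unfolding prev_pow [OF N f] by (rule res_in [OF N])
  qed
  ultimately show "bij_betw (\<lambda>i. (prev N ^^ i) f) {1..N} {1..N}"
    unfolding bij_betw_def by (intro conjI endo_inj_surj finite_atLeastAtMost)
qed

text \<open>The core of homogeneity: cutting off a block multiplies by the weight of the block. Its
  sigmas carry every index once and together contribute \<open>V (N + 1)\<close>; its gaps carry
  every index except \<open>f\<close>, which yields \<open>V_except N f\<close> when all of them are
  filled with \<open>\<rho>\<close>.\<close>

lemma block_coeff_weight:
  assumes b: "block N b" and f: "f \<in> {1..N}"
  shows "block_coeff N (lab N f b) = word_weight N (lab N f b)"
    and "cfree b \<Longrightarrow> V_except N f = word_weight N (lab N f b)"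
proof -
  note bij = prev_orbit [OF f]
  have N: "N > 0" using f by auto
  have "(\<Prod>i=1..N. if (prev N ^^ i) f = N then V (N + 1) else 1) = (\<Prod>l=1..N. if l = N then V (N + 1) else 1)"
    by (rule prod.reindex_bij_betw [OF bij(1)])
  also have "\<dots> = V (N + 1)" using N by (simp add: prod.delta)
  finally have w: "word_weight N (lab N f b) = block_coeff N (lab N f b)"
    using block_weight(1) [OF b order_refl f] by (simp add: block_coeff_def)
  then show "block_coeff N (lab N f b) = word_weight N (lab N f b)" by simp
  assume "cfree b"
  then have "{l. Rho l \<in> set (lab N f b)} = (\<lambda>i. (prev N ^^ i) f) ` ({1..N} - {N})"
    using block_weight(3) [OF b order_refl f] by (auto simp: image_def)
  also have "\<dots> = {1..N} - {f}"
    using bij N inj_on_image_set_diff [of "\<lambda>i. (prev N ^^ i) f" "{1..N}" "{1..N}" "{N}"]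
    by (auto simp: bij_betw_def)
  finally have R: "{l. Rho l \<in> set (lab N f b)} = {1..N} - {f}" .
  have "{1..N + 1} - {f} = insert (N + 1) ({1..N} - {f})" using f by auto
  then have "V_except N f = V (N + 1) * (\<Prod>l\<in>{1..N} - {f}. V l)"
    by (simp add: V_except_def)
  then show "V_except N f = word_weight N (lab N f b)"
    unfolding w block_coeff_def R .
qed

section \<open>The operations in terms of patterns\<close>

lemma gapped_prefix: "gapped (u @ v) \<Longrightarrow> gapped u" and gapped_suffix: "gapped (u @ v) \<Longrightarrow> gapped v"
  by (simp_all add: gapped_append)

text \<open>Alternation and a final \<open>Sg\<close> make the last \<open>2 * N - 1\<close> letters
  a block. The length admits no other choice, so the sum defining the cut is this one term, or 0 if
  the leftover contains a comma.\<close>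

lemma cut_right_window:
  assumes S: "gapped S" "last S = Sg" and N: "N \<ge> 1" "cnt S \<ge> N"
  obtains x b where "S = x @ b" "block N b" "x = [] \<or> last x \<noteq> Sg" "length x = length S - (2 * N - 1)"
    "\<And>e :: letter list \<Rightarrow> 'a::comm_monoid_add. cut_right N e S = (if cfree x then e x else 0)"
proof -
  have S0: "S \<noteq> []" using N by auto
  have len: "2 * N - 1 \<le> length S"
    using cnt_gapped [OF S(1) S0] S N by (cases "hd S = Sg") auto
  define x where "x = take (length S - (2 * N - 1)) S"
  define b where "b = drop (length S - (2 * N - 1)) S"
  have xb: "S = x @ b" by (simp add: x_def b_def)
  have lb: "length b = 2 * N - 1" using len by (simp add: b_def)
  then have b0: "b \<noteq> []" using N by auto
  have gb: "gapped b" using S xb gapped_suffix by metis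
  have "last b = Sg" using S b0 by (simp add: xb)
  then have hb: "hd b = Sg" using cnt_gapped [OF gb b0] lb N by (cases "hd b = Sg") (simp, simp, presburger)
  then have b: "block N b" using gb lb N by (simp add: block_def)
  moreover have x: "x = [] \<or> last x \<noteq> Sg" using S(1) b0 hb by (auto simp: xb gapped_append)
  moreover have "cut_right N e S = (if cfree x then e x else 0)" for e :: "letter list \<Rightarrow> 'a"
  proof -
    have "cut_right N e S = (if 2 * N - 1 \<le> length S then
        (if block N b then rho_right e x else 0) else 0)"
      unfolding cut_right_def x_def b_def by (rule splits_single_right) (auto simp: block_def)
    then show ?thesis using len b x by (auto simp: rho_right_def)
  qed
  moreover have "length x = length S - (2 * N - 1)" by (simp add: x_def)
  ultimately show ?thesis using that xb by blast
qed

lemma cut_left_window: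
  assumes S: "gapped S" "hd S = Sg" and N: "N \<ge> 1" "cnt S \<ge> N"
  obtains b z where "S = b @ z" "block N b" "z = [] \<or> hd z \<noteq> Sg" "length z = length S - (2 * N - 1)"
    "\<And>e :: letter list \<Rightarrow> 'a::comm_monoid_add. cut_left N e S = (if cfree z then e z else 0)"
proof -
  have S0: "S \<noteq> []" using N by auto
  have "cnt (rev S) = cnt S" by (simp add: cnt_def)
  then obtain x b where xb: "rev S = x @ b" "block N b" "x = [] \<or> last x \<noteq> Sg"
      "length x = length (rev S) - (2 * N - 1)"
      "\<And>e :: letter list \<Rightarrow> 'a. cut_right N e (rev S) = (if cfree x then e x else 0)"
    using cut_right_window [of "rev S" N] S S0 N by (auto simp: last_rev)
  have "S = rev b @ rev x" using xb(1) by (metis rev_append rev_rev_ident)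
  moreover have "rev x = [] \<or> hd (rev x) \<noteq> Sg" using xb(3) by (auto simp: hd_rev)
  moreover have "length (rev x) = length S - (2 * N - 1)" using xb(4) by simp
  moreover have "cut_left N e S = (if cfree (rev x) then e (rev x) else 0)" for e :: "letter list \<Rightarrow> 'a"
    unfolding cut_left_def xb(5) by simp
  ultimately show ?thesis using that [of "rev b" "rev x"] xb(2) by simp
qed

lemma split_sigmas_append:
  "u = [] \<or> is_sigma (last u) \<Longrightarrow> split_sigmas (sigmas u) (u @ v) = (u, v)"
proof (induction u)
  case (Cons g u)
  then have IH: "u \<noteq> [] \<Longrightarrow> split_sigmas (sigmas u) (u @ v) = (u, v)" by auto
  show ?case
  proof (cases "u = []")
    case True
    then show ?thesis using Cons.prems by (simp add: sigmas_def)
  next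
    case False
    then have "filter is_sigma u \<noteq> []" using Cons.prems by (metis filter_empty_conv last.simps last_in_set list.distinct(1))
    then have "\<exists>n. sigmas u = Suc n" by (cases "filter is_sigma u") (auto simp: sigmas_def)
    then show ?thesis using IH False by (auto simp: sigmas_def)
  qed
qed (simp add: sigmas_def)

lemma last_sigma_lab: "last b = Sg \<Longrightarrow> b \<noteq> [] \<Longrightarrow> is_sigma (last (lab N f b)) \<and> lab N f b \<noteq> []"
  by (induction N f b rule: lab.induct) (auto split: if_splits)

lemma hd_sigma_lab: "hd b = Sg \<Longrightarrow> b \<noteq> [] \<Longrightarrow> is_sigma (hd (lab N f b)) \<and> lab N f b \<noteq> []"
  by (cases "(N, f, b)" rule: lab.cases) auto

lemma left_cut_lab:
  assumes "block N b"
  shows "left_block N (lab N f (b @ z)) = lab N f b"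
    and "left_rest N (lab N f (b @ z)) = lab N (shift N f b) z"
  using split_sigmas_append [of "lab N f b" "lab N (shift N f b) z"]
    last_sigma_lab [of b N f] block_last [OF assms] block_not_Nil [OF assms] cnt_block [OF assms]
  by (simp_all add: left_block_def left_rest_def lab_append)

lemma right_cut_lab:
  assumes "block N b"
  shows "right_block N (lab N f (x @ b)) = lab N (shift N f x) b"
    and "right_rest N (lab N f (x @ b)) = lab N f x"
proof -
  let ?u = "lab N (shift N f x) b"
  have "sigmas (rev ?u) = N" using cnt_block [OF assms]
    by (simp add: sigmas_def flip: rev_filter) (metis sigmas_def sigmas_lab)
  moreover have "rev ?u = [] \<or> is_sigma (last (rev ?u))"
    using hd_sigma_lab [of b N "shift N f x"] block_not_Nil [OF assms] assms
    by (simp add: last_rev block_def)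
  ultimately have "split_sigmas N (rev ?u @ rev (lab N f x)) = (rev ?u, rev (lab N f x))"
    using split_sigmas_append by metis
  then show "right_block N (lab N f (x @ b)) = ?u" "right_rest N (lab N f (x @ b)) = lab N f x"
    by (simp_all add: right_block_def right_rest_def lab_append)
qed

lemma leftover_lab: "cfree u \<Longrightarrow> leftover f (lab N f u) = basis (mono_of N f u)"
  by (simp add: leftover_def mono_of_def)

section \<open>Allowability in terms of the joined word\<close>

lemma total_len_drop_le: "total_len (drop q ts) \<le> total_len ts"
  by (induction ts arbitrary: q) (auto simp: total_len_def drop_Cons' intro: le_SucI trans_le_add2)

lemma total_len_take_le: "total_len (take q ts) \<le> total_len ts"
  using append_take_drop_id [of q ts] by (metis le_add1 map_append sum_list_append total_len_def)

text \<open>Total length is monotone, so the longest proper part decides.\<close>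

lemma S2_iff: "N \<ge> 1 \<Longrightarrow> S2 N ts \<longleftrightarrow> length ts \<ge> 2 \<and> total_len (tl ts) \<ge> N"
proof
  assume "N \<ge> 1" "S2 N ts"
  then obtain q where q: "1 \<le> q" "q < length ts" "total_len (drop q ts) \<ge> N" by (auto simp: S2_def)
  then have "drop q ts = drop (q - 1) (tl ts)" by (cases q) (auto simp: drop_Suc)
  then have "total_len (tl ts) \<ge> N" using q(3) total_len_drop_le [of "q - 1" "tl ts"] by simp
  then show "length ts \<ge> 2 \<and> total_len (tl ts) \<ge> N" using q by simp
next
  assume "length ts \<ge> 2 \<and> total_len (tl ts) \<ge> N"
  then show "S2 N ts" unfolding S2_def by (intro bexI [of _ 1]) (auto simp: drop_Suc)
qed

lemma S1_iff: "N \<ge> 1 \<Longrightarrow> ts \<noteq> [] \<Longrightarrow> S1 N ts \<longleftrightarrow> total_len (butlast ts) \<ge> N"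
proof
  assume "N \<ge> 1" "ts \<noteq> []" "S1 N ts"
  then obtain q where q: "q < length ts" "total_len (take q ts) \<ge> N" by (auto simp: S1_def)
  then have "take q ts = take q (butlast ts)" by (simp add: take_butlast)
  then show "total_len (butlast ts) \<ge> N" using q(2) total_len_take_le [of q "butlast ts"] by simp
next
  assume "ts \<noteq> []" "total_len (butlast ts) \<ge> N"
  then show "S1 N ts" unfolding S1_def
    by (intro exI [of _ "length ts - 1"]) (auto simp: butlast_conv_take)
qed

lemma good_join:
  assumes "us \<noteq> []" "\<And>u. u \<in> set us \<Longrightarrow> altw u \<and> u \<noteq> []"
    "\<And>u. u \<in> set (tl us) \<Longrightarrow> hd u = Sg" "\<And>u. u \<in> set (butlast us) \<Longrightarrow> last u = Sg"
  shows "good (join us)"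
proof -
  have "gapped (join us) \<and> join us \<noteq> [] \<and> hd (join us) = hd (hd us) \<and> last (join us) = last (last us)"
    using assms
  proof (induction us)
    case (Cons u us)
    show ?case
    proof (cases "us = []")
      case False
      have IH: "gapped (join us) \<and> join us \<noteq> [] \<and> hd (join us) = hd (hd us) \<and> last (join us) = last (last us)"
        using Cons.prems False by (intro Cons.IH) (auto dest: list.set_sel(2))
      moreover have "hd (hd us) = Sg" "last u = Sg" "altw u" "u \<noteq> []"
        using Cons.prems False by auto
      ultimately show ?thesis using False
        by (auto simp: join_Cons gapped_append gapped_Cons altw_def)
    qed (use Cons.prems in \<open>simp add: altw_def\<close>)
  qed simp
  moreover have "hd (hd us) \<noteq> Cm" "last (last us) \<noteq> Cm"
    using assms(1) assms(2) [of "hd us"] assms(2) [of "last us"]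
    by (auto simp: altw_def cfree_hd cfree_last)
  ultimately show ?thesis by (simp add: good_def)
qed

lemma good_joinD:
  assumes "good (join us)" "u \<in> set us"
  shows "u \<noteq> []" and "u \<in> set (tl us) \<Longrightarrow> hd u = Sg" and "u \<in> set (butlast us) \<Longrightarrow> last u = Sg"
proof -
  show "u \<noteq> []"
    using assms good_middleD(1) by (metis in_set_conv_decomp)
  show "hd u = Sg" if u: "u \<in> set (tl us)"
  proof -
    obtain A C where "tl us = A @ u # C" using u by (metis in_set_conv_decomp)
    then have "us = (hd us # A) @ u # C" using u by (cases us) auto
    then show ?thesis using good_middleD(3) [of "hd us # A" u C] assms by simp
  qed
  show "last u = Sg" if u: "u \<in> set (butlast us)"
  proof -
    obtain A C where "butlast us = A @ u # C" using u by (metis in_set_conv_decomp)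
    then have "us = A @ u # (C @ [last us])" using u
      by (metis append_assoc append_Cons append_butlast_last_id butlast.simps(1) list.distinct(1) append_is_Nil_conv)
    then show ?thesis using good_middleD(2) [of A u "C @ [last us]"] assms by simp
  qed
qed

text \<open>The leftover avoids all commas exactly if it lies within the first entry, that is, if
  the block covers the first comma. What follows that comma starts and ends with \<open>Sg\<close>,
  so comparing its length with the block amounts to comparing its number of sigmas with
  \<open>N\<close>. This is the failure of (S2).\<close>

lemma cfree_right_window:
  assumes "good (join us)" "us \<noteq> []" "\<And>u. u \<in> set us \<Longrightarrow> cfree u" "N \<ge> 1"
    and x: "join us = x @ b" "length x = length (join us) - (2 * N - 1)" "2 * N - 1 \<le> length (join us)"
    and "last (join us) = Sg"
  shows "cfree x \<longleftrightarrow> length us = 1 \<or> cnt (join (tl us)) < N"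
proof -
  obtain u vs where us: "us = u # vs" using assms(2) by (cases us) auto
  show ?thesis
  proof (cases "vs = []")
    case True
    then show ?thesis using us x assms(3) by simp
  next
    case False
    let ?J = "join vs"
    have S: "join us = u @ Cm # ?J" using us False by (simp add: join_Cons)
    have g: "gapped ?J" "?J \<noteq> []" "hd ?J = Sg" "last ?J = Sg"
      using assms(1,8) unfolding S by (auto simp: good_def gapped_append gapped_Cons split: if_splits)
    have c: "2 * cnt ?J = length ?J + 1" using cnt_gapped [OF g(1,2)] g by simp
    have "cfree x \<longleftrightarrow> length x \<le> length u"
    proof
      assume "cfree x"
      then show "length x \<le> length u"
      proof (rule contrapos_pp)
        assume "\<not> length x \<le> length u"
        then have "x ! length u = Cm" "length u < length x"
          using x(1) S by (auto simp: nth_append dest: arg_cong [where f = "\<lambda>l. l ! length u"] split: if_splits)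
        then show "\<not> cfree x" by (metis cfree_def nth_mem)
      qed
    next
      assume l: "length x \<le> length u"
      have "x = take (length x) (u @ Cm # ?J)" using x(1) S by (metis append_eq_conv_conj)
      then have "x = take (length x) u" using l by simp
      then have "set x \<subseteq> set u" by (metis set_take_subset)
      then show "cfree x" using assms(3) [of u] us by (auto simp: cfree_def)
    qed
    also have "\<dots> \<longleftrightarrow> length ?J + 2 \<le> 2 * N" using x(2,3) S by auto
    also have "\<dots> \<longleftrightarrow> cnt ?J < N" using c by auto
    finally show ?thesis using us False by simp
  qed
qed

lemma cfree_left_window:
  assumes "good (join us)" "us \<noteq> []" "\<And>u. u \<in> set us \<Longrightarrow> cfree u" "N \<ge> 1"
    and z: "join us = b @ z" "length z = length (join us) - (2 * N - 1)" "2 * N - 1 \<le> length (join us)"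
    and "hd (join us) = Sg"
  shows "cfree z \<longleftrightarrow> length us = 1 \<or> cnt (join (butlast us)) < N"
proof -
  let ?us = "rev (map rev us)"
  have r: "join ?us = rev (join us)" by (simp add: rev_join)
  have "join us \<noteq> []" using assms(1) by (simp add: good_def)
  then have "cfree (rev z) \<longleftrightarrow> length ?us = 1 \<or> cnt (join (tl ?us)) < N"
  proof (intro cfree_right_window [where b = "rev b"])
    show "join ?us = rev z @ rev b" unfolding r assms(5) by simp
    show "last (join ?us) = Sg" unfolding r using assms(8) \<open>join us \<noteq> []\<close> by (simp only: last_rev)
  qed (use assms(1-4,6,7) in \<open>auto simp: r\<close>)
  moreover have "join (tl ?us) = rev (join (butlast us))"
    by (simp add: rev_join map_butlast flip: butlast_rev) (metis butlast_rev map_butlast rev_rev_ident rev_map)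
  ultimately show ?thesis by (simp add: cnt_def)
qed

lemma rescale_0 [simp]: "rescale N 0 = 0"
  by (simp add: rescale_def)

lemma lin_rescale: "lin h (rescale N x) = lin (\<lambda>m. smul (mono_weight N m) (h m)) x"
  by (simp add: rescale_def lin_lin lin_smul)

text \<open>The coefficient is the weight of the removed block, and multiplied by the weight of the
  leftover it gives the weight of the whole sequence.\<close>

lemma rescale_cut_from_right:
  assumes ts: "set ts \<subseteq> monomials N" "idempotents_match N ts" "ts \<noteq> []"
    and S: "join (map pat ts) = x @ b" "block N b" "cfree x" "gapped x"
  shows "rescale N (cut_from_right N ts) = smul (seq_weight N ts) (eval_at N (final N (hd ts)) x)"
proof -
  let ?f = "final N (hd ts)"
  have f: "?f \<in> {1..N}" using ts monomials_cases(3) [of "hd ts" N] hd_in_set by blast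
  have w: "seq_word ts = lab N ?f (x @ b)" using seq_lab(1) [OF ts] S(1) by simp
  have "cut_from_right N ts = smul (word_weight N (lab N (shift N ?f x) b)) (basis (mono_of N ?f x))"
    by (simp add: cut_from_right_def w right_cut_lab [OF S(2)] leftover_lab S(3)
        block_coeff_weight(1) [OF S(2) shift_in [OF f]])
  then show ?thesis
    using S(3,4) by (simp add: eval_at_def altw_def seq_weight_def w lab_append mono_weight_mono_of mult.commute)
qed

lemma rescale_cut_from_left:
  assumes ts: "set ts \<subseteq> monomials N" "idempotents_match N ts" "ts \<noteq> []"
    and S: "join (map pat ts) = b @ z" "block N b" "cfree z" "gapped z"
  shows "rescale N (cut_from_left N ts) = smul (seq_weight N ts) (eval_at N (final N (hd ts)) z)"
proof -
  let ?f = "final N (hd ts)"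
  have f: "?f \<in> {1..N}" using ts monomials_cases(3) [of "hd ts" N] hd_in_set by blast
  have w: "seq_word ts = lab N ?f (b @ z)" using seq_lab(1) [OF ts] S(1) by simp
  have s: "shift N ?f b = ?f" by (rule shift_block [OF f S(2)])
  have "leftover (initial (last ts)) (lab N ?f z) = basis (mono_of N ?f z)"
    using seq_lab(2) [OF ts] S(1) s S(3) leftover_lab [of z ?f N] by (cases "z = []") (simp_all add: leftover_def)
  then have "cut_from_left N ts = smul (word_weight N (lab N ?f b)) (basis (mono_of N ?f z))"
    by (simp add: cut_from_left_def w left_cut_lab [OF S(2)] s block_coeff_weight(1) [OF S(2) f])
  then show ?thesis
    using S(3,4) s by (simp add: eval_at_def altw_def seq_weight_def w lab_append mono_weight_mono_of)
qed

lemma hd_join: "us \<noteq> [] \<Longrightarrow> hd us \<noteq> [] \<Longrightarrow> hd (join us) = hd (hd us)"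
  by (cases us) (simp_all add: join_Cons)

lemma last_join: "us \<noteq> [] \<Longrightarrow> last us \<noteq> [] \<Longrightarrow> last (join us) = last (last us)"
  by (cases us rule: rev_cases) (simp_all add: join_append)

lemma cnt_pos: "u \<noteq> [] \<Longrightarrow> hd u = Sg \<or> last u = Sg \<Longrightarrow> cnt u > 0"
  by (metis cnt_def count_list_0_iff gr0I hd_in_set last_in_set)

lemma length_le_total_len: "(\<And>t. t \<in> set ts \<Longrightarrow> len t > 0) \<Longrightarrow> length ts \<le> total_len ts"
  by (induction ts) (force simp: total_len_def)+

lemma phi_few_sigmas: "cnt S < N \<Longrightarrow> phi N e S = 0"
proof -
  assume S: "cnt S < N"
  have b: "\<not> block N b" if "x @ b = S \<or> b @ x = S" for x b
    using that S cnt_block [of N b] by auto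
  have "cut_right N e S = 0"
    unfolding cut_right_def using b by (intro splits_zero) auto
  moreover have "cut_left N e S = 0"
    unfolding cut_left_splits using b by (intro splits_zero) auto
  moreover have "cut_all N e S = 0" using b [of "[]" S] by (simp add: cut_all_def)
  ultimately show ?thesis by (simp add: phi_def)
qed

text \<open>The shape conditions on an allowable sequence say that its joined pattern is
  \<open>good\<close>. For such a pattern the cut from the right is nonzero exactly if the word ends
  in \<open>Sg\<close> and (S2) fails, and the cut from the left exactly if it begins with
  \<open>Sg\<close> and (S1) fails. Stretching too far and impermissible flanking are the cases in
  which both vanish, and the case distinction in \<open>long_op\<close> lists which cuts
  remain.\<close>

lemma rescale_long_op:
  assumes N: "N \<ge> 1" and ts: "set ts \<subseteq> monomials N" "idempotents_match N ts" "ts \<noteq> []"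
  shows "rescale N (if total_len ts \<ge> N \<and> allowable N ts then long_op N ts else 0) =
    smul (seq_weight N ts) (phi N (eval_at N (final N (hd ts))) (join (map pat ts)))"
proof -
  let ?us = "map pat ts" and ?G = "seq_weight N ts" and ?e = "eval_at N (final N (hd ts))"
  let ?S = "join ?us"
  have alt: "altw u" if "u \<in> set ?us" for u using that ts monomials_cases(2) by auto
  have cf: "cfree u" if "u \<in> set ?us" for u using alt [OF that] by (simp add: altw_def)
  consider "total_len ts < N" | "\<not> good ?S" "total_len ts \<ge> N" | "good ?S" "total_len ts \<ge> N" by linarith
  then show ?thesis
  proof cases
    case 1
    then show ?thesis using phi_few_sigmas [of ?S N ?e] by (simp add: total_len_join)
  next
    case 2
    have "\<not> allowable N ts"
    proof
      assume al: "allowable N ts"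
      have p: "pat t \<noteq> []" if "t \<in> set ts" for t
        using al that by (auto simp: allowable_def len_pat)
      have "hd (pat t) = Sg" if "t \<in> set (tl ts)" for t
        using al that p [of t] ts(3) by (auto simp: allowable_def starts_rho_pat dest: list.set_sel(2))
      moreover have "last (pat t) = Sg" if "t \<in> set (butlast ts)" for t
        using al that p [of t] by (auto simp: allowable_def ends_rho_pat dest: in_set_butlastD)
      ultimately have "good ?S"
        using alt p ts(3) by (intro good_join) (auto simp flip: map_tl map_butlast)
      with 2 show False by simp
    qed
    moreover have "phi N ?e ?S = 0" by (rule phi_not_good [OF 2(1) eval_at_0])
    ultimately show ?thesis by simp
  next
    case 3
    then have g: "gapped ?S" and n: "cnt ?S \<ge> N" and S0: "?S \<noteq> []"
      by (auto simp: good_def total_len_join)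
    have us0: "?us \<noteq> []" using ts(3) by simp
    have pat: "pat t \<noteq> []" "t \<in> set (tl ts) \<Longrightarrow> hd (pat t) = Sg" "t \<in> set (butlast ts) \<Longrightarrow> last (pat t) = Sg"
      if "t \<in> set ts" for t
      using good_joinD [OF 3(1), of "pat t"] that by (auto simp flip: map_tl map_butlast)
    have lf: "left_flanked ts \<longleftrightarrow> hd ?S \<noteq> Sg"
      using pat(1) [of "hd ts"] ts(3) us0 by (simp add: left_flanked_def starts_rho_pat hd_join hd_map)
    have rf: "right_flanked ts \<longleftrightarrow> last ?S \<noteq> Sg"
      using pat(1) [of "last ts"] ts(3) us0 by (simp add: right_flanked_def ends_rho_pat last_join last_map)
    have len: "len t > 0" if t: "t \<in> set ts" for t
    proof (cases "length ts \<ge> 2")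
      case True
      have "t \<in> set (tl ts) \<or> t \<in> set (butlast ts)"
        using t True by (cases ts; cases "tl ts") auto
      then show ?thesis using pat [OF t] cnt_pos [of "pat t"] by (auto simp: len_pat)
    next
      case False
      then have "ts = [t]" using t by (cases ts; cases "tl ts") auto
      then show ?thesis using n N by (simp add: len_pat)
    qed
    have s2: "S2 N ts \<longleftrightarrow> length ts \<noteq> 1 \<and> \<not> cnt (join (tl ?us)) < N"
      using S2_iff [OF N, of ts] ts(3) by (cases ts; cases "tl ts") (auto simp: total_len_join)
    have s1: "S1 N ts \<longleftrightarrow> length ts \<noteq> 1 \<and> \<not> cnt (join (butlast ?us)) < N"
    proof (cases "length ts = 1")
      case True
      then show ?thesis using S1_iff [OF N ts(3)] N by (cases ts) (auto simp: total_len_def)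
    next
      case False
      then show ?thesis using S1_iff [OF N ts(3)] by (auto simp: total_len_join map_butlast)
    qed
    have R: "smul ?G (cut_right N ?e ?S) =
      (if last ?S = Sg \<and> \<not> S2 N ts then rescale N (cut_from_right N ts) else 0)"
    proof (cases "last ?S = Sg")
      case True
      obtain x b where xb: "?S = x @ b" "block N b" "x = [] \<or> last x \<noteq> Sg"
          "length x = length ?S - (2 * N - 1)" "\<And>e :: letter list \<Rightarrow> alg. cut_right N e ?S = (if cfree x then e x else 0)"
        by (rule cut_right_window [where ?'a = alg, OF g True N n]) (rule that)
      have l: "2 * N - 1 \<le> length ?S" using xb(1,2) by (auto simp: block_def)
      have "cfree x \<longleftrightarrow> \<not> S2 N ts"
        using cfree_right_window [OF 3(1) us0 cf N xb(1,4) l True] s2 by simp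
      moreover have "gapped x" using g xb(1) gapped_prefix by metis
      ultimately show ?thesis
        using rescale_cut_from_right [OF ts xb(1,2)] xb(5) True by simp
    next
      case False
      then show ?thesis by (simp add: cut_right_last [OF S0])
    qed
    have L: "smul ?G (cut_left N ?e ?S) =
      (if hd ?S = Sg \<and> \<not> S1 N ts then rescale N (cut_from_left N ts) else 0)"
    proof (cases "hd ?S = Sg")
      case True
      obtain b z where bz: "?S = b @ z" "block N b" "z = [] \<or> hd z \<noteq> Sg"
          "length z = length ?S - (2 * N - 1)" "\<And>e :: letter list \<Rightarrow> alg. cut_left N e ?S = (if cfree z then e z else 0)"
        by (rule cut_left_window [where ?'a = alg, OF g True N n]) (rule that)
      have l: "2 * N - 1 \<le> length ?S" using bz(1,2) by (auto simp: block_def)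
      have "cfree z \<longleftrightarrow> \<not> S1 N ts"
        using cfree_left_window [OF 3(1) us0 cf N bz(1,4) l True] s1 by simp
      moreover have "gapped z" using g bz(1) gapped_suffix by metis
      ultimately show ?thesis
        using rescale_cut_from_left [OF ts bz(1,2)] bz(5) True by simp
    next
      case False
      have "cut_left N ?e ?S = 0"
        unfolding cut_left_def using S0 False by (intro cut_right_last) (simp_all add: last_rev)
      then show ?thesis using False by simp
    qed
    have B: "block N ?S \<longleftrightarrow> hd ?S = Sg \<and> last ?S = Sg \<and> total_len ts = N"
      using cnt_gapped [OF g S0] g block_last [of N ?S] cnt_block [of N ?S]
      by (auto simp: total_len_join block_def)
    have E: "smul ?G (cut_all N ?e ?S) = (if block N ?S then rescale N (cut_from_right N ts) else 0)"
      using rescale_cut_from_right [OF ts, of "[]" ?S] by (simp add: cut_all_def)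
    have RL: "rescale N (cut_from_right N ts) = rescale N (cut_from_left N ts) \<and> \<not> S1 N ts \<and> \<not> S2 N ts"
      if B: "block N ?S"
    proof -
      have tot: "total_len ts = N" using B cnt_block by (simp add: total_len_join)
      have "total_len ts = len (hd ts) + total_len (tl ts)" "total_len ts = total_len (butlast ts) + len (last ts)"
        using ts(3) by (cases ts, auto simp: total_len_def, cases ts rule: rev_cases, auto)
      then have "total_len (tl ts) < N" "total_len (butlast ts) < N"
        using tot len [of "hd ts"] len [of "last ts"] ts(3) by auto
      then show ?thesis
        using rescale_cut_from_right [OF ts, of "[]" ?S] rescale_cut_from_left [OF ts, of ?S "[]"] B
          S1_iff [OF N ts(3)] S2_iff [OF N, of ts] by auto
    qed
    \<comment> \<open>If (S1) or (S2) fails, all entries but one contain fewer than \<open>N\<close>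
      sigmas in total, and each of them contains at least one.\<close>
    have le: "length ts \<le> N" if "\<not> (S1 N ts \<and> S2 N ts)"
    proof (cases "S1 N ts")
      case True
      show ?thesis
      proof (cases "length ts \<ge> 2")
        case True
        have "length (tl ts) \<le> total_len (tl ts)"
        proof (rule length_le_total_len)
          fix t assume "t \<in> set (tl ts)"
          then show "len t > 0" using len [OF list.set_sel(2) [OF ts(3)]] by simp
        qed
        then show ?thesis using \<open>S1 N ts\<close> that S2_iff [OF N, of ts] True by simp
      qed (use N in simp)
    next
      case False
      then have "length (butlast ts) < N"
        using S1_iff [OF N ts(3)] length_le_total_len [of "butlast ts"] len by (fastforce dest: in_set_butlastD)
      then show ?thesis by simp
    qed
    have al: "allowable N ts \<longleftrightarrow> \<not> (S1 N ts \<and> S2 N ts) \<and> \<not> impermissibly_flanked N ts"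
    proof -
      have "t \<in> set (tl ts) \<Longrightarrow> \<not> starts_rho t" "t \<in> set (butlast ts) \<Longrightarrow> \<not> ends_rho t" for t
        using pat [of t] by (auto simp: starts_rho_pat ends_rho_pat dest: in_set_butlastD list.set_sel(2) [OF ts(3)])
      then show ?thesis
        using le ts len by (auto simp: allowable_def stretches_too_far_def)
    qed
    have "rescale N (if allowable N ts then long_op N ts else 0) =
      (if last ?S = Sg \<and> \<not> S2 N ts then rescale N (cut_from_right N ts) else 0) +
      (if hd ?S = Sg \<and> \<not> S1 N ts then rescale N (cut_from_left N ts) else 0) +
      (if block N ?S then rescale N (cut_from_right N ts) else 0)"
    proof (cases "block N ?S")
      case True
      then show ?thesis
        using RL [OF True] B by (simp add: al impermissibly_flanked_def lf rf long_op_def)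
    next
      case False
      then show ?thesis
        using B by (auto simp: al impermissibly_flanked_def lf rf long_op_def rescale_add)
    qed
    then show ?thesis using 3 R L E by (simp add: phi_def smul_add)
  qed
qed

section \<open>Products and the differential\<close>

lemma mult_lin: "mult N x y = lin (\<lambda>a. lin (mono_mult N a) y) x"
  by (simp add: mult_def lin_def smul_sum)

lemma mono_mult_mono_of:
  assumes "altw u" "altw v" "f \<in> {1..N}"
  shows "mono_mult N (mono_of N f u) (mono_of N (shift N f u) v) = eval_at N f (u @ v)"
proof -
  have f': "shift N f u \<in> {1..N}" using assms(3) by (rule shift_in)
  have cf: "cfree u" "cfree v" "gapped u" "gapped v" using assms by (auto simp: altw_def)
  show ?thesis
  proof (cases "u = [] \<or> v = []")
    case True
    have "idx (last (lab N f u)) = shift N f u" if "u \<noteq> []"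
      using that cf by (simp add: last_lab)
    then show ?thesis using True assms cf final_mono_of [of f N v]
      by (auto simp: mono_of_def eval_at_def)
  next
    case False
    have "mono_of N f u = Word (lab N f u)" "mono_of N (shift N f u) v = Word (lab N (shift N f u) v)"
      using False by (auto simp: mono_of_def)
    moreover have "idx (last (lab N f u)) = gen_final N (hd (lab N (shift N f u) v))"
      using False cf f' by (simp add: last_lab hd_lab final_Rho_Sig del: gen_final.simps(2))
    moreover have "is_rho (last (lab N f u)) \<noteq> is_rho (hd (lab N (shift N f u) v)) \<longleftrightarrow> altw (u @ v)"
      using False cf by (auto simp: last_lab hd_lab altw_def gapped_append)
    ultimately show ?thesis using False by (simp add: eval_at_def mono_of_def lab_append)
  qed
qed

lemma rescale_mono_mult: "rescale N (mono_mult N a b) = smul (mono_weight N a * mono_weight N b) (mono_mult N a b)"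
  by (cases "(N, a, b)" rule: mono_mult.cases) (auto simp: rescale_def)

lemma rescale_leibniz:
  assumes "altw u" "f \<in> {1..N}"
  shows "rescale N (leibniz N (lab N f u)) = smul (word_weight N (lab N f u)) (dels (eval_at N f) u)"
  using assms
proof (induction u arbitrary: f)
  case (Cons a u)
  have a: "a = Rh \<or> a = Sg" using Cons.prems by (cases a) (auto simp: altw_def)
  have u: "altw u" using Cons.prems by (auto simp: altw_def gapped_Cons)
  define g where "g = (if a = Rh then Rho f else Sig (prev N f))"
  define f' where "f' = shift N f [a]"
  have f': "f' \<in> {1..N}" unfolding f'_def using Cons.prems(2) by (rule shift_in)
  have ga: "lab N f [a] = [g]" "lab N f (a # u) = g # lab N f' u" using a by (auto simp: g_def f'_def)
  have mg: "mono_of N f [a] = Word [g]" by (simp add: mono_of_def ga)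
  show ?case
  proof (cases u)
    case Nil
    show ?thesis using a by (auto simp: Nil eval_at_def altw_def mono_of_def)
  next
    case (Cons b w)
    have cu: "cfree u" using u by (simp add: altw_def)
    then obtain h v where hv: "lab N f' u = h # v" using Cons by (cases "lab N f' u") auto
    let ?y = "leibniz N (h # v)"
    have IH: "rescale N ?y = smul (word_weight N (h # v)) (dels (eval_at N f') u)"
      using Cons.IH [OF u f'] by (simp only: hv)
    have first: "rescale N (mult N (diff_gen g) (basis (Word (h # v)))) =
        smul (word_weight N (g # h # v)) (if a = Sg then 0 else eval_at N f u)"
    proof (cases "a = Sg")
      case True
      then show ?thesis by (simp add: g_def mult_lin rescale_def)
    next
      case False
      then have "f' = f" "g = Rho f" using a by (auto simp: f'_def g_def)
      moreover have "mono_of N f u = Word (h # v)" using hv \<open>f' = f\<close> Cons by (simp add: mono_of_def)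
      moreover from this have "final N (Word (h # v)) = f"
        using final_mono_of [OF Cons.prems(2) cu] by simp
      ultimately show ?thesis using False u
        by (simp add: mult_lin lin_smul eval_at_def ac_simps del: final.simps)
    qed
    have "rescale N (mult N (basis (Word [g])) ?y) = lin (\<lambda>m. rescale N (mono_mult N (Word [g]) m)) ?y"
      by (simp add: mult_lin rescale_lin)
    also have "\<dots> = smul (gweight N g) (lin (mono_mult N (Word [g])) (rescale N ?y))"
      by (simp add: rescale_mono_mult lin_rescale flip: lin_smul_fun)
    also have "\<dots> = smul (word_weight N (g # h # v)) (lin (mono_mult N (Word [g])) (dels (eval_at N f') u))"
      by (simp add: IH lin_smul mult.assoc)
    also have "lin (mono_mult N (Word [g])) (dels (eval_at N f') u) =
        dels (\<lambda>v. lin (mono_mult N (Word [g])) (eval_at N f' v)) u"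
      by (rule dels_natural) (simp_all add: lin_add)
    also have "(\<lambda>v. lin (mono_mult N (Word [g])) (eval_at N f' v)) = (\<lambda>v. eval_at N f (a # v))"
    proof
      fix v
      show "lin (mono_mult N (Word [g])) (eval_at N f' v) = eval_at N f (a # v)"
      proof (cases "altw v")
        case True
        have "altw [a]" using a by (auto simp: altw_def)
        then show ?thesis
          using mono_mult_mono_of [of "[a]" v f N] True Cons.prems(2) by (simp add: eval_at_def [of N f' v] mg flip: f'_def)
      next
        case False
        then have "\<not> altw (a # v)" by (auto simp: altw_def gapped_Cons)
        then show ?thesis using False by (simp add: eval_at_def)
      qed
    qed
    finally have second: "rescale N (mult N (basis (Word [g])) ?y) =
        smul (word_weight N (g # h # v)) (dels (\<lambda>v. eval_at N f (a # v)) u)" .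
    show ?thesis
      unfolding ga hv leibniz.simps rescale_add first second by (simp add: smul_add)
  qed
qed (simp add: rescale_def)


lemma rescale_smul_mono_of:
  assumes "altw u" and "c * word_weight N (lab N f u) = g"
  shows "rescale N (smul c (basis (mono_of N f u))) = smul g (eval_at N f u)"
  using assms by (simp add: eval_at_def mono_weight_mono_of)

text \<open>Below \<open>N\<close> sigmas there is no block to remove, and deletion of letters is
  the Leibniz rule. From \<open>N\<close> sigmas on, each end of the word contributes one term: a
  \<open>\<rho>\<close> at the end is deleted, whereas at a \<open>\<sigma>\<close> a block is cut
  off. The coefficients are the weights of what is removed, and \<open>cut_all\<close> corrects the
  case in which both cuts remove the whole word.\<close>

lemma rescale_diff:
  assumes N: "N \<ge> 2" and m: "m \<in> monomials N"
  shows "rescale N (diff N m) = smul (mono_weight N m) (bar N (eval_at N (final N m)) [pat m])"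
proof -
  define f where "f = final N m"
  define u where "u = pat m"
  let ?e = "eval_at N f"
  have f: "f \<in> {1..N}" and u: "altw u" and mu: "mono_of N f u = m"
    using monomials_cases [OF m] by (auto simp: f_def u_def)
  have cf: "cfree u" and gu: "gapped u" using u by (auto simp: altw_def)
  show ?thesis
  proof (cases "u = []")
    case True
    then have "m = Idem f" using mu by (simp add: mono_of_def)
    then show ?thesis by (simp add: bar_def pat_def)
  next
    case u0: False
    let ?w = "lab N f u"
    have mw: "m = Word ?w" using mu u0 by (simp add: mono_of_def)
    have w: "mono_weight N m = word_weight N ?w" by (simp add: mw)
    have sg: "sigmas ?w = cnt u" by simp
    show ?thesis
    proof (cases "cnt u < N")
      case True
      then have "diff N m = leibniz N ?w" by (simp add: mw Let_def)
      then show ?thesis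
        using rescale_leibniz [OF u f] phi_few_sigmas [OF True, of ?e]
        by (simp add: bar_def w flip: u_def f_def)
    next
      case False
      then have n: "cnt u \<ge> N" "N \<ge> 1" using N by auto
      have "2 * cnt u + 1 \<le> length u + 2" unfolding cnt_gapped [OF gu u0] by (simp add: of_bool_def)
      \<comment> \<open>Here \<open>N \<ge> 2\<close> enters: \<open>dels_altw\<close> and the
        formulas for the differential treat the two ends as different letters.\<close>
      then have l2: "length u \<ge> 2" using n N by linarith
      define i where "i = shift N f u"
      have iw: "initial (Word ?w) = i" "final N (Word ?w) = f"
        using initial_mono_of [OF cf, of N f] final_mono_of [OF f cf] mu by (simp_all only: mw i_def)
      have hdw: "is_rho (hd ?w) \<longleftrightarrow> hd u \<noteq> Sg" using u0 cf by (simp add: hd_lab)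
      have lastw: "is_rho (last ?w) \<longleftrightarrow> last u \<noteq> Sg" using u0 cf by (simp add: last_lab)
      define CL where "CL = smul (V_except N f) (leftover i (left_rest N ?w))"
      define CR where "CR = smul (V_except N i) (leftover f (right_rest N ?w))"
      have R: "smul (word_weight N ?w) (cut_right N ?e u) = (if last u = Sg then rescale N CR else 0)"
      proof (cases "last u = Sg")
        case True
        obtain x b where xb: "u = x @ b" "block N b" "x = [] \<or> last x \<noteq> Sg" "length x = length u - (2 * N - 1)"
            "\<And>e :: letter list \<Rightarrow> alg. cut_right N e u = (if cfree x then e x else 0)"
          by (rule cut_right_window [where ?'a = alg, OF gu True n(2,1)]) (rule that)
        have x: "altw x" "cfree b" "cfree x" using u xb(1) gapped_prefix [of x b] by (auto simp: altw_def)
        have "shift N f x = i"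
          using shift_block [OF shift_in [OF f] xb(2)] by (simp add: i_def xb(1))
        then have "V_except N i = word_weight N (lab N (shift N f x) b)"
          using block_coeff_weight(2) [OF xb(2) shift_in [OF f] x(2), of x] by simp
        then have "rescale N CR = smul (word_weight N ?w) (?e x)"
          unfolding CR_def xb(1) right_cut_lab [OF xb(2)] leftover_lab [OF x(3)]
          using x(1) by (intro rescale_smul_mono_of) (simp_all add: lab_append mult.commute)
        then show ?thesis using xb(5) x True by (simp add: altw_def)
      qed (simp add: cut_right_last u0)
      have L: "smul (word_weight N ?w) (cut_left N ?e u) = (if hd u = Sg then rescale N CL else 0)"
      proof (cases "hd u = Sg")
        case True
        obtain b z where bz: "u = b @ z" "block N b" "z = [] \<or> hd z \<noteq> Sg" "length z = length u - (2 * N - 1)"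
            "\<And>e :: letter list \<Rightarrow> alg. cut_left N e u = (if cfree z then e z else 0)"
          by (rule cut_left_window [where ?'a = alg, OF gu True n(2,1)]) (rule that)
        have z: "altw z" "cfree b" using u bz(1) gapped_suffix [of b z] by (auto simp: altw_def)
        have s: "shift N f b = f" by (rule shift_block [OF f bz(2)])
        have lo: "leftover i (lab N f z) = basis (mono_of N f z)"
          using z leftover_lab [of z f N] s by (cases "z = []") (auto simp: leftover_def altw_def i_def bz(1))
        have "V_except N f = word_weight N (lab N f b)"
          by (rule block_coeff_weight(2) [OF bz(2) f z(2)])
        then have "rescale N CL = smul (word_weight N ?w) (?e z)"
          unfolding CL_def bz(1) left_cut_lab [OF bz(2)] s lo
          using z(1) s by (intro rescale_smul_mono_of) (simp_all add: lab_append)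
        then show ?thesis using bz(5) z True by (simp add: altw_def)
      next
        case False
        have "cut_left N ?e u = 0"
          unfolding cut_left_def using u0 False by (intro cut_right_last) (simp_all add: last_rev)
        then show ?thesis using False by simp
      qed
      have B: "block N u \<longleftrightarrow> hd u = Sg \<and> last u = Sg \<and> cnt u = N"
      proof
        assume "block N u"
        then show "hd u = Sg \<and> last u = Sg \<and> cnt u = N"
          using block_last cnt_block by (auto simp: block_def)
      next
        assume "hd u = Sg \<and> last u = Sg \<and> cnt u = N"
        then show "block N u" using cnt_gapped [OF gu u0] gu by (simp add: block_def)
      qed
      have E: "smul (word_weight N ?w) (cut_all N ?e u) = (if block N u then rescale N CR else 0)"
        and CLR: "block N u \<Longrightarrow> rescale N CL = rescale N CR"
      proof -
        have "rescale N CR = smul (word_weight N ?w) (?e []) \<and> rescale N CL = rescale N CR" if b: "block N u"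
        proof -
          have i: "i = f" unfolding i_def by (rule shift_block [OF f b])
          have "left_rest N ?w = []" "right_rest N ?w = []"
            using left_cut_lab(2) [OF b, of f "[]"] right_cut_lab(2) [OF b, of f "[]"] by auto
          then show ?thesis
            using block_coeff_weight(2) [OF b f cf]
            by (simp add: CR_def CL_def i leftover_def eval_at_def altw_def mono_of_def)
        qed
        then show "smul (word_weight N ?w) (cut_all N ?e u) = (if block N u then rescale N CR else 0)"
          "block N u \<Longrightarrow> rescale N CL = rescale N CR"
          by (auto simp: cut_all_def)
      qed
      define DL where "DL = smul (V f) (basis (Word (tl ?w)))"
      define DR where "DR = smul (V i) (basis (Word (butlast ?w)))"
      have DL: "rescale N DL = smul (word_weight N ?w) (?e (tl u))"
        if h: "hd u \<noteq> Sg"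
      proof -
        obtain v where v: "u = Rh # v" using h u0 cf by (cases u; cases "hd u") auto
        have "altw v" using u v by (auto simp: altw_def gapped_Cons)
        moreover have "v \<noteq> []" using l2 v by auto
        ultimately show ?thesis using rescale_smul_mono_of [of v "V f" N f "word_weight N ?w"]
          by (simp add: v mono_of_def DL_def)
      qed
      have DR: "rescale N DR = smul (word_weight N ?w) (?e (butlast u))"
        if h: "last u \<noteq> Sg"
      proof -
        obtain v a where va: "u = v @ [a]" using u0 by (metis append_butlast_last_id)
        then have v: "u = v @ [Rh]" using h cf by (cases a) auto
        have "altw v" using u v by (auto simp: altw_def gapped_append)
        moreover have "v \<noteq> []" using l2 v by auto
        ultimately show ?thesis using rescale_smul_mono_of [of v "V i" N f "word_weight N ?w"]
          by (simp add: v mono_of_def lab_append i_def mult.commute DR_def)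
      qed
      have d: "dels ?e u = (if hd u = Sg then 0 else ?e (tl u)) + (if last u = Sg then 0 else ?e (butlast u))"
        by (rule dels_altw [OF u l2]) (rule eval_at_0)
      have "rescale N (diff N m) =
        (if hd u = Sg then 0 else smul (word_weight N ?w) (?e (tl u))) +
        (if last u = Sg then 0 else smul (word_weight N ?w) (?e (butlast u))) +
        (if last u = Sg then rescale N CR else 0) + (if hd u = Sg then rescale N CL else 0) +
        (if block N u then rescale N CR else 0)"
      proof -
        have "diff N m =
          (if \<not> is_rho (hd ?w) \<and> \<not> is_rho (last ?w) then
             (if cnt u = N then CR else CL + CR)
           else if is_rho (hd ?w) \<and> \<not> is_rho (last ?w) then
             DL + CR
           else if \<not> is_rho (hd ?w) \<and> is_rho (last ?w) then
             DR + CL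
           else DL + DR)"
          unfolding mw diff.simps Let_def iw CL_def CR_def DL_def DR_def is_sigma_iff sg if_not_P [OF False] by (rule refl)
        then show ?thesis
          unfolding hdw lastw using B CLR by (auto simp: rescale_add DL DR add_ac)
      qed
      also have "\<dots> = smul (word_weight N ?w) (dels ?e u + phi N ?e u)"
        unfolding d phi_def smul_add R L E by (simp add: add_ac)
      finally show ?thesis by (simp add: bar_def w flip: u_def f_def)
    qed
  qed
qed

text \<open>Homogeneity of all unweighted operations at once: what is left of an operation, apart
  from the weight of its inputs, is \<open>bar\<close> on patterns.\<close>

theorem rescale_mu_mono:
  assumes N: "N \<ge> 2" and ts: "set ts \<subseteq> monomials N" "idempotents_match N ts" "ts \<noteq> []"
  shows "rescale N (mu_mono N ts) =
    smul (seq_weight N ts) (bar N (eval_at N (final N (hd ts))) (map pat ts))"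
proof (cases "length ts = 1")
  case True
  then obtain m where "ts = [m]" by (cases ts) auto
  then show ?thesis using rescale_diff [OF N, of m] ts by (simp add: mu_mono_def)
next
  case False
  let ?f = "final N (hd ts)"
  have "rescale N (simple_mult N ts) = smul (seq_weight N ts) (short (eval_at N ?f) (map pat ts))"
  proof (cases "length ts = 2")
    case True
    then obtain a b where ab: "ts = [a, b]" by (cases ts; cases "tl ts"; cases "tl (tl ts)") auto
    have a: "mono_of N (final N a) (pat a) = a" "altw (pat a)" "final N a \<in> {1..N}"
      and b: "mono_of N (final N b) (pat b) = b" "altw (pat b)"
      using ts monomials_cases [of a N] monomials_cases [of b N] by (auto simp: ab)
    have "final N b = shift N (final N a) (pat a)"
      using ts(2) initial_mono_of [of "pat a" N "final N a"] a by (simp add: ab idempotents_match_def altw_def)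
    then have "mono_mult N a b = eval_at N (final N a) (pat a @ pat b)"
      using mono_mult_mono_of [OF a(2) b(2) a(3)] a(1) b(1) by simp
    then show ?thesis using rescale_mono_mult [of N a b] by (simp add: ab simple_mult_def)
  next
    case False': False
    then have "length (map pat ts) \<ge> 3" using False ts(3) by (cases ts; cases "tl ts"; cases "tl (tl ts)") auto
    then show ?thesis using False' by (simp add: simple_mult_def short_long)
  qed
  then show ?thesis
    using rescale_long_op [OF _ ts] N False ts(3)
    by (simp add: mu_mono_def rescale_add bar_def smul_add)
qed

section \<open>The relations on monomials\<close>

lemma cut_right_natural:
  assumes "T 0 = 0" and "\<And>x y. T (x + y) = T x + T y"
  shows "T (cut_right N e S) = cut_right N (\<lambda>u. T (e u)) S"
  unfolding cut_right_def splits_natural [where T = T, OF assms]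
  by (rule splits_cong) (auto simp: rho_right_def assms(1))

lemma bar_natural:
  assumes "T 0 = 0" and "\<And>x y. T (x + y) = T x + T y"
  shows "T (bar N e us) = bar N (\<lambda>u. T (e u)) us"
proof -
  have "T (short e us) = short (\<lambda>u. T (e u)) us"
    by (cases us; cases "tl us"; cases "tl (tl us)") (auto simp: assms(1) dels_natural [where T = T, OF assms])
  then show ?thesis
    by (simp add: bar_def phi_def cut_left_def cut_all_def assms(2) cut_right_natural [where T = T, OF assms])
      (simp add: assms(1))
qed

text \<open>
  The outputs have the same number of \<open>\<sigma>\<close> modulo \<open>N\<close> as the input, hence the same initial idempotent.
\<close>

lemma bar_cong:
  assumes us: "\<And>u. u \<in> set us \<Longrightarrow> cfree u"
    and e: "\<And>u. cfree u \<Longrightarrow> cnt u mod N = cnt (join us) mod N \<Longrightarrow> e u = e' u"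
  shows "bar N e us = bar N e' us"
proof -
  let ?S = "join us"
  have short: "short e us = short e' us"
  proof (cases us rule: short.cases [of "(e, us)" for us, simplified])
    fix u assume u: "us = [u]"
    have "dels e u = dels e' u"
    proof (rule dels_cong)
      fix p a q assume "u = p @ a # q" "a \<noteq> Sg"
      then show "e (p @ q) = e' (p @ q)" using us [of u] by (intro e) (auto simp: u)
    qed
    then show ?thesis by (simp add: u)
  next
    fix u v assume uv: "us = [u, v]"
    have "e (u @ v) = e' (u @ v)" using us by (intro e) (auto simp: uv)
    then show ?thesis by (simp add: uv)
  qed auto
  have b: "cnt x mod N = cnt ?S mod N" if "block N b" "x @ b = ?S \<or> b @ x = ?S" for x b
  proof -
    have "cnt ?S = cnt x + cnt b" using that(2) by (metis add.commute cnt_simps(3))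
    then show ?thesis using cnt_block [OF that(1)] by simp
  qed
  have "cut_right N e ?S = cut_right N e' ?S"
    unfolding cut_right_def by (rule splits_cong) (auto simp: rho_right_def intro!: e b)
  moreover have "cut_left N e ?S = cut_left N e' ?S"
    unfolding cut_left_splits by (rule splits_cong) (auto intro!: e b)
  moreover have "cut_all N e ?S = cut_all N e' ?S"
    using b [of ?S "[]"] e [of "[]"] by (simp add: cut_all_def)
  ultimately show ?thesis using short by (simp add: bar_def phi_def)
qed

lemma not_gapped_split: "\<not> gapped w \<Longrightarrow> \<exists>p a b q. w = p @ a # b # q \<and> (a = Sg) = (b = Sg)"
proof (induction w rule: induct_list012)
  case (3 a b w)
  show ?case
  proof (cases "(a = Sg) = (b = Sg)")
    case True
    then show ?thesis by (metis append_Nil)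
  next
    case False
    then have "\<not> gapped (b # w)" using 3 by simp
    then obtain p c d q where "b # w = p @ c # d # q" "(c = Sg) = (d = Sg)" using "3.IH"(2) by blast
    then show ?thesis by (metis append_Cons)
  qed
qed simp_all

text \<open>Deletions produce words with \<open>\<rho>\<rho>\<close> or
  \<open>\<sigma>\<sigma>\<close>, which are 0 in the algebra, so an outer \<open>bar\<close> has to
  vanish on them. In the differential of such a word, deleting a letter elsewhere keeps the adjacent
  pair, and the two ways of shortening \<open>\<rho>\<rho>\<close> cancel.\<close>

lemma bar_not_altw:
  fixes e :: "letter list \<Rightarrow> 'a::char2_group"
  assumes u: "cfree u" "\<not> altw u" and e: "\<And>w. \<not> altw w \<Longrightarrow> e w = 0"
  shows "bar N e (A @ u # C) = 0"
proof -
  have ng: "\<not> gapped u" using u by (simp add: altw_def)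
  have "\<not> good (join (A @ u # C))" using good_middleD(4) ng by blast
  then have "phi N e (join (A @ u # C)) = 0" by (rule phi_not_good [OF _ e])
  moreover have "short e (A @ u # C) = 0"
  proof -
    consider "A = []" "C = []" | t where "A = [t]" "C = []" | t where "A = []" "C = [t]" |
        "length (A @ u # C) \<ge> 3"
      by (cases A; cases "tl A"; cases C; cases "tl C") auto
    then show ?thesis
    proof cases
      case 1
      obtain p a b q where w: "u = p @ a # b # q" "(a = Sg) = (b = Sg)"
        using not_gapped_split [OF ng] by blast
      then have ab: "b = a" using u(1) by (cases a; cases b) auto
      have "\<not> altw (x @ a # a # y)" for x y by (simp add: altw_def gapped_append)
      then have "dels e u = 0"
        unfolding w(1) ab dels_append by (simp add: e add_ac)
      then show ?thesis using 1 by simp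
    next
      case (2 t)
      have "e (t @ u) = 0" using ng by (intro e) (simp add: altw_def gapped_append)
      then show ?thesis using 2 by simp
    next
      case (3 t)
      have "e (u @ t) = 0" using ng by (intro e) (simp add: altw_def gapped_append)
      then show ?thesis using 3 by simp
    next
      case 4
      then show ?thesis by (rule short_long)
    qed
  qed
  ultimately show ?thesis by (simp add: bar_def)
qed

definition spans :: "nat \<Rightarrow> nat \<Rightarrow> nat \<Rightarrow> mono \<Rightarrow> bool" where
  "spans N f i m \<longleftrightarrow> (\<exists>u. altw u \<and> m = mono_of N f u \<and> shift N f u = i)"

lemma spansD:
  assumes "spans N f i m" "f \<in> {1..N}"
  shows "m \<in> monomials N" and "final N m = f" and "initial m = i" and "altw (pat m)"
    and "m = mono_of N f (pat m)"
  using assms by (auto simp: spans_def altw_def mono_of_in final_mono_of initial_mono_of pat_mono_of)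

lemma bar_eval_at:
  assumes "set ts \<subseteq> monomials N" "idempotents_match N ts" "ts \<noteq> []"
  defines "f \<equiv> final N (hd ts)" and "i \<equiv> initial (last ts)"
  shows "bar N (eval_at N f) (map pat ts) =
    bar N (\<lambda>u. if spans N f i (mono_of N f u) then eval_at N f u else 0) (map pat ts)"
proof (rule bar_cong)
  show "cfree u" if "u \<in> set (map pat ts)" for u
    using that assms(1) monomials_cases(2) by (auto simp: altw_def)
  fix u assume u: "cfree u" "cnt u mod N = cnt (join (map pat ts)) mod N"
  have f: "f \<in> {1..N}" using assms monomials_cases(3) [of "hd ts" N] hd_in_set by blast
  then have "N > 0" by auto
  then have "shift N f u = i"
    using seq_lab(2) [OF assms(1-3)] prev_pow_mod [OF _ f u(2)] by (simp add: i_def f_def shift_def)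
  then show "eval_at N f u = (if spans N f i (mono_of N f u) then eval_at N f u else 0)"
    by (auto simp: eval_at_def spans_def)
qed

lemma keys_mu_mono:
  assumes N: "N \<ge> 2" and ts: "set ts \<subseteq> monomials N" "idempotents_match N ts" "ts \<noteq> []"
    and m: "m \<in> Poly_Mapping.keys (mu_mono N ts)"
  shows "spans N (final N (hd ts)) (initial (last ts)) m"
proof -
  let ?f = "final N (hd ts)" and ?i = "initial (last ts)"
  \<comment> \<open>The projection onto monomials with the prescribed idempotents. It fixes the
    rescaled output, whose monomials therefore all have these idempotents.\<close>
  define p where "p = lin (\<lambda>m. if spans N ?f ?i m then basis m else 0)"
  let ?y = "bar N (eval_at N ?f) (map pat ts)"
  have "p ?y = bar N (\<lambda>u. p (eval_at N ?f u)) (map pat ts)"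
    by (rule bar_natural) (simp_all add: p_def lin_add)
  also have "(\<lambda>u. p (eval_at N ?f u)) =
      (\<lambda>u. if spans N ?f ?i (mono_of N ?f u) then eval_at N ?f u else 0)"
    by (rule ext) (simp add: eval_at_def p_def)
  also have "bar N \<dots> (map pat ts) = ?y" using bar_eval_at [OF ts] by simp
  finally have py: "p ?y = ?y" .
  have "m \<in> Poly_Mapping.keys (rescale N (mu_mono N ts))" using m by simp
  then have "m \<in> Poly_Mapping.keys (p ?y)"
    unfolding rescale_mu_mono [OF N ts] py by (auto simp: in_keys_iff)
  moreover have "Poly_Mapping.lookup (p x) m = 0" if "\<not> spans N ?f ?i m" for x
    unfolding p_def lin_def lookup_sum
    using that by (intro sum.neutral) (auto simp: basis_def lookup_single when_def)
  ultimately show ?thesis by (auto simp: in_keys_iff)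
qed

lemma mu_mono_mismatch: "\<not> idempotents_match N ts \<Longrightarrow> mu_mono N ts = 0"
proof -
  assume ts: "\<not> idempotents_match N ts"
  then have "length ts \<noteq> 0" "length ts \<noteq> 1"
    by (auto simp: idempotents_match_def length_Suc_conv)
  moreover have "simple_mult N ts = 0"
  proof (cases "length ts = 2")
    case True
    then obtain a b where ab: "ts = [a, b]" by (cases ts; cases "tl ts"; cases "tl (tl ts)") auto
    then have "initial a \<noteq> final N b" using ts by (simp add: idempotents_match_def)
    then have "mono_mult N a b = 0" by (cases "(N, a, b)" rule: mono_mult.cases) auto
    then show ?thesis by (simp add: ab simple_mult_def)
  qed (simp add: simple_mult_def)
  ultimately show ?thesis using ts by (auto simp: mu_mono_def allowable_def)
qed

lemma idempotents_match_replace: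
  assumes "idempotents_match N B" "B \<noteq> []" "final N m = final N (hd B)" "initial m = initial (last B)"
  shows "idempotents_match N (A @ m # C) \<longleftrightarrow> idempotents_match N (A @ B @ C)"
  using assms by (auto simp: idempotents_match_append idempotents_match_Cons)

text \<open>After \<open>rescale\<close> all terms share the factor \<open>seq_weight N ts\<close>,
  and what remains is \<open>bar_relation\<close> for the patterns, evaluated at the final
  idempotent of the sequence.\<close>

theorem mono_relation:
  assumes N: "N \<ge> 2" and ts: "set ts \<subseteq> monomials N"
  shows "splits3 (\<lambda>A B C. lin (\<lambda>m. mu_mono N (A @ m # C)) (mu_mono N B)) ts = 0"
proof (cases "idempotents_match N ts \<and> ts \<noteq> []")
  case False
  show ?thesis
  proof (rule splits3_zero)
    fix A B C assume ABC: "ts = A @ B @ C"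
    show "lin (\<lambda>m. mu_mono N (A @ m # C)) (mu_mono N B) = 0"
    proof (cases "idempotents_match N B \<and> B \<noteq> []")
      case True
      have B: "set B \<subseteq> monomials N" using ts ABC by auto
      have f: "final N (hd B) \<in> {1..N}" using B True monomials_cases(3) [of "hd B" N] hd_in_set by blast
      \<comment> \<open>The inner output has the outer idempotents of the entries it replaces, so a
        mismatch elsewhere in \<open>ts\<close> persists.\<close>
      have "lin (\<lambda>m. mu_mono N (A @ m # C)) (mu_mono N B) = lin (\<lambda>m. 0) (mu_mono N B)"
      proof (rule lin_cong)
        fix m assume "m \<in> Poly_Mapping.keys (mu_mono N B)"
        then have "spans N (final N (hd B)) (initial (last B)) m" using keys_mu_mono [OF N B] True by blast
        then have "\<not> idempotents_match N (A @ m # C)"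
          using spansD [OF _ f] False True idempotents_match_replace [of N B m A C] ABC by auto
        then show "mu_mono N (A @ m # C) = 0" by (rule mu_mono_mismatch)
      qed
      then show ?thesis by simp
    next
      case False
      then have "mu_mono N B = 0" using mu_mono_mismatch [of N B] by (auto simp: mu_mono_def)
      then show ?thesis by simp
    qed
  qed
next
  case True
  define f where "f = final N (hd ts)"
  let ?e = "eval_at N f"
  have e0: "\<not> altw w \<Longrightarrow> ?e w = 0" for w by (rule eval_at_0)
  have cf: "cfree t" if "t \<in> set (map pat ts)" for t
    using that ts monomials_cases(2) by (auto simp: altw_def)
  have main: "rescale N (lin (\<lambda>m. mu_mono N (A @ m # C)) (mu_mono N B)) =
      smul (seq_weight N ts) (bar N (\<lambda>u. bar N ?e (map pat A @ u # map pat C)) (map pat B))"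
    if ABC: "ts = A @ B @ C" for A B C
  proof (cases "B = []")
    case True
    then show ?thesis by (simp add: mu_mono_def bar_def)
  next
    case B0: False
    have B: "set B \<subseteq> monomials N" "idempotents_match N B"
      using ts True ABC by (auto simp: idempotents_match_append)
    define fB where "fB = final N (hd B)"
    define iB where "iB = initial (last B)"
    have fB: "fB \<in> {1..N}" unfolding fB_def using B B0 monomials_cases(3) [of "hd B" N] hd_in_set by blast
    let ?k = "\<lambda>u. bar N ?e (map pat A @ u # map pat C)"
    have h: "rescale N (mu_mono N (A @ m # C)) =
        smul (seq_weight N A * mono_weight N m * seq_weight N C) (?k (pat m))"
      if m: "m \<in> Poly_Mapping.keys (mu_mono N B)" for m
    proof -
      have sp: "spans N fB iB m" unfolding fB_def iB_def by (rule keys_mu_mono [OF N B B0 m])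
      have "idempotents_match N (A @ m # C)"
        using idempotents_match_replace [OF B(2) B0] spansD [OF sp fB] True ABC
        by (auto simp: fB_def iB_def)
      moreover have "set (A @ m # C) \<subseteq> monomials N" using ts ABC spansD [OF sp fB] by auto
      moreover have "final N (hd (A @ m # C)) = f"
        using spansD [OF sp fB] ABC B0 by (auto simp: f_def fB_def hd_append)
      ultimately show ?thesis
        using rescale_mu_mono [OF N, of "A @ m # C"] by (simp add: mult.assoc)
    qed
    let ?y = "bar N (eval_at N fB) (map pat B)"
    have "rescale N (lin (\<lambda>m. mu_mono N (A @ m # C)) (mu_mono N B)) =
      lin (\<lambda>m. smul (seq_weight N A * mono_weight N m * seq_weight N C) (?k (pat m))) (mu_mono N B)"
      unfolding rescale_lin by (rule lin_cong) (rule h)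
    also have "\<dots> = smul (seq_weight N A * seq_weight N C) (lin (\<lambda>m. ?k (pat m)) (rescale N (mu_mono N B)))"
      unfolding lin_rescale lin_smul_fun [symmetric] by (simp add: ac_simps)
    also have "\<dots> = smul (seq_weight N ts) (lin (\<lambda>m. ?k (pat m)) ?y)"
      unfolding rescale_mu_mono [OF N B B0] by (simp add: lin_smul fB_def ABC ac_simps)
    also have "lin (\<lambda>m. ?k (pat m)) ?y = bar N (\<lambda>u. lin (\<lambda>m. ?k (pat m)) (eval_at N fB u)) (map pat B)"
      by (rule bar_natural) (simp_all add: lin_add)
    also have "\<dots> = bar N ?k (map pat B)"
    proof (rule bar_cong)
      show "cfree u" if "u \<in> set (map pat B)" for u using cf that ABC by auto
      fix u assume u: "cfree u"
      have "\<not> altw u \<Longrightarrow> ?k u = 0" by (rule bar_not_altw [OF u _ e0])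
      then show "lin (\<lambda>m. ?k (pat m)) (eval_at N fB u) = ?k u"
        using u by (cases "altw u") (simp_all add: eval_at_def pat_mono_of)
    qed
    finally show ?thesis .
  qed
  have "rescale N (splits3 (\<lambda>A B C. lin (\<lambda>m. mu_mono N (A @ m # C)) (mu_mono N B)) ts) =
    splits3 (\<lambda>A B C. rescale N (lin (\<lambda>m. mu_mono N (A @ m # C)) (mu_mono N B))) ts"
    unfolding splits3_def by (simp add: splits_natural [where T = "rescale N"] rescale_add)
  also have "\<dots> = splits3 (\<lambda>A B C. smul (seq_weight N ts)
      (bar N (\<lambda>u. bar N ?e (map pat A @ u # map pat C)) (map pat B))) ts"
    by (rule splits3_cong) (rule main)
  also have "\<dots> = smul (seq_weight N ts)
      (splits3 (\<lambda>A B C. bar N (\<lambda>u. bar N ?e (map pat A @ u # map pat C)) (map pat B)) ts)"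
    unfolding splits3_def by (simp add: splits_natural [where T = "smul c" for c] smul_add)
  also have "splits3 (\<lambda>A B C. bar N (\<lambda>u. bar N ?e (map pat A @ u # map pat C)) (map pat B)) ts =
      splits3 (\<lambda>A B C. bar N (\<lambda>u. bar N ?e (A @ u # C)) B) (map pat ts)"
    by (simp add: splits3_map)
  also have "\<dots> = 0" using N by (intro bar_relation cf e0) auto
  finally show ?thesis by simp
qed

section \<open>The curvature relation on monomials\<close>

lemma U0_eq: "N \<ge> 1 \<Longrightarrow> U0 N = (\<Sum>i = 1..N. basis (mono_of N i (srs N)) + basis (mono_of N i (rss N)))"
proof -
  assume N: "N \<ge> 1"
  have s: "concat (map (\<lambda>t. [Sig (res N (i + t)), Rho (res N (i + t))]) (rev [0..<n])) =
      lab N (res N (i + n)) (srs n)"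
    and r: "concat (map (\<lambda>t. [Rho (res N (i + t + 1)), Sig (res N (i + t))]) (rev [0..<n])) =
      lab N (res N (i + n)) (rss n)" for i n
    using N by (induction n) (simp_all add: srs_Suc prev_res_Suc, simp_all add: srs_def rss_def)
  have "res N (i + N) = i" if "i \<in> {1..N}" for i
  proof -
    have "res N (i + N) = res N i" using that by (intro res_eqI) auto
    then show ?thesis using that by (simp add: res_id)
  qed
  then show ?thesis
    unfolding U0_def s r sum.distrib [symmetric] using N by (intro sum.cong) (auto simp: mono_of_def)
qed

text \<open>A monomial of \<open>U0\<close> contains every generator once, whatever its idempotent.
  Moving a \<open>\<rho>\<close> from one end to the other turns one kind into the other, and
  \<open>V f\<close> can be cancelled; hence \<open>U0\<close> is homogeneous.\<close>

lemma weight_srs: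
  assumes f: "f \<in> {1..N}"
  shows "word_weight N (lab N f (srs N)) = (\<Prod>l = 1..N. (if l = N then V (N + 1) else 1) * V l)"
    and "word_weight N (lab N f (rss N)) = word_weight N (lab N f (srs N))"
proof -
  have "word_weight N (lab N f (srs n)) =
      (\<Prod>i = 1..n. (if (prev N ^^ i) f = N then V (N + 1) else 1) * V ((prev N ^^ i) f))" for n
  proof (induction n arbitrary: f)
    case (Suc n)
    let ?g = "\<lambda>i. (if (prev N ^^ i) f = N then V (N + 1) else 1) * V ((prev N ^^ i) f)"
    have "prod ?g {1..Suc n} = ?g 1 * prod ?g {Suc 1..Suc n}" by (rule prod.atLeast_Suc_atMost) simp
    then show ?case using Suc.IH [of "prev N f"] unfolding prod.shift_bounds_cl_Suc_ivl
      by (simp add: srs_Suc funpow_swap1 mult.assoc)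
  qed (simp add: srs_def)
  then show "word_weight N (lab N f (srs N)) = (\<Prod>l = 1..N. (if l = N then V (N + 1) else 1) * V l)"
    using prod.reindex_bij_betw [OF prev_orbit(1) [OF f], of "\<lambda>l. (if l = N then V (N + 1) else 1) * V l"]
    by simp
  have cs: "cnt (rss n) = n" for n by (induction n) (simp_all add: srs_Suc, simp add: rss_def)
  have "rss n @ [Rh] = Rh # srs n" for n by (induction n) (simp_all add: srs_Suc, simp add: srs_def rss_def)
  then have "lab N f (rss N @ [Rh]) = Rho f # lab N f (srs N)" by simp
  then have "lab N f (rss N) @ [Rho f] = Rho f # lab N f (srs N)"
    using prev_orbit(2) [OF f] by (simp add: lab_append shift_def cs)
  then have "word_weight N (lab N f (rss N)) * V f = V f * word_weight N (lab N f (srs N))"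
    by (metis word_weight_simps gweight.simps(1) mult.right_neutral)
  then show "word_weight N (lab N f (rss N)) = word_weight N (lab N f (srs N))" by (simp add: mult.commute)
qed

text \<open>In a nonempty matching sequence only the two summands of \<open>U0\<close> with the
  idempotent of the slot fit, and they reduce to \<open>bar_curvature\<close>. For the empty
  sequence each idempotent \<open>i\<close> contributes, and the two monomials belonging to
  \<open>i\<close> already have equal differentials.\<close>

theorem mono_curvature:
  assumes N: "N \<ge> 2" and ts: "set ts \<subseteq> monomials N"
  shows "splits (\<lambda>A C. lin (\<lambda>m. mu_mono N (A @ m # C)) (U0 N)) ts = 0"
proof -
  let ?B = "\<lambda>f A C. bar N (eval_at N f) (map pat A @ srs N # map pat C) +
    bar N (eval_at N f) (map pat A @ rss N # map pat C)"
  define G0 where "G0 = (\<Prod>l = 1..N. (if l = N then V (N + 1) else 1) * V l)"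
  have c: "cnt (srs n) = n" "cnt (rss n) = n" for n
    by (induction n) (simp_all add: srs_Suc, simp_all add: srs_def rss_def)
  have U: "mono_of N i u \<in> monomials N" "final N (mono_of N i u) = i" "initial (mono_of N i u) = i"
      "pat (mono_of N i u) = u" "mono_weight N (mono_of N i u) = G0"
    if i: "i \<in> {1..N}" and u: "u = srs N \<or> u = rss N" for i u
    using u altw_srs [of N] weight_srs [OF i] prev_orbit(2) [OF i] c i
    by (auto simp: altw_def mono_of_in final_mono_of initial_mono_of pat_mono_of shift_def
        mono_weight_mono_of G0_def)
  define h where "h A C i = mu_mono N (A @ mono_of N i (srs N) # C) + mu_mono N (A @ mono_of N i (rss N) # C)" for A C i
  have lin: "lin (\<lambda>m. mu_mono N (A @ m # C)) (U0 N) = (\<Sum>i = 1..N. h A C i)" for A C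
    using N by (simp add: U0_eq lin_sum lin_add h_def)
  have h1: "rescale N (h A C i) = smul (seq_weight N (A @ C) * G0)
      (?B f A C)"
    if i: "i \<in> {1..N}" and AC: "set (A @ C) \<subseteq> monomials N" "idempotents_match N (A @ C)"
      and f: "f = (if A = [] then i else final N (hd A))"
      and iA: "A \<noteq> [] \<Longrightarrow> initial (last A) = i" and iC: "C \<noteq> [] \<Longrightarrow> final N (hd C) = i" for A C i f
  proof -
    have "rescale N (mu_mono N (A @ mono_of N i u # C)) =
        smul (seq_weight N (A @ C) * G0) (bar N (eval_at N f) (map pat A @ u # map pat C))"
      if u: "u = srs N \<or> u = rss N" for u
    proof -
      have "idempotents_match N (A @ mono_of N i u # C)"
      proof -
        have "A = [] \<or> initial (last A) = i" "C = [] \<or> final N (hd C) = i" using iA iC by auto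
        then show ?thesis
          using AC U [OF i u] by (auto simp: idempotents_match_append idempotents_match_Cons)
      qed
      moreover have "final N (hd (A @ mono_of N i u # C)) = f" using f U [OF i u] by auto
      ultimately show ?thesis
        using rescale_mu_mono [OF N, of "A @ mono_of N i u # C"] AC U [OF i u] by (simp add: ac_simps)
    qed
    then show ?thesis by (simp add: h_def rescale_add smul_add)
  qed
  have alt: "altw t" if "t \<in> set (map pat ts)" for t using that ts monomials_cases(2) by auto
  have curv: "splits (\<lambda>A C. bar N (eval_at N f) (A @ srs N # C) + bar N (eval_at N f) (A @ rss N # C)) us = 0"
    if "\<And>t. t \<in> set us \<Longrightarrow> altw t" for f us
    using N by (intro bar_curvature that eval_at_0) auto
  show ?thesis
  proof (cases "ts = []")
    case True
    have "rescale N (h [] [] i) = 0" if "i \<in> {1..N}" for i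
      using h1 [of i "[]" "[]" i] curv [of "[]" i] that by (simp add: idempotents_match_def)
    then show ?thesis by (simp add: True lin)
  next
    case ts0: False
    show ?thesis
    proof (cases "idempotents_match N ts")
      case False
      show ?thesis
      proof (rule splits_zero)
        fix A C assume AC: "A @ C = ts"
        have "h A C i = 0" if i: "i \<in> {1..N}" for i
        proof -
          have "\<not> idempotents_match N (A @ mono_of N i u # C)" if u: "u = srs N \<or> u = rss N" for u
            using False U [OF i u] by (auto simp: idempotents_match_append idempotents_match_Cons simp flip: AC)
          then show ?thesis by (simp add: h_def mu_mono_mismatch)
        qed
        then show "lin (\<lambda>m. mu_mono N (A @ m # C)) (U0 N) = 0" by (simp add: lin)
      qed
    next
      case True
      define f where "f = final N (hd ts)"
      have main: "rescale N (lin (\<lambda>m. mu_mono N (A @ m # C)) (U0 N)) = smul (seq_weight N ts * G0)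
          (?B f A C)"
        if AC: "A @ C = ts" for A C
      proof -
        define j where "j = (if C = [] then initial (last A) else final N (hd C))"
        have jA: "initial (last A) = j" if "A \<noteq> []"
          using that True by (auto simp: j_def idempotents_match_append simp flip: AC)
        have jC: "final N (hd C) = j" if "C \<noteq> []" using that by (simp add: j_def)
        have mono: "initial m \<in> {1..N} \<and> final N m \<in> {1..N}" if "m \<in> set ts" for m
        proof -
          have m: "m \<in> monomials N" using ts that by auto
          then have "initial m = shift N (final N m) (pat m)"
            using initial_mono_of [of "pat m" N "final N m"] monomials_cases [OF m] by (simp add: altw_def)
          then show ?thesis using shift_in monomials_cases(3) [OF m] by simp
        qed
        have j: "j \<in> {1..N}"
        proof (cases "C = []")
          case True
          then have "last A \<in> set ts" using AC ts0 by auto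
          then show ?thesis using mono True by (simp add: j_def)
        next
          case False
          then have "hd C \<in> set ts" using AC by auto
          then show ?thesis using mono False by (simp add: j_def)
        qed
        have "h A C i = (if i = j then h A C j else 0)" if i: "i \<in> {1..N}" for i
        proof (cases "i = j")
          case False
          have "\<not> idempotents_match N (A @ mono_of N i u # C)" if u: "u = srs N \<or> u = rss N" for u
          proof -
            have "A = [] \<or> initial (last A) = j" "C = [] \<or> final N (hd C) = j" "A \<noteq> [] \<or> C \<noteq> []"
              using jA jC ts0 AC by auto
            then show ?thesis
              using False U [OF i u] by (auto simp: idempotents_match_append idempotents_match_Cons)
          qed
          then show ?thesis using False by (simp add: h_def mu_mono_mismatch)
        qed simp
        then have "lin (\<lambda>m. mu_mono N (A @ m # C)) (U0 N) = (\<Sum>i = 1..N. if i = j then h A C j else 0)"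
          unfolding lin by (rule sum.cong [OF refl])
        also have "\<dots> = h A C j" using j by simp
        finally have linj: "lin (\<lambda>m. mu_mono N (A @ m # C)) (U0 N) = h A C j" .
        show ?thesis
        proof -
          have "f = (if A = [] then j else final N (hd A))"
            using AC ts0 jC by (cases "A = []") (auto simp: f_def)
          then have "rescale N (h A C j) = smul (seq_weight N (A @ C) * G0)
              (?B f A C)"
            using ts True jA jC by (intro h1 j) (simp_all add: AC)
          then show ?thesis
            unfolding linj by (simp only: AC)
        qed
      qed
      have "rescale N (splits (\<lambda>A C. lin (\<lambda>m. mu_mono N (A @ m # C)) (U0 N)) ts) =
          splits (\<lambda>A C. rescale N (lin (\<lambda>m. mu_mono N (A @ m # C)) (U0 N))) ts"
        by (rule splits_natural) (simp_all add: rescale_add)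
      also have "\<dots> = splits (\<lambda>A C. smul (seq_weight N ts * G0)
          (?B f A C)) ts"
        by (rule splits_cong) (rule main)
      also have "\<dots> = smul (seq_weight N ts * G0) (splits (\<lambda>A C.
          ?B f A C) ts)"
        by (rule splits_natural [symmetric]) (simp_all add: smul_add)
      also have "\<dots> = 0" using curv [of "map pat ts" f] alt by (simp add: splits_map)
      finally show ?thesis by simp
    qed
  qed
qed

section \<open>Multilinear extension\<close>

fun mlin :: "(mono list \<Rightarrow> alg) \<Rightarrow> alg list \<Rightarrow> alg" where
  "mlin F [] = F []"
| "mlin F (x # xs) = lin (\<lambda>m. mlin (\<lambda>ms. F (m # ms)) xs) x"

lemma mlin_0 [simp]: "mlin (\<lambda>ms. 0) xs = 0"
  by (induction xs) simp_all

lemma mlin_add: "mlin (\<lambda>ms. F ms + G ms) xs = mlin F xs + mlin G xs"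
  by (induction xs arbitrary: F G) (simp_all add: lin_add_fun)

lemma mlin_smul: "mlin (\<lambda>ms. smul c (F ms)) xs = smul c (mlin F xs)"
  by (induction xs arbitrary: F) (simp_all add: lin_smul_fun)

lemma mlin_sum: "mlin (\<lambda>ms. \<Sum>a\<in>A. F a ms) xs = (\<Sum>a\<in>A. mlin (F a) xs)"
  by (induction A rule: infinite_finite_induct) (simp_all add: mlin_add)

lemma mlin_lin: "mlin (\<lambda>ms. lin (\<lambda>m. F m ms) x) xs = lin (\<lambda>m. mlin (F m) xs) x"
  by (simp add: lin_def mlin_sum mlin_smul)

lemma lin_mlin: "lin h (mlin F xs) = mlin (\<lambda>ms. lin h (F ms)) xs"
  by (induction xs arbitrary: F) (simp_all add: lin_lin)

lemma mlin_append: "mlin F (xs @ ys) = mlin (\<lambda>ms. mlin (\<lambda>ns. F (ms @ ns)) ys) xs"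
  by (induction xs arbitrary: F) simp_all

lemma mlin_cong:
  assumes "\<And>ms. list_all2 (\<lambda>m x. m \<in> Poly_Mapping.keys x) ms xs \<Longrightarrow> F ms = G ms"
  shows "mlin F xs = mlin G xs"
  using assms
proof (induction xs arbitrary: F G)
  case (Cons x xs)
  have "mlin (\<lambda>ms. F (m # ms)) xs = mlin (\<lambda>ms. G (m # ms)) xs" if "m \<in> Poly_Mapping.keys x" for m
    using that by (intro Cons.IH Cons.prems) simp
  then show ?case by (simp cong: lin_cong)
qed simp

lemma mlin_splits: "mlin (\<lambda>ms. splits (\<lambda>x y. F x y ms) w) xs = splits (\<lambda>x y. mlin (F x y) xs) w"
  by (induction w arbitrary: F) (simp_all add: mlin_add)

lemma lin_splits: "lin (\<lambda>m. splits (\<lambda>x y. F x y m) w) a = splits (\<lambda>x y. lin (F x y) a) w"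
  by (induction w arbitrary: F) (simp_all add: lin_add_fun)

lemma splits_mlin: "splits (\<lambda>A W. mlin (\<lambda>a. mlin (\<lambda>w. K a w) W) A) xs = mlin (splits K) xs"
proof (induction xs arbitrary: K)
  case (Cons x xs)
  have "splits (\<lambda>A W. mlin (\<lambda>a. mlin (\<lambda>w. K a w) W) (x # A)) xs =
      lin (\<lambda>m. mlin (splits (\<lambda>a. K (m # a))) xs) x"
    by (simp add: Cons.IH [symmetric] lin_splits)
  then show ?case by (simp add: mlin_add lin_add_fun)
qed simp

text \<open>Decomposing a list of algebra elements commutes with multilinear extension, which
  reduces the relation to lists of monomials.\<close>

lemma splits3_mlin:
  "splits3 (\<lambda>A B C. mlin (\<lambda>a. mlin (\<lambda>b. mlin (\<lambda>c. K a b c) C) B) A) xs = mlin (splits3 K) xs"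
proof -
  have "splits (\<lambda>B C. mlin (\<lambda>a. mlin (\<lambda>b. mlin (\<lambda>c. K a b c) C) B) A) W =
      mlin (\<lambda>a. mlin (splits (K a)) W) A" for A W
    by (simp add: splits_mlin flip: mlin_splits)
  then have "splits3 (\<lambda>A B C. mlin (\<lambda>a. mlin (\<lambda>b. mlin (\<lambda>c. K a b c) C) B) A) xs =
      splits (\<lambda>A W. mlin (\<lambda>a. mlin (splits (K a)) W) A) xs"
    unfolding splits3_def by (intro splits_cong)
  also have "\<dots> = mlin (splits3 K) xs"
    by (simp add: splits_mlin splits3_def [abs_def])
  finally show ?thesis .
qed

lemma mu_0_mlin: "mu N 0 xs = mlin (mu_mono N) xs"
proof -
  have "(\<Sum>ms\<in>listset (map Poly_Mapping.keys xs). smul (prod_list (map2 Poly_Mapping.lookup xs ms)) (F ms)) = mlin F xs"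
    for F :: "mono list \<Rightarrow> alg"
  proof (induction xs arbitrary: F)
    case (Cons x xs)
    let ?L = "listset (map Poly_Mapping.keys xs)"
    have L: "listset (map Poly_Mapping.keys (x # xs)) = (\<lambda>(m, ms). m # ms) ` (Poly_Mapping.keys x \<times> ?L)"
      by (auto simp: set_Cons_def)
    have "inj_on (\<lambda>(m, ms). m # ms) (Poly_Mapping.keys x \<times> ?L)" by (auto simp: inj_on_def)
    then have "(\<Sum>ms\<in>listset (map Poly_Mapping.keys (x # xs)).
        smul (prod_list (map2 Poly_Mapping.lookup (x # xs) ms)) (F ms)) =
      (\<Sum>m\<in>Poly_Mapping.keys x. \<Sum>ms\<in>?L.
        smul (Poly_Mapping.lookup x m) (smul (prod_list (map2 Poly_Mapping.lookup xs ms)) (F (m # ms))))"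
      unfolding L by (subst sum.reindex) (simp_all add: sum.cartesian_product o_def case_prod_beta)
    also have "\<dots> = mlin F (x # xs)"
      by (simp add: lin_def smul_sum flip: Cons.IH)
    finally show ?case .
  qed simp
  then show ?thesis by (simp add: mu_def)
qed

lemma mu_0_insert: "mu N 0 (A @ [y] @ C) = mlin (\<lambda>a. mlin (\<lambda>c. lin (\<lambda>m. mu_mono N (a @ m # c)) y) C) A"
  by (simp add: mu_0_mlin mlin_append mlin_lin)

lemma mu_0_nested: "mu N 0 (A @ [mu N 0 B] @ C) =
    mlin (\<lambda>a. mlin (\<lambda>b. mlin (\<lambda>c. lin (\<lambda>m. mu_mono N (a @ m # c)) (mu_mono N b)) C) B) A"
proof -
  have "mlin (\<lambda>c. lin (\<lambda>m. mu_mono N (a @ m # c)) (mlin (mu_mono N) B)) C =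
      mlin (\<lambda>b. mlin (\<lambda>c. lin (\<lambda>m. mu_mono N (a @ m # c)) (mu_mono N b)) C) B" for a
    by (simp only: mlin_lin) (rule lin_mlin)
  then show ?thesis unfolding mu_0_insert by (simp add: mu_0_mlin)
qed

lemma in_monomials_of_keys:
  assumes "list_all2 (\<lambda>m x. m \<in> Poly_Mapping.keys x) ms xs"
    and "\<And>x. x \<in> set xs \<Longrightarrow> Poly_Mapping.keys x \<subseteq> monomials N"
  shows "set ms \<subseteq> monomials N"
  using assms by (induction ms xs rule: list_all2_induct) auto

theorem mu_relation:
  assumes "N \<ge> 2" and xs: "\<And>x. x \<in> set xs \<Longrightarrow> Poly_Mapping.keys x \<subseteq> monomials N"
  shows "splits3 (\<lambda>A B C. mu N 0 (A @ [mu N 0 B] @ C)) xs = 0"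
proof -
  have "mlin (splits3 (\<lambda>a b c. lin (\<lambda>m. mu_mono N (a @ m # c)) (mu_mono N b))) xs = mlin (\<lambda>ms. 0) xs"
    by (rule mlin_cong) (rule mono_relation [OF assms(1) in_monomials_of_keys [OF _ xs]])
  then show ?thesis unfolding mu_0_nested splits3_mlin by simp
qed

theorem mu_curvature:
  assumes "N \<ge> 2" and xs: "\<And>x. x \<in> set xs \<Longrightarrow> Poly_Mapping.keys x \<subseteq> monomials N"
  shows "splits (\<lambda>A C. mu N 0 (A @ [U0 N] @ C)) xs = 0"
proof -
  have "mlin (splits (\<lambda>a c. lin (\<lambda>m. mu_mono N (a @ m # c)) (U0 N))) xs = mlin (\<lambda>ms. 0) xs"
    by (rule mlin_cong) (rule mono_curvature [OF assms(1) in_monomials_of_keys [OF _ xs]])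
  then show ?thesis unfolding mu_0_insert splits_mlin by simp
qed

text \<open>Inputs are listed from the last to the first, so \<open>r\<close> is the length of the
  middle piece, \<open>p\<close> that of the right piece, and the left piece has the remaining
  \<open>length xs - p - r\<close> entries.\<close>

lemma splits3_index:
  "splits3 F xs = (\<Sum>r = 0..length xs. \<Sum>p = 0..length xs - r.
     F (take (length xs - p - r) xs) (take r (drop (length xs - p - r) xs)) (drop (length xs - p) xs))"
proof -
  let ?k = "length xs"
  have "splits3 F xs = (\<Sum>a\<le>?k. \<Sum>r\<le>?k - a. F (take a xs) (take r (drop a xs)) (drop r (drop a xs)))"
    by (simp add: splits3_def splits_index)
  also have "\<dots> = (\<Sum>(a, r)\<in>(SIGMA a:{..?k}. {..?k - a}). F (take a xs) (take r (drop a xs)) (drop r (drop a xs)))"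
    by (subst sum.Sigma) simp_all
  also have "\<dots> = (\<Sum>(r, p)\<in>(SIGMA r:{0..?k}. {0..?k - r}).
      F (take (?k - p - r) xs) (take r (drop (?k - p - r) xs)) (drop (?k - p) xs))"
  proof (rule sum.reindex_bij_witness [where i = "\<lambda>(r, p). (?k - p - r, r)" and j = "\<lambda>(a, r). (r, ?k - a - r)"])
    fix x assume "x \<in> (SIGMA a:{..?k}. {..?k - a})"
    then obtain a r where x: "x = (a, r)" "a + r \<le> ?k" by auto
    then have "?k - (?k - a - r) - r = a" "?k - (?k - a - r) = r + a" by auto
    then show "(case case x of (a, r) \<Rightarrow> (r, ?k - a - r) of (r, p) \<Rightarrow>
        F (take (?k - p - r) xs) (take r (drop (?k - p - r) xs)) (drop (?k - p) xs)) =
      (case x of (a, r) \<Rightarrow> F (take a xs) (take r (drop a xs)) (drop r (drop a xs)))"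
      unfolding x(1) by (simp only: prod.case drop_drop)
  qed auto
  also have "\<dots> = (\<Sum>r = 0..?k. \<Sum>p = 0..?k - r.
      F (take (?k - p - r) xs) (take r (drop (?k - p - r) xs)) (drop (?k - p) xs))"
    by (subst sum.Sigma) simp_all
  finally show ?thesis .
qed

lemma inputs_parts:
  assumes "p + r \<le> k"
  shows "inputs \<tau> k (p + r + 1) = take (k - p - r) (inputs \<tau> k 1)"
    and "inputs \<tau> (p + r) (p + 1) = take r (drop (k - p - r) (inputs \<tau> k 1))"
    and "inputs \<tau> p 1 = drop (k - p) (inputs \<tau> k 1)"
  using assms
  by (auto simp: inputs_def take_map drop_map rev_take rev_drop take_rev drop_rev min_def
      simp del: upt_Suc intro!: arg_cong [where f = "map \<tau>"])

lemma length_inputs [simp]: "length (inputs \<tau> k 1) = k"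
  by (simp add: inputs_def)

lemma weight_zero_decomp: "{(w', w''). w' + w'' = (0 :: weight)} = {(0, 0)}"
proof -
  have *: "w' = 0 \<and> w'' = 0" if "w' + w'' = 0" for w' w'' :: weight
  proof -
    have "Poly_Mapping.lookup w' k + Poly_Mapping.lookup w'' k = 0" for k
      using arg_cong [OF that, of "\<lambda>w. Poly_Mapping.lookup w k"] by (simp add: lookup_add)
    then show ?thesis by (auto intro!: poly_mapping_eqI)
  qed
  show ?thesis by (auto dest: *)
qed

lemma weight_eps_decomp: "{(w', w''). w' + w'' = eps 0} = {(0, eps 0), (eps 0, 0)}"
proof -
  have *: "w' = 0 \<and> w'' = eps 0 \<or> w' = eps 0 \<and> w'' = 0" if e: "w' + w'' = eps 0" for w' w'' :: weight
  proof -
    have l: "Poly_Mapping.lookup w' k + Poly_Mapping.lookup w'' k = (if k = 0 then 1 else 0)" for k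
      using arg_cong [OF e, of "\<lambda>w. Poly_Mapping.lookup w k"]
      by (simp add: lookup_add eps_def lookup_single when_def)
    consider "Poly_Mapping.lookup w' 0 = 0" | "Poly_Mapping.lookup w'' 0 = 0" using l [of 0] by (auto simp: add_is_1)
    then show ?thesis
    proof cases
      case 1
      have "w' = 0"
      proof (rule poly_mapping_eqI)
        fix k show "Poly_Mapping.lookup w' k = Poly_Mapping.lookup 0 k"
          using l [of k] 1 by (cases "k = 0") auto
      qed
      then show ?thesis using e by simp
    next
      case 2
      have "w'' = 0"
      proof (rule poly_mapping_eqI)
        fix k show "Poly_Mapping.lookup w'' k = Poly_Mapping.lookup 0 k"
          using l [of k] 2 by (cases "k = 0") auto
      qed
      then show ?thesis using e by simp
    qed
  qed
  show ?thesis by (auto dest: *)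
qed

lemma eps_neq_0 [simp]: "eps i \<noteq> 0"
  unfolding eps_def by (metis lookup_single_eq lookup_zero zero_neq_one)

lemma mu_zero_input: "mu N 0 (A @ [0] @ C) = 0"
  using mu_0_insert [of N A 0 C] by simp

lemma mu_weighted: "w \<noteq> 0 \<Longrightarrow> mu N w (A @ [y] @ C) = 0"
  by (simp add: mu_def)

theorem proposition5p5:
  fixes N k :: nat and w :: weight and \<tau> :: "nat \<Rightarrow> alg"
  assumes "N \<ge> 3"
    and "w \<in> weights N"
    and "\<And>j. j \<in> {1..k} \<Longrightarrow> \<tau> j \<in> alg_carrier N"
  shows "(\<Sum>(w', w'') \<in> {(w', w''). w' + w'' = w}.
            \<Sum>r = 0..k. \<Sum>p = 0..k - r.
              mu N w' (inputs \<tau> k (p + r + 1) @ [mu N w'' (inputs \<tau> (p + r) (p + 1))] @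
                       inputs \<tau> p 1)) = 0"
proof -
  let ?xs = "inputs \<tau> k 1"
  let ?T = "\<lambda>w' w'' r p. mu N w' (inputs \<tau> k (p + r + 1) @ [mu N w'' (inputs \<tau> (p + r) (p + 1))] @ inputs \<tau> p 1)"
  let ?R = "\<lambda>w' w''. \<Sum>r = 0..k. \<Sum>p = 0..k - r. ?T w' w'' r p"
  have N: "N \<ge> 2" using assms(1) by simp
  have xs: "Poly_Mapping.keys x \<subseteq> monomials N" if "x \<in> set ?xs" for x
  proof -
    have *: "set ?xs = \<tau> ` {1..k}"
      unfolding inputs_def set_map set_rev set_upt atLeastLessThanSuc_atLeastAtMost by (rule refl)
    from that obtain j where j: "j \<in> {1..k}" "x = \<tau> j" unfolding * by (elim imageE) simp
    show ?thesis using assms(3) [OF j(1)] unfolding alg_carrier_def j(2) by simp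
  qed
  have R: "?R w' w'' = splits3 (\<lambda>A B C. mu N w' (A @ [mu N w'' B] @ C)) ?xs" for w' w''
    unfolding splits3_index length_inputs
  proof (intro sum.cong refl)
    fix r p assume "r \<in> {0..k}" "p \<in> {0..k - r}"
    then have pr: "p + r \<le> k" by auto
    show "?T w' w'' r p = mu N w' (take (k - p - r) ?xs @
        [mu N w'' (take r (drop (k - p - r) ?xs))] @ drop (k - p) ?xs)"
      by (simp only: inputs_parts [OF pr, of \<tau>])
  qed
  \<comment> \<open>The outer operation always has at least one input, while nonzero weights occur
    only without inputs.\<close>
  have weighted: "?R w' w'' = 0" if "w' \<noteq> 0" for w' w''
    by (intro sum.neutral ballI mu_weighted that)
  consider "w = 0" | "w = eps 0" | "w \<noteq> 0" "w \<noteq> eps 0" by blast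
  then show ?thesis
  proof cases
    case 1
    have "?R 0 0 = 0" unfolding R by (rule mu_relation [OF N xs])
    then show ?thesis by (simp only: 1 weight_zero_decomp) simp
  next
    case 2
    have "?R 0 (eps 0) = splits3 (\<lambda>A B C. if B = [] then mu N 0 (A @ [U0 N] @ C) else 0) ?xs"
      unfolding R by (rule splits3_cong) (auto simp: mu_def [of N "eps 0"] mu_zero_input [simplified])
    also have "\<dots> = splits (\<lambda>A C. mu N 0 (A @ [U0 N] @ C)) ?xs"
      unfolding splits3_def by (intro splits_cong) (subst splits_single [where n = 0], auto)
    also have "\<dots> = 0" by (rule mu_curvature [OF N xs])
    finally have "?R 0 (eps 0) = 0" .
    moreover have "?R (eps 0) 0 = 0" by (rule weighted) simp
    ultimately show ?thesis
      by (simp only: 2 weight_eps_decomp) simp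
  next
    case 3
    \<comment> \<open>Outer weight 0 leaves all of \<open>w\<close> to the inner operation, and no
      operation has this weight.\<close>
    have "?R w' w'' = 0" if "w' + w'' = w" for w' w''
    proof (cases "w' = 0")
      case True
      then have "mu N w'' B = 0" for B using 3 that by (simp add: mu_def)
      then show ?thesis using True by (simp only: mu_zero_input sum.neutral_const)
    qed (rule weighted)
    then show ?thesis by (intro sum.neutral) auto
  qed
qed

end
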